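(* Let $m,s$ be integers with $1\le s\le m-1$, and suppose that none of the following holds: (1) $s\in\{1,2\}$ and $m\ge 2s+1$; (2) $s\in\{3,4\}$, $m$ is odd and $m\ge 7$; (3) $m$ is odd and $s=m-2$. Consider the $(m,s)$ secure decentralized pliable index coding problem with circular side information sets. Then: (a) if $\frac{m}{m-s}\in\mathbb{Z}$, there is a valid scheme of normalized code length $\ell\le\frac{m}{s}$; (b) if $\frac{m}{m-s}\notin\mathbb{Z}$ and $m>2s$, there is a valid linear scheme of normalized code length $\ell\le\frac{3m}{2s}+3$; (c) if $\frac{m}{m-s}\notin\mathbb{Z}$ and $m<2s$, there is a valid linear scheme of normalized code length $\ell\le 2+7=9$. Equivalently, the smallest normalized code length $\ell^*$ (over all valid schemes in case (a), over all valid linear schemes in cases (b) and (c)) satisfies these upper bounds.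
   Context: The $(m,s)$ secure decentralized pliable index coding (PICOD) problem with circular side information, $1\le s\le m-1$. There are $m$ messages $w_1,\dots,w_m$ and $m$ users $u_1,\dots,u_m$. For a message length $\kappa\in\mathbb{N}$, $\kappa\ge1$ (which the scheme may choose), the messages are independent and uniformly distributed vectors in $\mathbb{F}_2^{\kappa}$. For $A\subseteq[m]=\{1,\dots,m\}$ write $W_A=\{w_i: i\in A\}$. User $u_i$ knows $W_{A_i}$ as side information, where $A_i=\{i,i-1,\dots,i-s+1\}$ with indices taken modulo $m$ in $[m]$. The collection $\mathcal{A}=\{A_1,\dots,A_m\}$ is known to all users. There is no central transmitter. Each user $i$ broadcasts, without error and to all users, a string $x_i=\mathbf{ENC}_i(W_{A_i},\mathcal{A})\in\mathbb{F}_2^{\kappa\ell_i}$, a deterministic function of its own side information, where $\ell_i\ge0$ and $\kappa\ell_i$ is a nonnegative integer. The overall transmission is $x=(x_1,\dots,x_m)$, with normalized code length $\ell=\sum_{i=1}^m\ell_i$. A scheme (choice of $\kappa$ and of the encoding functions) is valid if for every $i\in[m]$ there is an index $d_i\in[m]\setminus A_i$ such that: - (decodability) $w_{d_i}$ is a function of $(x,W_{A_i})$; - (security) $I(w_j;\,x,W_{A_i})=0$ for all $j\in[m]\setminus(A_i\cup\{d_i\})$, where $I$ denotes mutual information; that is, each such $w_j$ is individually independent of $(x,W_{A_i})$. A scheme is linear if each $\mathbf{ENC}_i$ is an $\mathbb{F}_2$-linear map of the message vectors in $W_{A_i}$. *)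

theory Defs
  imports
    "HOL-Library.Z2"
    "HOL-Number_Theory.Cong"
    "HOL-Probability.Probability"
    "Jordan_Normal_Form.Matrix"
begin

section \<open>Secure decentralized pliable index coding with circular side information\<close>

text \<open>
  The field \<open>\<bbbF>\<^sub>2\<close> is the type \<^typ>\<open>bit\<close>, and \<open>\<bbbF>\<^sub>2\<^sup>\<kappa>\<close> is \<open>carrier_vec \<kappa>\<close>. A family of vectors
  indexed by \<open>A\<close>, such as \<open>W\<^sub>A\<close>, is an element of a \<^const>\<open>PiE\<close>; hence \<open>W\<^sub>A = restrict w A\<close>.
\<close>

definition side_info :: "nat \<Rightarrow> nat \<Rightarrow> nat \<Rightarrow> nat set" where
  "side_info m s i = {j \<in> {1..m}. \<exists>k<s. [int j = int i - int k] (mod int m)}"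

definition msg_tuples :: "nat set \<Rightarrow> nat \<Rightarrow> (nat \<Rightarrow> bit vec) set" where
  "msg_tuples A \<kappa> = (\<Pi>\<^sub>E j\<in>A. carrier_vec \<kappa>)"

definition msg_space :: "nat \<Rightarrow> nat \<Rightarrow> (nat \<Rightarrow> bit vec) measure" where
  "msg_space m \<kappa> = PiM {1..m} (\<lambda>_. uniform_count_measure (carrier_vec \<kappa>))"

text \<open>
  A scheme is given by the message length \<open>\<kappa>\<close>, the numbers \<open>n i = \<kappa> \<ell>\<^sub>i\<close> of bits sent by the users,
  and the encoders \<open>enc i\<close>.
\<close>

definition transmission ::
    "nat \<Rightarrow> nat \<Rightarrow> (nat \<Rightarrow> (nat \<Rightarrow> bit vec) \<Rightarrow> bit vec) \<Rightarrow> (nat \<Rightarrow> bit vec) \<Rightarrow> nat \<Rightarrow> bit vec" where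
  "transmission m s enc w = (\<lambda>i\<in>{1..m}. enc i (restrict w (side_info m s i)))"

definition user_view ::
    "nat \<Rightarrow> nat \<Rightarrow> (nat \<Rightarrow> (nat \<Rightarrow> bit vec) \<Rightarrow> bit vec) \<Rightarrow> nat \<Rightarrow> (nat \<Rightarrow> bit vec) \<Rightarrow>
      (nat \<Rightarrow> bit vec) \<times> (nat \<Rightarrow> bit vec)" where
  "user_view m s enc i w = (transmission m s enc w, restrict w (side_info m s i))"

definition code_length :: "nat \<Rightarrow> nat \<Rightarrow> (nat \<Rightarrow> nat) \<Rightarrow> real" where
  "code_length m \<kappa> n = (\<Sum>i=1..m. real (n i) / real \<kappa>)"

definition decodable ::
    "nat \<Rightarrow> nat \<Rightarrow> nat \<Rightarrow> (nat \<Rightarrow> (nat \<Rightarrow> bit vec) \<Rightarrow> bit vec) \<Rightarrow> nat \<Rightarrow> nat \<Rightarrow> bool" where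
  "decodable m s \<kappa> enc i d \<longleftrightarrow>
    (\<exists>dec. \<forall>w \<in> msg_tuples {1..m} \<kappa>. dec (user_view m s enc i w) = w d)"

text \<open>
  Mutual information is taken with respect to the discrete sigma-algebras on the (finite) ranges
  of the two random variables.
\<close>

definition mutual_info :: "'a measure \<Rightarrow> ('a \<Rightarrow> 'b) \<Rightarrow> ('a \<Rightarrow> 'c) \<Rightarrow> real" where
  "mutual_info M X Y = prob_space.mutual_information M 2
     (count_space (X ` space M)) (count_space (Y ` space M)) X Y"

definition secure ::
    "nat \<Rightarrow> nat \<Rightarrow> nat \<Rightarrow> (nat \<Rightarrow> (nat \<Rightarrow> bit vec) \<Rightarrow> bit vec) \<Rightarrow> nat \<Rightarrow> nat \<Rightarrow> bool" where
  "secure m s \<kappa> enc i d \<longleftrightarrow>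
    (\<forall>j \<in> {1..m} - (side_info m s i \<union> {d}).
       mutual_info (msg_space m \<kappa>) (\<lambda>w. w j) (user_view m s enc i) = 0)"

definition valid_scheme ::
    "nat \<Rightarrow> nat \<Rightarrow> nat \<Rightarrow> (nat \<Rightarrow> nat) \<Rightarrow> (nat \<Rightarrow> (nat \<Rightarrow> bit vec) \<Rightarrow> bit vec) \<Rightarrow> bool" where
  "valid_scheme m s \<kappa> n enc \<longleftrightarrow>
    1 \<le> \<kappa> \<and>
    (\<forall>i\<in>{1..m}. enc i \<in> msg_tuples (side_info m s i) \<kappa> \<rightarrow> carrier_vec (n i)) \<and>
    (\<forall>i\<in>{1..m}. \<exists>d \<in> {1..m} - side_info m s i.
       decodable m s \<kappa> enc i d \<and> secure m s \<kappa> enc i d)"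

definition linear_scheme ::
    "nat \<Rightarrow> nat \<Rightarrow> nat \<Rightarrow> (nat \<Rightarrow> (nat \<Rightarrow> bit vec) \<Rightarrow> bit vec) \<Rightarrow> bool" where
  "linear_scheme m s \<kappa> enc \<longleftrightarrow>
    (\<forall>i\<in>{1..m}.
      (\<forall>u \<in> msg_tuples (side_info m s i) \<kappa>. \<forall>v \<in> msg_tuples (side_info m s i) \<kappa>.
         enc i (\<lambda>j\<in>side_info m s i. u j + v j) = enc i u + enc i v) \<and>
      (\<forall>c. \<forall>u \<in> msg_tuples (side_info m s i) \<kappa>.
         enc i (\<lambda>j\<in>side_info m s i. c \<cdot>\<^sub>v u j) = c \<cdot>\<^sub>v enc i u))"

subsection \<open>Basic facts about the message space\<close>

lemma finite_carrier_vec_bit: "finite (carrier_vec \<kappa> :: bit vec set)"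
proof (rule finite_imageD)
  have "(UNIV :: bit set) = {0, 1}"
    by (auto intro: bit.exhaust)
  then have fin: "finite (UNIV :: bit set)"
    by (metis finite.emptyI finite.insertI)
  show "finite (list_of_vec ` (carrier_vec \<kappa> :: bit vec set))"
    by (rule finite_subset[OF _ finite_lists_length_eq[OF fin, of \<kappa>]]) auto
  show "inj_on list_of_vec (carrier_vec \<kappa> :: bit vec set)"
    by (metis inj_onI vec_list)
qed

lemma msg_space_eq_uniform:
  "msg_space m \<kappa> = uniform_count_measure (msg_tuples {1..m} \<kappa>)"
proof -
  let ?V = "carrier_vec \<kappa> :: bit vec set"
  have fin: "finite ?V" by (rule finite_carrier_vec_bit)
  have ne: "?V \<noteq> {}" using zero_carrier_vec by blast
  have card: "card (msg_tuples {1..m} \<kappa>) = card ?V ^ m"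
    unfolding msg_tuples_def by (simp add: card_PiE)
  have finT: "finite (msg_tuples {1..m} \<kappa>)"
    unfolding msg_tuples_def by (intro finite_PiE) (auto simp: fin)
  have "prob_space (uniform_count_measure ?V)"
    by (rule prob_space_uniform_count_measure[OF fin ne])
  then interpret product_sigma_finite "\<lambda>_::nat. uniform_count_measure ?V"
    unfolding product_sigma_finite_def using prob_space_imp_sigma_finite by blast
  have "uniform_count_measure (msg_tuples {1..m} \<kappa>)
      = PiM {1..m} (\<lambda>_. uniform_count_measure ?V)"
  proof (rule PiM_eqI)
    have "sets (PiM {1..m} (\<lambda>_. uniform_count_measure ?V)) = sets (PiM {1..m} (\<lambda>_. count_space ?V))"
      by (intro sets_PiM_cong) (auto simp: sets_uniform_count_measure)
    also have "\<dots> = sets (count_space (msg_tuples {1..m} \<kappa>))"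
      unfolding msg_tuples_def
      by (subst count_space_PiM_finite) (auto simp: fin countable_finite)
    finally show "sets (uniform_count_measure (msg_tuples {1..m} \<kappa>))
        = sets (PiM {1..m} (\<lambda>_. uniform_count_measure ?V))"
      by (simp add: sets_uniform_count_measure)
  next
    fix A :: "nat \<Rightarrow> bit vec set"
    assume "\<And>i. i \<in> {1..m} \<Longrightarrow> A i \<in> sets (uniform_count_measure ?V)"
    then have A: "\<And>i. i \<in> {1..m} \<Longrightarrow> A i \<subseteq> ?V"
      by (simp add: sets_uniform_count_measure)
    have "emeasure (uniform_count_measure (msg_tuples {1..m} \<kappa>)) (Pi\<^sub>E {1..m} A)
        = ennreal (real (card (Pi\<^sub>E {1..m} A)) / real (card ?V ^ m))"
      using A PiE_mono[of "{1..m}" A "\<lambda>_. ?V"]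
      by (subst emeasure_uniform_count_measure[OF finT])
        (simp_all only: card[symmetric] msg_tuples_def)
    also have "real (card (Pi\<^sub>E {1..m} A)) / real (card ?V ^ m)
        = (\<Prod>i\<in>{1..m}. real (card (A i)) / real (card ?V))"
      by (simp add: card_PiE prod_dividef)
    also have "ennreal \<dots> = (\<Prod>i\<in>{1..m}. ennreal (real (card (A i)) / real (card ?V)))"
      by (simp add: prod_ennreal)
    also have "\<dots> = (\<Prod>i\<in>{1..m}. emeasure (uniform_count_measure ?V) (A i))"
      using A by (intro prod.cong refl) (simp add: emeasure_uniform_count_measure fin)
    finally show "emeasure (uniform_count_measure (msg_tuples {1..m} \<kappa>)) (Pi\<^sub>E {1..m} A)
        = (\<Prod>i\<in>{1..m}. emeasure (uniform_count_measure ?V) (A i))" .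
  qed simp
  then show ?thesis by (simp add: msg_space_def)
qed

end

theory Submission
  imports Defs
begin

text \<open>
  Outside case (a) the schemes are scalar linear codes over the field with four elements, that is
  \<open>\<kappa> = 2\<close>: every transmission is a linear combination of messages, all known to one user. User
  \<open>u\<close> decodes \<open>d\<close> if some transmission contains \<open>d\<close> as its only unknown message, and learns
  nothing about another unknown message \<open>j\<close> as soon as some word that vanishes on the known
  messages and on \<open>d\<close>, but not at \<open>j\<close>, is orthogonal to all transmissions. Both conditions depend
  only on the pattern of known messages at the positions that carry a nonzero coefficient.

  For \<open>m > 2 s\<close> the circle is cut into blocks of length \<open>2 s\<close>, each served by three transmissions,
  and a remainder. For \<open>m < 2 s\<close> a code for \<open>(m, s)\<close> with \<open>g = m - s\<close> yields one for
  \<open>(m + g, s + g)\<close> with the same number of transmissions, which reduces the problem to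
  \<open>2 g < m < 3 g\<close>, where few sparse codes suffice. In case (a) only the users at multiples of
  \<open>m - s\<close> transmit, and only messages at multiples of \<open>m - s\<close> are involved.
\<close>

text \<open>Secrecy is the obstacle. A user must see every codeword either with exactly one unknown
  position, which it decodes, or with enough unknown positions to hide all of them. A two-point
  codeword with distance \<open>\<delta> < s\<close> serves \<open>2 * \<delta>\<close> users,
  namely those who know exactly one end; everyone else knows both ends or neither, which is
  harmless. In a block of \<open>2 * s\<close> positions three distances adding up to
  \<open>s\<close> therefore serve every user once. The bound \<open>3 * m / (2 * s) + 3\<close>
  thus leaves a remainder of length \<open>r\<close> at most \<open>3 * r / (2 * s) + 3\<close>
  codewords, and the remainder needs codewords with more points. There the users and the service
  capacities are counted: a cover whose total size is \<open>m\<close> is a partition, so no user is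
  served twice by accident. The spacing conditions of the remainder fail for a few short remainders;
  these borrow one block, or use an explicit code when there is no block to spare. In the dense case
  the explicit families break down exactly where two of their positions collide, which leads to the
  isolated small codes.\<close>

datatype f4 = F0 | F1 | Fa | Fb

instantiation f4 :: field
begin

definition "0 = F0"
definition "1 = F1"

fun plus_f4 :: "f4 \<Rightarrow> f4 \<Rightarrow> f4" where
  "F0 + y = y"
| "x + F0 = x"
| "F1 + F1 = F0" | "F1 + Fa = Fb" | "F1 + Fb = Fa"
| "Fa + F1 = Fb" | "Fa + Fa = F0" | "Fa + Fb = F1"
| "Fb + F1 = Fa" | "Fb + Fa = F1" | "Fb + Fb = F0"

fun times_f4 :: "f4 \<Rightarrow> f4 \<Rightarrow> f4" where
  "F0 * y = F0"
| "x * F0 = F0"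
| "F1 * y = y"
| "x * F1 = x"
| "Fa * Fa = Fb" | "Fa * Fb = F1" | "Fb * Fa = F1" | "Fb * Fb = Fa"

definition "- (x :: f4) = x"
definition "(x :: f4) - y = x + y"

fun inverse_f4 :: "f4 \<Rightarrow> f4" where
  "inverse F0 = F0" | "inverse F1 = F1" | "inverse Fa = Fb" | "inverse Fb = Fa"

definition "(x :: f4) div y = x * inverse y"

instance
proof
  fix a b c :: f4
  show "a + b + c = a + (b + c)" by (cases a; cases b; cases c) simp_all
  show "a + b = b + a" by (cases a; cases b) simp_all
  show "0 + a = a" by (cases a) (simp_all add: zero_f4_def)
  show "- a + a = 0" by (cases a) (simp_all add: zero_f4_def uminus_f4_def)
  show "a - b = a + - b" by (simp add: minus_f4_def uminus_f4_def)
  show "a * b * c = a * (b * c)" by (cases a; cases b; cases c) simp_all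
  show "a * b = b * a" by (cases a; cases b) simp_all
  show "1 * a = a" by (cases a) (simp_all add: one_f4_def)
  show "(a + b) * c = a * c + b * c" by (cases a; cases b; cases c) simp_all
  show "(0::f4) \<noteq> 1" by (simp add: zero_f4_def one_f4_def)
  show "a \<noteq> 0 \<Longrightarrow> inverse a * a = 1" by (cases a) (simp_all add: zero_f4_def one_f4_def)
  show "a div b = a * inverse b" by (simp add: divide_f4_def)
  show "inverse (0::f4) = 0" by (simp add: zero_f4_def)
qed

end

lemma f4_add_self [simp]: "x + x = (0::f4)"
  by (cases x) (simp_all add: zero_f4_def)

text \<open>This fails over the field with two elements, where two nonzero summands always add up to
  zero. It is the reason for working over \<open>f4\<close>.\<close>

lemma f4_split:
  fixes c :: f4
  obtains x y where "x \<noteq> 0" "y \<noteq> 0" "x + y = c"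
proof (cases "c = 0")
  case True
  then show ?thesis using that[of 1 1] by simp
next
  case False
  then show ?thesis using that[of F1 Fa] that[of F1 Fb] that[of Fa Fb]
    by (cases c) (simp_all add: zero_f4_def)
qed

subsection \<open>F4-linear codes\<close>

text \<open>Positions are residues \<open>0, ..., m - 1\<close>, with 0 standing for index
  \<open>m\<close>. Adding \<open>m\<close> before subtracting keeps natural subtraction exact for
  \<open>x < m\<close>.\<close>

definition knows :: "nat \<Rightarrow> nat \<Rightarrow> nat \<Rightarrow> nat \<Rightarrow> bool" where
  "knows m s u x \<longleftrightarrow> (u + m - x) mod m < s"

text \<open>One word \<open>f\<close> serves all unknown \<open>j\<close> at once: it is nonzero at
  every unknown position except \<open>d\<close>, and its multiples take every value at each of
  them.\<close>

definition good_code :: "nat \<Rightarrow> nat \<Rightarrow> nat \<Rightarrow> (nat \<Rightarrow> nat \<Rightarrow> f4) \<Rightarrow> bool" where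
  "good_code m s N c \<longleftrightarrow>
    (\<forall>k<N. \<exists>u<m. \<forall>x<m. c k x \<noteq> 0 \<longrightarrow> knows m s u x) \<and>
    (\<forall>u<m. \<exists>d<m. \<not> knows m s u d \<and>
       (\<exists>k<N. c k d \<noteq> 0 \<and> (\<forall>x<m. c k x \<noteq> 0 \<longrightarrow> x = d \<or> knows m s u x)) \<and>
       (\<exists>f. (\<forall>x<m. f x = 0 \<longleftrightarrow> x = d \<or> knows m s u x) \<and> (\<forall>k<N. (\<Sum>x<m. c k x * f x) = 0)))"

lemma knows_iff:
  assumes "u < m" "x < m" "s < m"
  shows "knows m s u x \<longleftrightarrow> x \<le> u \<and> u < x + s \<or> u + m < x + s"
proof (cases "x \<le> u")
  case True
  then have "(u + m - x) mod m = u - x"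
    using assms by (metis Nat.add_diff_assoc2 le_add_diff_inverse2 less_imp_diff_less mod_add_self2 mod_less)
  then show ?thesis using True assms by (auto simp: knows_def)
next
  case False
  then have "(u + m - x) mod m = u + m - x"
    using assms by simp
  then show ?thesis using False assms by (auto simp: knows_def)
qed

lemma knows_mod: "knows m s (u mod m) (x mod m) \<longleftrightarrow> (int u - int x) mod int m < int s" if "m > 0"
proof -
  have "x mod m \<le> u mod m + m"
    using that by (simp add: trans_le_add2 less_imp_le)
  then have "int ((u mod m + m - x mod m) mod m) = (int (u mod m) - int (x mod m) + int m) mod int m"
    by (simp only: zmod_int of_nat_diff of_nat_add) (simp add: algebra_simps)
  also have "\<dots> = (int u - int x) mod int m"
    by (simp add: zmod_int mod_diff_eq)
  finally show ?thesis
    by (simp add: knows_def) (metis of_nat_less_iff)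
qed

section \<open>Secrecy and decodability on the uniform message space\<close>

text \<open>An injection that preserves \<open>Y\<close> and carries the fibre \<open>X = x\<close>
  into \<open>X = x'\<close> shows that the joint fibres over a fixed \<open>y\<close> all have the
  same size. Each fibre of \<open>Y\<close> is then split evenly among the values of
  \<open>X\<close>, so the joint distribution is the product of the marginals.\<close>

lemma mutual_info_uniform_eq_0:
  assumes fin: "finite \<Omega>" and ne: "\<Omega> \<noteq> {}"
    and shift: "\<And>x x'. x \<in> X ` \<Omega> \<Longrightarrow> x' \<in> X ` \<Omega> \<Longrightarrow>
      \<exists>T. inj_on T \<Omega> \<and> T \<in> \<Omega> \<rightarrow> \<Omega> \<and> (\<forall>w\<in>\<Omega>. Y (T w) = Y w \<and> (X w = x \<longrightarrow> X (T w) = x'))"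
  shows "mutual_info (uniform_count_measure \<Omega>) X Y = 0"
proof -
  let ?M = "uniform_count_measure \<Omega>"
  interpret prob_space ?M by (rule prob_space_uniform_count_measure[OF fin ne])
  interpret information_space ?M 2 by standard simp
  have sf: "simple_function ?M f" for f :: "'a \<Rightarrow> 'd"
    using fin by (simp add: simple_function_def space_uniform_count_measure sets_uniform_count_measure)
  have sd: "simple_distributed ?M f (\<lambda>x. card {w \<in> \<Omega>. f w = x} / card \<Omega>)" for f :: "'a \<Rightarrow> 'd"
  proof (rule simple_distributedI[OF sf])
    fix x assume "x \<in> f ` space ?M"
    have "prob (f -` {x} \<inter> space ?M) = card (f -` {x} \<inter> \<Omega>) / card \<Omega>"
      by (simp add: space_uniform_count_measure measure_uniform_count_measure[OF fin])
    also have "f -` {x} \<inter> \<Omega> = {w \<in> \<Omega>. f w = x}" by auto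
    finally show "card {w \<in> \<Omega>. f w = x} / card \<Omega> = prob (f -` {x} \<inter> space ?M)" by simp
  qed simp
  let ?c = "\<lambda>x y. card {w \<in> \<Omega>. X w = x \<and> Y w = y}"
  have le: "?c x y \<le> ?c x' y" if xx: "x \<in> X ` \<Omega>" "x' \<in> X ` \<Omega>" for x x' y
  proof -
    obtain T where T: "inj_on T \<Omega>" "T \<in> \<Omega> \<rightarrow> \<Omega>"
        "\<forall>w\<in>\<Omega>. Y (T w) = Y w \<and> (X w = x \<longrightarrow> X (T w) = x')"
      using shift[OF xx] by blast
    show ?thesis
    proof (rule card_inj_on_le)
      show "inj_on T {w \<in> \<Omega>. X w = x \<and> Y w = y}"
        using T(1) by (rule inj_on_subset) auto
      show "T ` {w \<in> \<Omega>. X w = x \<and> Y w = y} \<subseteq> {w \<in> \<Omega>. X w = x' \<and> Y w = y}"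
        using T(2,3) by (simp add: image_subset_iff Pi_iff)
      show "finite {w \<in> \<Omega>. X w = x' \<and> Y w = y}" using fin by simp
    qed
  qed
  then have eq: "?c x y = ?c x' y" if "x \<in> X ` \<Omega>" "x' \<in> X ` \<Omega>" for x x' y
    using that by (meson le_antisym)
  have Y: "card {w \<in> \<Omega>. Y w = y} = card (X ` \<Omega>) * ?c x y" if x: "x \<in> X ` \<Omega>" for x y
  proof -
    have "{w \<in> \<Omega>. Y w = y} = (\<Union>x'\<in>X ` \<Omega>. {w \<in> \<Omega>. X w = x' \<and> Y w = y})" by auto
    also have "card \<dots> = (\<Sum>x'\<in>X ` \<Omega>. ?c x' y)"
      using fin by (intro card_UN_disjoint) auto
    also have "\<dots> = (\<Sum>x'\<in>X ` \<Omega>. ?c x y)"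
      by (rule sum.cong[OF refl]) (rule eq[OF _ x])
    finally show ?thesis by simp
  qed
  have X: "card (X ` \<Omega>) * card {w \<in> \<Omega>. X w = x} = card \<Omega>" if x: "x \<in> X ` \<Omega>" for x
  proof -
    have "\<Omega> = (\<Union>y\<in>Y ` \<Omega>. {w \<in> \<Omega>. Y w = y})" by auto
    then have "card \<Omega> = card (\<Union>y\<in>Y ` \<Omega>. {w \<in> \<Omega>. Y w = y})" by simp
    also have "\<dots> = (\<Sum>y\<in>Y ` \<Omega>. card {w \<in> \<Omega>. Y w = y})"
      using fin by (intro card_UN_disjoint) auto
    also have "\<dots> = card (X ` \<Omega>) * (\<Sum>y\<in>Y ` \<Omega>. ?c x y)"
      using Y[OF x] by (simp add: sum_distrib_left)
    also have "(\<Sum>y\<in>Y ` \<Omega>. ?c x y) = card (\<Union>y\<in>Y ` \<Omega>. {w \<in> \<Omega>. X w = x \<and> Y w = y})"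
      using fin by (intro card_UN_disjoint[symmetric]) auto
    also have "(\<Union>y\<in>Y ` \<Omega>. {w \<in> \<Omega>. X w = x \<and> Y w = y}) = {w \<in> \<Omega>. X w = x}" by auto
    finally show ?thesis by simp
  qed
  have "mutual_information 2 (count_space (X ` space ?M)) (count_space (Y ` space ?M)) X Y = 0"
  proof (rule mutual_information_eq_0_simple[OF sd sd sd], rule ballI)
    fix w assume "w \<in> space ?M"
    then have w: "X w \<in> X ` \<Omega>" by (simp add: space_uniform_count_measure)
    have "card \<Omega> > 0" using fin ne by (simp add: card_gt_0_iff)
    moreover have "card {v \<in> \<Omega>. X v = X w} * card {v \<in> \<Omega>. Y v = Y w} = ?c (X w) (Y w) * card \<Omega>"
      unfolding Y[OF w] X[OF w, symmetric] by (simp only: mult.assoc mult.commute mult.left_commute)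
    then have "real (card {v \<in> \<Omega>. X v = X w}) * real (card {v \<in> \<Omega>. Y v = Y w})
        = real (?c (X w) (Y w)) * real (card \<Omega>)"
      by (simp only: of_nat_mult[symmetric])
    ultimately show "card {v \<in> \<Omega>. (X v, Y v) = (X w, Y w)} / card \<Omega>
        = card {v \<in> \<Omega>. X v = X w} / card \<Omega> * (card {v \<in> \<Omega>. Y v = Y w} / card \<Omega>)"
      unfolding prod.inject times_divide_times_eq by simp
  qed
  then show ?thesis by (simp add: mutual_info_def)
qed

lemma finite_msg_tuples: "finite A \<Longrightarrow> finite (msg_tuples A \<kappa>)"
  unfolding msg_tuples_def by (intro finite_PiE) (auto simp: finite_carrier_vec_bit)

lemma cancel_vec:
  fixes u v :: "'a::group_add vec"
  assumes "u \<in> carrier_vec n" "v \<in> carrier_vec n"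
  shows "(u + v) - v = u"
  using assms by (intro eq_vecI) auto

text \<open>The injection is the translation by a message tuple \<open>p\<close> that user
  \<open>i\<close> cannot notice. Taking \<open>a = x' - x\<close> moves the value at
  \<open>j\<close> from \<open>x\<close> to \<open>x'\<close>.\<close>

lemma secureI:
  assumes pert: "\<And>j a. j \<in> {1..m} - (side_info m s i \<union> {d}) \<Longrightarrow> a \<in> carrier_vec \<kappa> \<Longrightarrow>
      \<exists>p \<in> msg_tuples {1..m} \<kappa>. p j = a \<and>
        (\<forall>w \<in> msg_tuples {1..m} \<kappa>.
           user_view m s enc i (\<lambda>l\<in>{1..m}. w l + p l) = user_view m s enc i w)"
  shows "secure m s \<kappa> enc i d"
  unfolding secure_def msg_space_eq_uniform
proof (intro ballI mutual_info_uniform_eq_0)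
  fix j x x'
  let ?\<Omega> = "msg_tuples {1..m} \<kappa>"
  assume j: "j \<in> {1..m} - (side_info m s i \<union> {d})"
    and x: "x \<in> (\<lambda>w. w j) ` ?\<Omega>" and x': "x' \<in> (\<lambda>w. w j) ` ?\<Omega>"
  have c: "x \<in> carrier_vec \<kappa>" "x' \<in> carrier_vec \<kappa>"
    using x x' j by (auto simp: msg_tuples_def)
  obtain p where p: "p \<in> ?\<Omega>" "p j = x' - x"
    "\<forall>w \<in> ?\<Omega>. user_view m s enc i (\<lambda>l\<in>{1..m}. w l + p l) = user_view m s enc i w"
    using pert[OF j, of "x' - x"] c by auto
  let ?T = "\<lambda>w. \<lambda>l\<in>{1..m}. w l + p l"
  have pc: "p l \<in> carrier_vec \<kappa>" if "l \<in> {1..m}" for l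
    using p(1) that by (auto simp: msg_tuples_def)
  have "inj_on ?T ?\<Omega>"
  proof (rule inj_onI)
    fix v w assume v: "v \<in> ?\<Omega>" and w: "w \<in> ?\<Omega>" and eq: "?T v = ?T w"
    show "v = w"
    proof (rule PiE_ext[OF v[unfolded msg_tuples_def] w[unfolded msg_tuples_def]])
      fix l assume l: "l \<in> {1..m}"
      have "v l \<in> carrier_vec \<kappa>" "w l \<in> carrier_vec \<kappa>"
        using v w l by (auto simp: msg_tuples_def)
      moreover have "v l + p l = w l + p l"
        using fun_cong[OF eq, of l] l by simp
      ultimately show "v l = w l"
        using pc[OF l] by (metis cancel_vec)
    qed
  qed
  moreover have "?T \<in> ?\<Omega> \<rightarrow> ?\<Omega>"
    using pc by (auto simp: msg_tuples_def PiE_iff)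
  moreover have "?T w j = x'" if "w j = x" for w
  proof -
    have "?T w j = x + (x' - x)" using j that p(2) by simp
    also have "\<dots> = x'" using c by (intro eq_vecI) auto
    finally show ?thesis .
  qed
  ultimately show "\<exists>T. inj_on T ?\<Omega> \<and> T \<in> ?\<Omega> \<rightarrow> ?\<Omega> \<and>
      (\<forall>w\<in>?\<Omega>. user_view m s enc i (T w) = user_view m s enc i w \<and> (w j = x \<longrightarrow> T w j = x'))"
    using p(3) by (intro exI[of _ ?T]) auto
next
  show "finite (msg_tuples {1..m} \<kappa>)" by (simp add: finite_msg_tuples)
  show "msg_tuples {1..m} \<kappa> \<noteq> {}"
    unfolding msg_tuples_def PiE_eq_empty_iff using zero_carrier_vec by blast
qed

text \<open>The decoder picks any message tuple that is compatible with the view and reads off its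
  entry \<open>d\<close>.\<close>

lemma decodableI:
  assumes "\<And>w w'. w \<in> msg_tuples {1..m} \<kappa> \<Longrightarrow> w' \<in> msg_tuples {1..m} \<kappa> \<Longrightarrow>
      user_view m s enc i w = user_view m s enc i w' \<Longrightarrow> w d = w' d"
  shows "decodable m s \<kappa> enc i d"
  unfolding decodable_def
proof (intro exI ballI)
  let ?\<Omega> = "msg_tuples {1..m} \<kappa>"
  fix w assume w: "w \<in> ?\<Omega>"
  let ?P = "\<lambda>v. v \<in> ?\<Omega> \<and> user_view m s enc i v = user_view m s enc i w"
  have "?P (SOME v. ?P v)" using w by (intro someI[of ?P w]) simp
  then show "(\<lambda>y. (SOME v. v \<in> ?\<Omega> \<and> user_view m s enc i v = y) d) (user_view m s enc i w) = w d"
    using assms[OF _ w] by simp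
qed

lemma side_info_iff_knows:
  assumes "j \<in> {1..m}" "s \<le> m"
  shows "j \<in> side_info m s i \<longleftrightarrow> knows m s (i mod m) (j mod m)"
proof -
  have m: "m > 0" using assms by auto
  have "(\<exists>k<s. [int j = int i - int k] (mod int m)) \<longleftrightarrow> (int i - int j) mod int m < int s"
  proof
    assume "\<exists>k<s. [int j = int i - int k] (mod int m)"
    then obtain k where k: "k < s" "[int j = int i - int k] (mod int m)" by blast
    have kk: "int j mod int m = (int i - int k) mod int m"
      using k(2) by (simp only: Cong.cong_def)
    have "(int i - int j) mod int m = (int i - int j mod int m) mod int m"
      by (rule mod_diff_right_eq[symmetric])
    also have "\<dots> = (int i - (int i - int k) mod int m) mod int m"
      by (rule arg_cong[OF kk])
    also have "\<dots> = (int i - (int i - int k)) mod int m"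
      by (rule mod_diff_right_eq)
    also have "\<dots> = int k"
      using k assms by simp
    finally show "(int i - int j) mod int m < int s"
      using k assms by simp
  next
    assume a: "(int i - int j) mod int m < int s"
    define k where "k = nat ((int i - int j) mod int m)"
    have k: "int k = (int i - int j) mod int m" using m by (simp add: k_def)
    have "(int i - int k) mod int m = int j mod int m"
      unfolding k mod_diff_right_eq by simp
    then show "\<exists>k<s. [int j = int i - int k] (mod int m)"
      using a k by (intro exI[of _ k]) (auto simp: Cong.cong_def)
  qed
  then show ?thesis
    using assms knows_mod[OF m, of s i j] by (simp add: side_info_def)
qed

lemma bij_betw_mod: "m > 0 \<Longrightarrow> bij_betw (\<lambda>j. j mod m) {1..m} {..<m::nat}"
  by (rule bij_betw_byWitness[of _ "\<lambda>x. if x = 0 then m else x"])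
     (auto simp: le_less dest!: dvd_imp_le)

section \<open>Field elements as pairs of bits\<close>

text \<open>\<open>lo\<close> and \<open>hi\<close> are the coordinates with respect to the basis
  \<open>F1\<close>, \<open>Fa\<close> over the prime field. Their additivity is what makes a
  codeword over \<open>f4\<close> an encoder that is linear over bits.\<close>

fun lo :: "f4 \<Rightarrow> bit" where
  "lo F0 = 0" | "lo F1 = 1" | "lo Fa = 0" | "lo Fb = 1"

fun hi :: "f4 \<Rightarrow> bit" where
  "hi F0 = 0" | "hi F1 = 0" | "hi Fa = 1" | "hi Fb = 1"

definition f4_of_bits :: "bit \<Rightarrow> bit \<Rightarrow> f4" where
  "f4_of_bits a b = (if a = 0 then (if b = 0 then F0 else Fa) else (if b = 0 then F1 else Fb))"

lemma lo_add: "lo (x + y) = lo x + lo y"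
  by (cases x; cases y) (simp_all add: zero_f4_def)

lemma hi_add: "hi (x + y) = hi x + hi y"
  by (cases x; cases y) (simp_all add: zero_f4_def)

lemma f4_eq_iff: "x = y \<longleftrightarrow> lo x = lo y \<and> hi x = hi y"
  by (cases x; cases y; simp)

lemma lo_of_bits [simp]: "lo (f4_of_bits a b) = a" and hi_of_bits [simp]: "hi (f4_of_bits a b) = b"
  by (cases a; cases b; simp add: f4_of_bits_def)+

definition to_f4 :: "bit vec \<Rightarrow> f4" where
  "to_f4 v = f4_of_bits (v $ 0) (v $ 1)"

definition of_f4 :: "f4 \<Rightarrow> bit vec" where
  "of_f4 z = vec 2 (\<lambda>i. if i = 0 then lo z else hi z)"

lemma of_f4_carrier [simp]: "of_f4 z \<in> carrier_vec 2"
  by (simp add: of_f4_def)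

lemma to_of_f4 [simp]: "to_f4 (of_f4 z) = z"
  by (simp add: to_f4_def of_f4_def f4_eq_iff)

lemma of_to_f4: "v \<in> carrier_vec 2 \<Longrightarrow> of_f4 (to_f4 v) = v"
  by (rule eq_vecI) (auto simp: to_f4_def of_f4_def less_2_cases_iff)

lemma to_f4_add:
  "v \<in> carrier_vec 2 \<Longrightarrow> w \<in> carrier_vec 2 \<Longrightarrow> to_f4 (v + w) = to_f4 v + to_f4 w"
  by (simp add: f4_eq_iff to_f4_def lo_add hi_add)

lemma to_f4_smult: "v \<in> carrier_vec 2 \<Longrightarrow> to_f4 (c \<cdot>\<^sub>v v) = (if c = 0 then 0 else to_f4 v)"
  by (cases c) (auto simp: f4_eq_iff to_f4_def zero_f4_def)

lemma to_f4_inj: "v \<in> carrier_vec 2 \<Longrightarrow> w \<in> carrier_vec 2 \<Longrightarrow> to_f4 v = to_f4 w \<Longrightarrow> v = w"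
  by (metis of_to_f4)

text \<open>User \<open>i\<close> sends the values of the codewords \<open>k\<close> with \<open>own k = i\<close>, two bits for each.\<close>

locale f4_scheme =
  fixes m s N :: nat and c :: "nat \<Rightarrow> nat \<Rightarrow> f4" and own :: "nat \<Rightarrow> nat"
  assumes s_le: "s \<le> m"
    and own: "k < N \<Longrightarrow> own k \<in> {1..m}"
    and local: "k < N \<Longrightarrow> j \<in> {1..m} \<Longrightarrow> c k (j mod m) \<noteq> 0 \<Longrightarrow> j \<in> side_info m s (own k)"
begin

abbreviation "A \<equiv> side_info m s"

definition ks :: "nat \<Rightarrow> nat list" where
  "ks i = sorted_list_of_set {k. k < N \<and> own k = i}"

definition val :: "nat set \<Rightarrow> nat \<Rightarrow> (nat \<Rightarrow> bit vec) \<Rightarrow> f4" where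
  "val B k w = (\<Sum>j\<in>B. c k (j mod m) * to_f4 (w j))"

text \<open>Entries \<open>2 * t\<close> and \<open>2 * t + 1\<close> are the two coordinates of the
  value of the codeword \<open>ks i ! t\<close>.\<close>

definition enc :: "nat \<Rightarrow> (nat \<Rightarrow> bit vec) \<Rightarrow> bit vec" where
  "enc i u = vec (2 * length (ks i))
     (\<lambda>p. (if even p then lo else hi) (val (A i) (ks i ! (p div 2)) u))"

definition n :: "nat \<Rightarrow> nat" where
  "n i = 2 * length (ks i)"

lemma A_sub: "A i \<subseteq> {1..m}" and fin_A: "finite (A i)"
  by (auto simp: side_info_def)

lemma ks_set: "set (ks i) = {k. k < N \<and> own k = i}"
  by (simp add: ks_def)

lemma length_ks: "length (ks i) = card {k. k < N \<and> own k = i}"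
  by (simp add: ks_def)

lemma enc_carrier: "enc i \<in> msg_tuples (A i) 2 \<rightarrow> carrier_vec (n i)"
  by (simp add: enc_def n_def)

text \<open>All positions with a nonzero coefficient are known to the owner, so the value computed
  from the owner's side information is the global one.\<close>

lemma val_restrict: "k < N \<Longrightarrow> val (A (own k)) k (restrict w (A (own k))) = val {1..m} k w"
proof -
  assume k: "k < N"
  have "c k (j mod m) = 0" if "j \<in> {1..m} - A (own k)" for j
    using local[OF k, of j] that by blast
  then show ?thesis
    unfolding val_def using A_sub
    by (intro sum.mono_neutral_cong_left) auto
qed

lemma enc_cong:
  assumes "\<And>k. k < N \<Longrightarrow> own k = i \<Longrightarrow> val (A i) k u = val (A i) k v"
  shows "enc i u = enc i v"
proof (rule eq_vecI)
  fix p assume "p < dim_vec (enc i v)"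
  then have p: "p < 2 * length (ks i)" by (simp add: enc_def)
  then have "ks i ! (p div 2) \<in> set (ks i)" by (intro nth_mem) auto
  then show "enc i u $ p = enc i v $ p"
    using p assms by (simp add: enc_def ks_set)
qed (simp add: enc_def)

lemma enc_eqD:
  assumes eq: "enc i u = enc i v" and k: "k < N" "own k = i"
  shows "val (A i) k u = val (A i) k v"
proof -
  have "k \<in> set (ks i)" using k by (simp add: ks_set)
  then obtain t where t: "t < length (ks i)" "ks i ! t = k"
    by (auto simp: in_set_conv_nth)
  have "enc i u $ (2 * t) = enc i v $ (2 * t)" "enc i u $ (2 * t + 1) = enc i v $ (2 * t + 1)"
    by (simp_all add: eq)
  then show ?thesis using t by (simp add: enc_def f4_eq_iff)
qed

text \<open>Which user sends a codeword becomes irrelevant here: a view amounts to all codeword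
  values together with the side information.\<close>

lemma user_view_eq_iff:
  "user_view m s enc i v = user_view m s enc i w \<longleftrightarrow>
     (\<forall>k<N. val {1..m} k v = val {1..m} k w) \<and> (\<forall>j\<in>A i. v j = w j)"
proof -
  have "transmission m s enc v = transmission m s enc w \<longleftrightarrow>
      (\<forall>i\<in>{1..m}. enc i (restrict v (A i)) = enc i (restrict w (A i)))"
    by (auto simp: transmission_def fun_eq_iff)
  also have "\<dots> \<longleftrightarrow> (\<forall>k<N. val {1..m} k v = val {1..m} k w)"
  proof (intro iffI allI ballI impI)
    fix k assume "\<forall>i\<in>{1..m}. enc i (restrict v (A i)) = enc i (restrict w (A i))" and k: "k < N"
    then show "val {1..m} k v = val {1..m} k w"
      using enc_eqD[of "own k" "restrict v (A (own k))" "restrict w (A (own k))" k] own[OF k]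
      by (simp add: val_restrict)
  next
    fix i assume eq: "\<forall>k<N. val {1..m} k v = val {1..m} k w"
    show "enc i (restrict v (A i)) = enc i (restrict w (A i))"
    proof (rule enc_cong)
      fix k assume k: "k < N" "own k = i"
      show "val (A i) k (restrict v (A i)) = val (A i) k (restrict w (A i))"
        using eq k val_restrict[OF k(1), of v] val_restrict[OF k(1), of w] by simp
    qed
  qed
  moreover have "restrict v (A i) = restrict w (A i) \<longleftrightarrow> (\<forall>j\<in>A i. v j = w j)"
    by (auto simp: fun_eq_iff)
  ultimately show ?thesis by (simp add: user_view_def)
qed

lemma val_add:
  assumes "\<And>j. j \<in> B \<Longrightarrow> u j \<in> carrier_vec 2" "\<And>j. j \<in> B \<Longrightarrow> v j \<in> carrier_vec 2"
    "\<And>j. j \<in> B \<Longrightarrow> w j = u j + v j"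
  shows "val B k w = val B k u + val B k v"
  using assms by (simp add: val_def to_f4_add distrib_left sum.distrib)

text \<open>A codeword costs two bits, and messages have two bits, so each codeword counts for
  exactly one unit.\<close>

lemma code_length_eq: "code_length m 2 n = real N"
proof -
  have "code_length m 2 n = (\<Sum>i\<in>{1..m}. real (card {k. k < N \<and> own k = i}))"
    by (simp add: code_length_def n_def length_ks)
  also have "\<dots> = real (card (\<Union>i\<in>{1..m}. {k. k < N \<and> own k = i}))"
    by (subst card_UN_disjoint) auto
  also have "(\<Union>i\<in>{1..m}. {k. k < N \<and> own k = i}) = {..<N}"
    using own by auto
  finally show ?thesis by simp
qed

lemma linear: "linear_scheme m s 2 enc"
  unfolding linear_scheme_def
proof (intro ballI conjI allI)
  fix i u v
  assume u: "u \<in> msg_tuples (A i) 2" and v: "v \<in> msg_tuples (A i) 2"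
  have car: "u j \<in> carrier_vec 2" "v j \<in> carrier_vec 2" if "j \<in> A i" for j
    using u v that by (auto simp: msg_tuples_def)
  have "val (A i) k (\<lambda>j\<in>A i. u j + v j) = val (A i) k u + val (A i) k v" for k
    using car by (intro val_add) auto
  then show "enc i (\<lambda>j\<in>A i. u j + v j) = enc i u + enc i v"
    by (intro eq_vecI) (simp_all add: enc_def lo_add hi_add)
next
  fix i u and a :: bit
  assume u: "u \<in> msg_tuples (A i) 2"
  have car: "u j \<in> carrier_vec 2" if "j \<in> A i" for j
    using u that by (auto simp: msg_tuples_def)
  have "val (A i) k (\<lambda>j\<in>A i. a \<cdot>\<^sub>v u j) = (if a = 0 then 0 else val (A i) k u)" for k
    using car by (simp add: val_def to_f4_smult)
  then show "enc i (\<lambda>j\<in>A i. a \<cdot>\<^sub>v u j) = a \<cdot>\<^sub>v enc i u"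
    by (intro eq_vecI) (cases a, simp_all add: enc_def zero_f4_def)
qed

end

lemma good_code_scheme:
  assumes good: "good_code m s N c" and s: "s \<le> m" and m: "0 < m"
  shows "\<exists>\<kappa> n enc. valid_scheme m s \<kappa> n enc \<and> linear_scheme m s \<kappa> enc \<and> code_length m \<kappa> n = real N"
proof -
  note bij = bij_betw_mod[OF m]
  have res: "\<exists>j\<in>{1..m}. j mod m = x" if "x < m" for x
    using bij that by (metis bij_betw_def imageE lessThan_iff)
  have "\<exists>i. i \<in> {1..m} \<and> (\<forall>j\<in>{1..m}. c k (j mod m) \<noteq> 0 \<longrightarrow> j \<in> side_info m s i)" if kN: "k < N" for k
  proof -
    obtain u where u: "u < m" "\<forall>x<m. c k x \<noteq> 0 \<longrightarrow> knows m s u x"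
      using good kN unfolding good_code_def by blast
    obtain i where "i \<in> {1..m}" and "i mod m = u" using res[OF u(1)] by blast
    moreover have "j \<in> side_info m s i" if "j \<in> {1..m}" "c k (j mod m) \<noteq> 0" for j
      using u(2) that m \<open>i mod m = u\<close> side_info_iff_knows[OF that(1) s, of i] by simp
    ultimately show ?thesis by blast
  qed
  then obtain own where own: "\<And>k. k < N \<Longrightarrow> own k \<in> {1..m} \<and>
      (\<forall>j\<in>{1..m}. c k (j mod m) \<noteq> 0 \<longrightarrow> j \<in> side_info m s (own k))" by metis
  interpret f4_scheme m s N c own
    using s own by unfold_locales blast+
  have main: "\<exists>d \<in> {1..m} - A i. decodable m s 2 enc i d \<and> secure m s 2 enc i d" if i: "i \<in> {1..m}" for i
  proof -
    let ?K = "\<lambda>x. knows m s (i mod m) x"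
    have im: "i mod m < m" using m by simp
    obtain e k f where e: "e < m" "\<not> ?K e"
      and k: "k < N" "c k e \<noteq> 0" "\<forall>x<m. c k x \<noteq> 0 \<longrightarrow> x = e \<or> ?K x"
      and f: "\<forall>x<m. f x = 0 \<longleftrightarrow> x = e \<or> ?K x" "\<forall>k<N. (\<Sum>x<m. c k x * f x) = 0"
      using conjunct2[OF good[unfolded good_code_def], rule_format, OF im]
      by (elim exE conjE) (rule that)
    obtain d where d: "d \<in> {1..m}" "d mod m = e" using res[OF e(1)] by blast
    have A: "j \<in> A i \<longleftrightarrow> ?K (j mod m)" if "j \<in> {1..m}" for j
      using that side_info_iff_knows[OF that s] by simp
    have eq_d: "j = d" if "j \<in> {1..m}" "j mod m = e" for j
      using bij that d by (metis bij_betw_def inj_onD)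
    have "decodable m s 2 enc i d"
    proof (rule decodableI)
      fix v w assume v: "v \<in> msg_tuples {1..m} 2" and w: "w \<in> msg_tuples {1..m} 2"
        and eq: "user_view m s enc i v = user_view m s enc i w"
      \<comment> \<open>Codeword \<open>k\<close> has \<open>e\<close> as its only unknown position
        for user \<open>i\<close>, so two tuples with equal views can differ in this sum only
        through the summand of \<open>d\<close>.\<close>
      have other: "c k (j mod m) * to_f4 (v j) = c k (j mod m) * to_f4 (w j)"
        if j: "j \<in> {1..m} - {d}" for j
      proof (cases "c k (j mod m) = 0")
        case False
        have "j mod m < m" "j mod m \<noteq> e" using m eq_d[of j] j by auto
        then have "?K (j mod m)" using k(3) False by blast
        then have "j \<in> A i" using A j by blast
        then have "v j = w j" using eq by (simp add: user_view_eq_iff)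
        then show ?thesis by simp
      qed simp
      have split: "val {1..m} k u = c k e * to_f4 (u d) + (\<Sum>j\<in>{1..m} - {d}. c k (j mod m) * to_f4 (u j))" for u
        unfolding val_def using d by (subst sum.remove[of _ d]) auto
      let ?S = "\<lambda>u. \<Sum>j\<in>{1..m} - {d}. c k (j mod m) * to_f4 (u j)"
      have S: "?S v = ?S w"
        using other by (rule sum.cong[OF refl])
      have "val {1..m} k v = val {1..m} k w" using eq k(1) by (simp add: user_view_eq_iff)
      then have "c k e * to_f4 (v d) + ?S w = c k e * to_f4 (w d) + ?S w"
        unfolding split S .
      then have "c k e * to_f4 (v d) = c k e * to_f4 (w d)"
        by (rule add_right_imp_eq)
      then have "to_f4 (v d) = to_f4 (w d)" using k(2) by simp
      then show "v d = w d"
        using v w d by (intro to_f4_inj) (auto simp: msg_tuples_def)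
    qed
    moreover have "secure m s 2 enc i d"
    proof (rule secureI)
      fix j and a :: "bit vec" assume j: "j \<in> {1..m} - (A i \<union> {d})" and a: "a \<in> carrier_vec 2"
      have "j mod m < m" "j mod m \<noteq> e" "\<not> ?K (j mod m)"
        using m eq_d[of j] A[of j] j by auto
      then have fj: "f (j mod m) \<noteq> 0" using f(1) by blast
      \<comment> \<open>Scaling \<open>f\<close> by \<open>z\<close> produces the prescribed value
        \<open>a\<close> at \<open>j\<close>; orthogonality and the zeros of \<open>f\<close>
        survive the scaling, so the perturbation is invisible to user \<open>i\<close>.\<close>
      define z where "z = to_f4 a / f (j mod m)"
      define p where "p = (\<lambda>l\<in>{1..m}. of_f4 (z * f (l mod m)))"
      have p: "p \<in> msg_tuples {1..m} 2" by (simp add: p_def msg_tuples_def)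
      have "p j = a" using j fj of_to_f4[OF a] by (simp add: p_def z_def)
      moreover have "user_view m s enc i (\<lambda>l\<in>{1..m}. w l + p l) = user_view m s enc i w"
        if w: "w \<in> msg_tuples {1..m} 2" for w
      proof -
        have car: "w l \<in> carrier_vec 2" "p l \<in> carrier_vec 2" if "l \<in> {1..m}" for l
          using w p that by (auto simp: msg_tuples_def)
        have val0: "val {1..m} l p = 0" if "l < N" for l
        proof -
          have "val {1..m} l p = (\<Sum>j\<in>{1..m}. z * (c l (j mod m) * f (j mod m)))"
            by (simp add: val_def p_def ac_simps)
          also have "\<dots> = z * (\<Sum>j\<in>{1..m}. c l (j mod m) * f (j mod m))"
            by (simp add: sum_distrib_left)
          also have "(\<Sum>j\<in>{1..m}. c l (j mod m) * f (j mod m)) = (\<Sum>x<m. c l x * f x)"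
            by (rule sum.reindex_bij_betw[OF bij])
          finally show ?thesis using f(2) that by simp
        qed
        have val1: "val {1..m} l (\<lambda>l\<in>{1..m}. w l + p l) = val {1..m} l w + val {1..m} l p" for l
          using car by (intro val_add) auto
        have same: "w l + p l = w l" if l: "l \<in> A i" for l
        proof -
          have lm: "l \<in> {1..m}" by (rule subsetD[OF A_sub l])
          then have "?K (l mod m)" using A l by blast
          then have "f (l mod m) = 0" using f(1) m by simp
          then have "p l = of_f4 0" using lm by (simp add: p_def)
          then show ?thesis using car[OF lm]
            by (intro eq_vecI) (auto simp: of_f4_def zero_f4_def)
        qed
        show ?thesis
          unfolding user_view_eq_iff
        proof (intro conjI allI impI ballI)
          fix l assume "l < N"
          then show "val {1..m} l (\<lambda>l\<in>{1..m}. w l + p l) = val {1..m} l w"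
            using val0 val1 by simp
        next
          fix l assume l: "l \<in> A i"
          then have "l \<in> {1..m}" by (rule subsetD[OF A_sub])
          then show "(\<lambda>l\<in>{1..m}. w l + p l) l = w l"
            using same[OF l] by simp
        qed
      qed
      ultimately show "\<exists>p \<in> msg_tuples {1..m} 2. p j = a \<and> (\<forall>w \<in> msg_tuples {1..m} 2.
          user_view m s enc i (\<lambda>l\<in>{1..m}. w l + p l) = user_view m s enc i w)"
        using p by (intro bexI[of _ p] conjI ballI)
    qed
    moreover have "d \<in> {1..m} - A i" using d e(2) A[OF d(1)] by simp
    ultimately show ?thesis by (intro bexI[of _ d] conjI)
  qed
  have "valid_scheme m s 2 n enc"
    unfolding valid_scheme_def
  proof (intro conjI ballI)
    show "1 \<le> (2::nat)" by simp
    show "enc i \<in> msg_tuples (A i) 2 \<rightarrow> carrier_vec (n i)" for i by (rule enc_carrier)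
  qed (rule main)
  then show ?thesis using linear code_length_eq by (intro exI conjI)
qed

lemma good_codeI:
  assumes "\<And>k. k < N \<Longrightarrow> \<exists>u<m. \<forall>x<m. c k x \<noteq> 0 \<longrightarrow> knows m s u x"
    and "\<And>u. u < m \<Longrightarrow> \<exists>d k f. d < m \<and> \<not> knows m s u d \<and> k < N \<and> c k d \<noteq> 0 \<and>
       (\<forall>x<m. c k x \<noteq> 0 \<longrightarrow> x = d \<or> knows m s u x) \<and>
       (\<forall>x<m. f x = 0 \<longleftrightarrow> x = d \<or> knows m s u x) \<and> (\<forall>k<N. (\<Sum>x<m. c k x * f x) = 0)"
  shows "good_code m s N c"
  unfolding good_code_def
proof (intro conjI allI impI)
  fix u assume u: "u < m"
  obtain d k f where "d < m" "\<not> knows m s u d" "k < N" "c k d \<noteq> 0"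
    "\<forall>x<m. c k x \<noteq> 0 \<longrightarrow> x = d \<or> knows m s u x"
    "\<forall>x<m. f x = 0 \<longleftrightarrow> x = d \<or> knows m s u x" "\<forall>k<N. (\<Sum>x<m. c k x * f x) = 0"
    using assms(2)[OF u] by (elim exE conjE) (rule that)
  then show "\<exists>d<m. \<not> knows m s u d \<and>
       (\<exists>k<N. c k d \<noteq> 0 \<and> (\<forall>x<m. c k x \<noteq> 0 \<longrightarrow> x = d \<or> knows m s u x)) \<and>
       (\<exists>f. (\<forall>x<m. f x = 0 \<longleftrightarrow> x = d \<or> knows m s u x) \<and> (\<forall>k<N. (\<Sum>x<m. c k x * f x) = 0))"
    by (intro exI[of _ d] exI[of _ k] exI[of _ f] conjI)
qed (rule assms(1))

subsection \<open>Lengthening the circle\<close>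

text \<open>Duplicating the first \<open>m - s\<close> positions: each window of unknown positions of the longer circle
  is mapped bijectively onto one of the shorter circle.\<close>

definition fold_pos :: "nat \<Rightarrow> nat \<Rightarrow> nat" where
  "fold_pos g x = (if x < g then x else x - g)"

lemma unknown_iff:
  assumes "u < m" "x < m" "s < m"
  shows "\<not> knows m s u x \<longleftrightarrow> u < x \<and> x + s \<le> u + m \<or> x + s \<le> u"
  using assms by (auto simp: knows_iff)

lemma bij_betw_CollectI:
  assumes "\<And>x. P x \<Longrightarrow> Q (f x) \<and> g (f x) = x" "\<And>y. Q y \<Longrightarrow> P (g y) \<and> f (g y) = y"
  shows "bij_betw f {x. P x} {y. Q y}"
  using assms by (intro bij_betw_byWitness[of _ g]) auto

definition unknown :: "nat \<Rightarrow> nat \<Rightarrow> nat \<Rightarrow> nat set" where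
  "unknown m s u = {x. x < m \<and> \<not> knows m s u x}"

lemma unknown_eq:
  assumes "u < s + g" "0 < g"
  shows "unknown (s + g) s u = {x. x < s + g \<and> (u < x \<and> x \<le> u + g \<or> x + s \<le> u)}"
  using unknown_iff[OF assms(1), of _ s] assms(2) by (auto simp: unknown_def)

lemma bij_fold_pos_shift:
  assumes "0 < g" "u + 1 < s + g"
  shows "bij_betw (fold_pos g) (unknown (s + g + g) (s + g) (u + g)) (unknown (s + g) s u)"
proof -
  have 1: "u + g < (s + g) + g" "u < s + g" using assms by auto
  show ?thesis
    unfolding unknown_eq[OF 1(1) assms(1)] unknown_eq[OF 1(2) assms(1)]
  proof (rule bij_betw_CollectI[of _ _ _ "\<lambda>y. if y + s \<le> u then y else y + g"])
    fix x assume "x < s + g + g \<and> (u + g < x \<and> x \<le> u + g + g \<or> x + (s + g) \<le> u + g)"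
    then consider "u + g < x" "x < s + g + g" "x \<le> u + g + g" | "x + s \<le> u" by linarith
    then show "(fold_pos g x < s + g \<and> (u < fold_pos g x \<and> fold_pos g x \<le> u + g \<or> fold_pos g x + s \<le> u)) \<and>
        (if fold_pos g x + s \<le> u then fold_pos g x else fold_pos g x + g) = x"
      using assms(2) by cases (auto simp: fold_pos_def)
  next
    fix y assume "y < s + g \<and> (u < y \<and> y \<le> u + g \<or> y + s \<le> u)"
    then show "((if y + s \<le> u then y else y + g) < s + g + g \<and>
        (u + g < (if y + s \<le> u then y else y + g) \<and> (if y + s \<le> u then y else y + g) \<le> u + g + g \<or>
         (if y + s \<le> u then y else y + g) + (s + g) \<le> u + g)) \<and>
        fold_pos g (if y + s \<le> u then y else y + g) = y"
      using assms(2) by (cases "y + s \<le> u") (auto simp: fold_pos_def)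
  qed
qed

text \<open>The first \<open>2 * g\<close> positions are two copies of the first \<open>g\<close>,
  so each of the \<open>g + 1\<close> windows of length \<open>g\<close> inside them meets every
  class modulo \<open>g\<close> once and folds onto the first window. The window starting at
  \<open>b\<close> belongs to user \<open>b - 1\<close>, which for \<open>b = 0\<close> is the last
  user.\<close>

lemma bij_fold_pos_start:
  assumes "0 < s" "0 < g" "b \<le> g" and u': "u' = (if b = 0 then s + g + g - 1 else b - 1)"
  shows "bij_betw (fold_pos g) (unknown (s + g + g) (s + g) u') (unknown (s + g) s (s + g - 1))"
proof -
  have 1: "u' < (s + g) + g" "s + g - 1 < s + g" using assms by auto
  have "unknown (s + g + g) (s + g) u' = {x. b \<le> x \<and> x < b + g}"
    unfolding unknown_eq[OF 1(1) assms(2)] using assms by auto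
  moreover have "unknown (s + g) s (s + g - 1) = {x. x < g}"
    unfolding unknown_eq[OF 1(2) assms(2)] using assms by auto
  moreover have "bij_betw (fold_pos g) {x. b \<le> x \<and> x < b + g} {x. x < g}"
    by (rule bij_betw_CollectI[of _ _ _ "\<lambda>y. if b \<le> y then y else y + g"])
      (use assms(3) in \<open>auto simp: fold_pos_def\<close>)
  ultimately show ?thesis by simp
qed

text \<open>Only the window of unknown positions matters for decoding and for orthogonality, and
  \<open>fold_pos\<close> maps each such window of the long circle bijectively onto one of the short
  circle.\<close>

lemma good_code_fold:
  assumes good: "good_code (s + g) s N c" and s: "0 < s" and g: "0 < g"
  shows "good_code (s + 2 * g) (s + g) N (\<lambda>k x. c k (fold_pos g x))"
proof -
  let ?m = "s + g"
  have m2: "s + 2 * g = ?m + g" by simp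
  let ?U = "unknown ?m s" and ?U' = "unknown (?m + g) (s + g)"
  \<comment> \<open>This direction finds a transmitter for each codeword; the next one,
    \<open>onto\<close>, finds for each user of the long circle a user to imitate.\<close>
  have forth: "\<exists>u'<?m + g. bij_betw (fold_pos g) (?U' u') (?U u)" if u: "u < ?m" for u
  proof (cases "u + 1 = ?m")
    case True
    then have "u = ?m - 1" by simp
    then show ?thesis
      using bij_fold_pos_start[OF s g, of g "g - 1"] g by (intro exI[of _ "g - 1"]) auto
  next
    case False
    then show ?thesis
      using bij_fold_pos_shift[OF g, of u s] u by (intro exI[of _ "u + g"]) auto
  qed
  have onto: "\<exists>u<?m. bij_betw (fold_pos g) (?U' u') (?U u)" if u': "u' < ?m + g" for u'
  proof (cases "g \<le> u' \<and> u' + 1 < ?m + g")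
    case True
    then show ?thesis
      using bij_fold_pos_shift[OF g, of "u' - g" s] by (intro exI[of _ "u' - g"]) auto
  next
    case False
    then have "u' < g \<or> u' = ?m + g - 1" using u' by linarith
    then have "bij_betw (fold_pos g) (?U' u') (?U (?m - 1))"
      using bij_fold_pos_start[OF s g, of "if u' < g then u' + 1 else 0" u'] s by auto
    then show ?thesis using s by (intro exI[of _ "?m - 1"]) auto
  qed
  show ?thesis
    unfolding m2
  proof (rule good_codeI)
    fix k assume "k < N"
    then obtain u where u: "u < ?m" "\<forall>x<?m. c k x \<noteq> 0 \<longrightarrow> knows ?m s u x"
      using good unfolding good_code_def by blast
    obtain u' where u': "u' < ?m + g" "bij_betw (fold_pos g) (?U' u') (?U u)"
      using forth[OF u(1)] by blast
    have "knows (?m + g) (s + g) u' x" if x: "x < ?m + g" "c k (fold_pos g x) \<noteq> 0" for x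
    proof (rule ccontr)
      assume "\<not> ?thesis"
      then have "fold_pos g x \<in> ?U u"
        using bij_betw_apply[OF u'(2), of x] x(1) by (simp add: unknown_def)
      then show False using u(2) x(2) by (auto simp: unknown_def)
    qed
    then show "\<exists>u<?m + g. \<forall>x<?m + g. c k (fold_pos g x) \<noteq> 0 \<longrightarrow> knows (?m + g) (s + g) u x"
      using u'(1) by blast
  next
    fix u' assume "u' < ?m + g"
    then obtain u where u: "u < ?m" and bij: "bij_betw (fold_pos g) (?U' u') (?U u)"
      using onto by blast
    obtain e k f where e: "e < ?m" "\<not> knows ?m s u e"
      and k: "k < N" "c k e \<noteq> 0" "\<forall>x<?m. c k x \<noteq> 0 \<longrightarrow> x = e \<or> knows ?m s u x"
      and f: "\<forall>x<?m. f x = 0 \<longleftrightarrow> x = e \<or> knows ?m s u x" "\<forall>k<N. (\<Sum>x<?m. c k x * f x) = 0"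
      using conjunct2[OF good[unfolded good_code_def], rule_format, OF u]
      by (elim exE conjE) (rule that)
    have "e \<in> ?U u" using e by (simp add: unknown_def)
    then obtain d where d: "d \<in> ?U' u'" "fold_pos g d = e"
      using bij unfolding bij_betw_def by (metis (no_types, lifting) imageE)
    have inU: "fold_pos g x \<in> ?U u" if "x \<in> ?U' u'" for x using bij that by (rule bij_betw_apply)
    have inj: "x = d" if "x \<in> ?U' u'" "fold_pos g x = e" for x
      using bij d that unfolding bij_betw_def by (metis (no_types, lifting) inj_onD)
    \<comment> \<open>The cutoff is needed: a known position may be the duplicate of an unknown one,
      where \<open>f\<close> composed with \<open>fold_pos\<close> would not vanish.\<close>
    define f' where "f' x = (if x \<in> ?U' u' then f (fold_pos g x) else 0)" for x
    have "f' x = 0 \<longleftrightarrow> x = d \<or> knows (?m + g) (s + g) u' x" if "x < ?m + g" for x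
      using inU[of x] inj[of x] f(1) d that by (auto simp: f'_def unknown_def)
    moreover have "(\<Sum>x<?m + g. c l (fold_pos g x) * f' x) = 0" if l: "l < N" for l
    proof -
      have "(\<Sum>x<?m + g. c l (fold_pos g x) * f' x) = (\<Sum>x\<in>?U' u'. c l (fold_pos g x) * f (fold_pos g x))"
        by (rule sum.mono_neutral_cong_right) (auto simp: f'_def unknown_def)
      also have "\<dots> = (\<Sum>x\<in>?U u. c l x * f x)"
        by (rule sum.reindex_bij_betw[OF bij])
      also have "\<dots> = (\<Sum>x<?m. c l x * f x)"
        using f(1) by (intro sum.mono_neutral_left) (auto simp: unknown_def)
      finally show ?thesis using f(2) l by simp
    qed
    moreover have "x = d \<or> knows (?m + g) (s + g) u' x" if "x < ?m + g" "c k (fold_pos g x) \<noteq> 0" for x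
    proof (rule ccontr)
      assume "\<not> ?thesis"
      then have "x \<in> ?U' u'" "x \<noteq> d" using that(1) by (auto simp: unknown_def)
      then have "fold_pos g x \<in> ?U u" "fold_pos g x \<noteq> e" using inU inj by auto
      then show False using k(3) that(2) by (auto simp: unknown_def)
    qed
    ultimately show "\<exists>d k f. d < ?m + g \<and> \<not> knows (?m + g) (s + g) u' d \<and> k < N \<and> c k (fold_pos g d) \<noteq> 0 \<and>
       (\<forall>x<?m + g. c k (fold_pos g x) \<noteq> 0 \<longrightarrow> x = d \<or> knows (?m + g) (s + g) u' x) \<and>
       (\<forall>x<?m + g. f x = 0 \<longleftrightarrow> x = d \<or> knows (?m + g) (s + g) u' x) \<and>
       (\<forall>k<N. (\<Sum>x<?m + g. c k (fold_pos g x) * f x) = 0)"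
      using d k by (intro exI[of _ d] exI[of _ k] exI[of _ f'] conjI) (auto simp: unknown_def)
  qed
qed

subsection \<open>Codes with coefficients zero and one\<close>

definition set_code :: "nat set list \<Rightarrow> nat \<Rightarrow> nat \<Rightarrow> f4" where
  "set_code Ss k x = (if x \<in> Ss ! k then 1 else 0)"

text \<open>A certificate for a word that is nonzero exactly on \<open>U\<close> and orthogonal to
  all the indicator words. The list is solved from its end: the head owns two points of
  \<open>U\<close> that no later set contains, so their values can be changed without spoiling the
  equations already solved.\<close>

inductive peelable :: "nat set \<Rightarrow> nat set list \<Rightarrow> bool" for U where
  Nil: "peelable U []"
| skip: "peelable U Ss \<Longrightarrow> S \<inter> U = {} \<Longrightarrow> peelable U (S # Ss)"
| peel: "peelable U Ss \<Longrightarrow> x \<noteq> y \<Longrightarrow> {x, y} \<subseteq> S \<inter> U \<Longrightarrow> {x, y} \<inter> \<Union> (set Ss) = {} \<Longrightarrow> peelable U (S # Ss)"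

text \<open>Over \<open>F4\<close> every element is a sum of two nonzero elements, so two new unknowns
  suffice to satisfy one more equation.\<close>

lemma peelable_weights:
  assumes "peelable U Ss" "\<forall>S\<in>set Ss. finite S"
  shows "\<exists>f :: nat \<Rightarrow> f4. (\<forall>x. f x = 0 \<longleftrightarrow> x \<notin> U) \<and> (\<forall>S\<in>set Ss. sum f S = 0)"
  using assms
proof (induction rule: peelable.induct)
  case Nil
  show ?case by (intro exI[of _ "\<lambda>x. if x \<in> U then 1 else 0"]) auto
next
  case (skip Ss S)
  then obtain f where f: "\<forall>x. f x = (0::f4) \<longleftrightarrow> x \<notin> U" "\<forall>S\<in>set Ss. sum f S = 0" by auto
  have "sum f S = 0" using skip.hyps(2) f(1) by (intro sum.neutral) blast
  then show ?case using f by auto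
next
  case (peel Ss x y S)
  then obtain f where f: "\<forall>x. f x = (0::f4) \<longleftrightarrow> x \<notin> U" "\<forall>S\<in>set Ss. sum f S = 0" by auto
  \<comment> \<open>The two new values add up to the remaining sum rather than to its negative,
    because in characteristic two these agree.\<close>
  obtain a b where ab: "a \<noteq> 0" "b \<noteq> 0" "a + b = sum f (S - {x, y})" by (rule f4_split)
  define h where "h = f(x := a, y := b)"
  have "h z = 0 \<longleftrightarrow> z \<notin> U" for z using f(1) ab peel.hyps(3) by (auto simp: h_def)
  moreover have "sum h T = 0" if T: "T \<in> set Ss" for T
  proof -
    have "sum h T = sum f T" using peel.hyps(4) T by (intro sum.cong) (auto simp: h_def)
    then show ?thesis using f(2) T by simp
  qed
  moreover have "sum h S = 0"
  proof -
    have S: "S = {x, y} \<union> (S - {x, y})" using peel.hyps(3) by auto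
    have "sum h S = sum h {x, y} + sum h (S - {x, y})"
      using peel.prems by (subst S, intro sum.union_disjoint) auto
    also have "sum h {x, y} = a + b" using peel.hyps(2) by (simp add: h_def)
    also have "sum h (S - {x, y}) = sum f (S - {x, y})" by (intro sum.cong) (auto simp: h_def)
    finally show ?thesis using ab by simp
  qed
  ultimately show ?case by (intro exI[of _ h]) auto
qed

text \<open>\<open>Ts\<close> lists the same sets as \<open>Ss\<close> in an order that may depend
  on the user, since the order of peeling does.\<close>

lemma good_set_codeI:
  assumes sub: "\<And>S. S \<in> set Ss \<Longrightarrow> S \<subseteq> {..<m}"
    and loc: "\<And>S. S \<in> set Ss \<Longrightarrow> \<exists>u<m. \<forall>x\<in>S. knows m s u x"
    and user: "\<And>u. u < m \<Longrightarrow> \<exists>d S Ts. S \<in> set Ss \<and> d \<in> S \<and> S \<inter> unknown m s u = {d} \<and>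
      set Ts = set Ss \<and> peelable (unknown m s u - {d}) Ts"
  shows "good_code m s (length Ss) (set_code Ss)"
proof (rule good_codeI)
  fix k assume k: "k < length Ss"
  then show "\<exists>u<m. \<forall>x<m. set_code Ss k x \<noteq> 0 \<longrightarrow> knows m s u x"
    using loc[OF nth_mem[OF k]] by (auto simp: set_code_def)
next
  fix u assume u: "u < m"
  obtain d S Ts where S: "S \<in> set Ss" "d \<in> S" "S \<inter> unknown m s u = {d}"
    and Ts: "set Ts = set Ss" "peelable (unknown m s u - {d}) Ts"
    using user[OF u] by blast
  have fin: "\<forall>S\<in>set Ts. finite S" using sub Ts(1) finite_subset by blast
  obtain f :: "nat \<Rightarrow> f4" where f: "\<forall>x. f x = 0 \<longleftrightarrow> x \<notin> unknown m s u - {d}" "\<forall>S\<in>set Ts. sum f S = 0"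
    using peelable_weights[OF Ts(2) fin] by blast
  obtain k where k: "k < length Ss" "Ss ! k = S" using S(1) by (auto simp: in_set_conv_nth)
  have d: "d < m" "\<not> knows m s u d" using S(3) by (auto simp: unknown_def)
  have "set_code Ss k d \<noteq> 0" using S(2) k by (simp add: set_code_def)
  moreover have "\<forall>x<m. set_code Ss k x \<noteq> 0 \<longrightarrow> x = d \<or> knows m s u x"
    using S(3) k by (auto simp: set_code_def unknown_def)
  moreover have "\<forall>x<m. f x = 0 \<longleftrightarrow> x = d \<or> knows m s u x"
    using f(1) by (auto simp: unknown_def)
  moreover have "\<forall>l<length Ss. (\<Sum>x<m. set_code Ss l x * f x) = 0"
  proof (intro allI impI)
    fix l assume l: "l < length Ss"
    have "(\<Sum>x<m. set_code Ss l x * f x) = (\<Sum>x\<in>{..<m} \<inter> Ss ! l. f x)"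
      by (subst sum.inter_restrict) (auto simp: set_code_def intro!: sum.cong)
    also have "{..<m} \<inter> Ss ! l = Ss ! l" using sub[OF nth_mem[OF l]] by blast
    finally show "(\<Sum>x<m. set_code Ss l x * f x) = 0"
      using f(2) Ts(1) nth_mem[OF l] by simp
  qed
  ultimately show "\<exists>d k f. d < m \<and> \<not> knows m s u d \<and> k < length Ss \<and> set_code Ss k d \<noteq> 0 \<and>
       (\<forall>x<m. set_code Ss k x \<noteq> 0 \<longrightarrow> x = d \<or> knows m s u x) \<and>
       (\<forall>x<m. f x = 0 \<longleftrightarrow> x = d \<or> knows m s u x) \<and> (\<forall>k<length Ss. (\<Sum>x<m. set_code Ss k x * f x) = 0)"
    using d k(1) by (intro exI[of _ d] exI[of _ k] exI[of _ f] conjI)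
qed

subsection \<open>Codes given by a table\<close>

text \<open>A row \<open>(st, d, k, f)\<close> of the table treats the users who know exactly the points of \<open>P\<close>
  flagged by \<open>st\<close>: they decode point \<open>d\<close> from codeword \<open>k\<close>, and \<open>f\<close> is a word orthogonal to the code
  whose support consists of the remaining unknown points.\<close>

definition row_ok :: "f4 list list \<Rightarrow> bool list \<times> nat \<times> nat \<times> f4 list \<Rightarrow> bool" where
  "row_ok C = (\<lambda>(st, d, k, f). d < length st \<and> \<not> st ! d \<and> length f = length st \<and> k < length C \<and>
     C ! k ! d \<noteq> 0 \<and>
     (\<forall>j\<in>set [0..<length st]. (C ! k ! j \<noteq> 0 \<longrightarrow> j = d \<or> st ! j) \<and> (f ! j = 0 \<longleftrightarrow> j = d \<or> st ! j)) \<and>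
     (\<forall>row\<in>set C. length row = length st \<and> sum_list (map2 (*) row f) = 0))"

definition at_point :: "nat list \<Rightarrow> f4 list \<Rightarrow> nat \<Rightarrow> f4 option" where
  "at_point P v = map_of (zip P v)"

definition table_code :: "nat list \<Rightarrow> f4 list list \<Rightarrow> nat \<Rightarrow> nat \<Rightarrow> f4" where
  "table_code P C k x = (case at_point P (C ! k) x of None \<Rightarrow> 0 | Some c \<Rightarrow> c)"

lemma at_point_nth:
  "distinct P \<Longrightarrow> length v = length P \<Longrightarrow> j < length P \<Longrightarrow> at_point P v (P ! j) = Some (v ! j)"
  by (simp add: at_point_def map_of_zip_nth)

lemma at_point_None: "length v = length P \<Longrightarrow> x \<notin> set P \<Longrightarrow> at_point P v x = None"
  by (auto simp: at_point_def map_of_eq_None_iff dest: set_zip_leftD)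

lemma table_code_nth:
  assumes "distinct P" "length (C ! k) = length P"
  shows "j < length P \<Longrightarrow> table_code P C k (P ! j) = C ! k ! j"
    and "x \<notin> set P \<Longrightarrow> table_code P C k x = 0"
  using assms by (simp_all add: table_code_def at_point_nth at_point_None)

text \<open>Positions outside \<open>P\<close> carry the coefficient zero, so only the flags on
  \<open>P\<close> matter. The circle may then grow with a parameter while the check of the rows
  remains a finite computation; linear arithmetic is left with determining the flags.\<close>

lemma good_table_code:
  assumes P: "distinct P" "set P \<subseteq> {..<m}"
    and len: "\<forall>row\<in>set C. length row = length P"
    and loc: "\<And>row. row \<in> set C \<Longrightarrow> \<exists>u<m. list_all2 (\<lambda>x c. c \<noteq> 0 \<longrightarrow> knows m s u x) P row"
    and states: "\<And>u. u < m \<Longrightarrow> map (knows m s u) P \<in> fst ` set T"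
    and ok: "\<forall>r\<in>set T. row_ok C r"
  shows "good_code m s (length C) (table_code P C)"
proof (rule good_codeI)
  have pos: "x \<in> set P \<Longrightarrow> \<exists>j<length P. x = P ! j" for x by (metis in_set_conv_nth)
  {
    fix k assume k: "k < length C"
    then have row: "C ! k \<in> set C" "length (C ! k) = length P" using len by auto
    obtain u where u: "u < m" "\<forall>j<length P. C ! k ! j \<noteq> 0 \<longrightarrow> knows m s u (P ! j)"
      using loc[OF row(1)] by (auto simp: list_all2_conv_all_nth)
    have "knows m s u x" if "table_code P C k x \<noteq> 0" for x
    proof -
      have "x \<in> set P" using table_code_nth(2)[OF P(1) row(2)] that by blast
      then obtain j where "j < length P" "x = P ! j" using pos by blast
      then show ?thesis using u(2) that table_code_nth(1)[of P C k j, OF P(1) row(2)] by auto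
    qed
    then show "\<exists>u<m. \<forall>x<m. table_code P C k x \<noteq> 0 \<longrightarrow> knows m s u x" using u(1) by blast
  }
  fix u assume u: "u < m"
  obtain d k f where r: "(map (knows m s u) P, d, k, f) \<in> set T"
    using states[OF u] by force
  have ok': "row_ok C (map (knows m s u) P, d, k, f)" using ok r by blast
  then have d: "d < length P" "\<not> knows m s u (P ! d)" and f: "length f = length P"
    and k: "k < length C" "C ! k ! d \<noteq> 0"
    and kj: "\<And>j. j < length P \<Longrightarrow> C ! k ! j \<noteq> 0 \<Longrightarrow> j = d \<or> knows m s u (P ! j)"
    and fj: "\<And>j. j < length P \<Longrightarrow> f ! j = 0 \<longleftrightarrow> j = d \<or> knows m s u (P ! j)"
    and orth: "\<And>row. row \<in> set C \<Longrightarrow> sum_list (map2 (*) row f) = 0"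
    unfolding row_ok_def by auto
  have lenk: "length (C ! l) = length P" if "l < length C" for l using len that by auto
  \<comment> \<open>Unknown positions outside \<open>P\<close> occur in no codeword, so any nonzero
    weight does; 1 is taken.\<close>
  define h where "h x = (case at_point P f x of None \<Rightarrow> if knows m s u x then 0 else 1 | Some c \<Rightarrow> c)" for x
  have h: "h (P ! j) = f ! j" if "j < length P" for j
    using that P(1) f by (simp add: h_def at_point_nth)
  have h0: "h x = 0 \<longleftrightarrow> x = P ! d \<or> knows m s u x" for x
  proof (cases "x \<in> set P")
    case True
    then obtain j where j: "j < length P" "x = P ! j" using pos by blast
    then show ?thesis using h[OF j(1)] fj[OF j(1)] P(1) d(1) by (simp add: nth_eq_iff_index_eq)
  next
    case False
    moreover have "x \<noteq> P ! d" using False d(1) by auto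
    ultimately show ?thesis using at_point_None[OF f False] by (simp add: h_def)
  qed
  have dec: "x = P ! d \<or> knows m s u x" if "table_code P C k x \<noteq> 0" for x
  proof -
    have "x \<in> set P" using table_code_nth(2)[OF P(1) lenk[OF k(1)]] that by blast
    then obtain j where j: "j < length P" "x = P ! j" using pos by blast
    then show ?thesis using kj[OF j(1)] that table_code_nth(1)[OF P(1) lenk[OF k(1)] j(1)] by auto
  qed
  have "(\<Sum>x<m. table_code P C l x * h x) = 0" if l: "l < length C" for l
  proof -
    have "(\<Sum>x<m. table_code P C l x * h x) = (\<Sum>x\<in>set P. table_code P C l x * h x)"
      using P(2) table_code_nth(2)[OF P(1) lenk[OF l]] by (intro sum.mono_neutral_right) auto
    also have "\<dots> = sum_list (map (\<lambda>x. table_code P C l x * h x) P)"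
      using P(1) by (simp add: sum_list_distinct_conv_sum_set)
    also have "map (\<lambda>x. table_code P C l x * h x) P = map2 (*) (C ! l) f"
      using lenk[OF l] f h table_code_nth(1)[OF P(1) lenk[OF l]] by (intro nth_equalityI) auto
    finally show ?thesis using orth l by simp
  qed
  moreover have "P ! d < m" using P(2) d(1) nth_mem by blast
  moreover have "table_code P C k (P ! d) \<noteq> 0"
    using table_code_nth(1)[OF P(1) lenk[OF k(1)] d(1)] k(2) by simp
  ultimately show "\<exists>d k f. d < m \<and> \<not> knows m s u d \<and> k < length C \<and> table_code P C k d \<noteq> 0 \<and>
       (\<forall>x<m. table_code P C k x \<noteq> 0 \<longrightarrow> x = d \<or> knows m s u x) \<and>
       (\<forall>x<m. f x = 0 \<longleftrightarrow> x = d \<or> knows m s u x) \<and> (\<forall>k<length C. (\<Sum>x<m. table_code P C k x * f x) = 0)"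
    using d(2) k(1) dec h0 by (intro exI[of _ "P ! d"] exI[of _ k] exI[of _ h] conjI) auto
qed

definition finite_table_ok ::
    "nat \<Rightarrow> nat \<Rightarrow> f4 list list \<Rightarrow> (bool list \<times> nat \<times> nat \<times> f4 list) list \<Rightarrow> bool" where
  "finite_table_ok m s C T \<longleftrightarrow>
    list_all (\<lambda>row. length row = m \<and>
      list_ex (\<lambda>u. list_all2 (\<lambda>x c. c \<noteq> 0 \<longrightarrow> knows m s u x) [0..<m] row) [0..<m]) C \<and>
    list_all (\<lambda>u. map (knows m s u) [0..<m] \<in> set (map fst T)) [0..<m] \<and> list_all (row_ok C) T"

lemma finite_table:
  assumes "finite_table_ok m s C T"
  shows "good_code m s (length C) (table_code [0..<m] C)"
  using assms unfolding finite_table_ok_def list_all_iff list_ex_iff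
  by (intro good_table_code[where T = T]) (fastforce simp: image_iff)+

text \<open>Together with the next three lemmas this gives one-directional criteria, one for each
  position of the known window relative to \<open>x\<close>, whose premises are linear. A flag in a
  table row is proved by the one whose premises \<open>linarith\<close> can discharge.\<close>

lemma knows_below: "u < m \<Longrightarrow> x \<le> u \<Longrightarrow> u < x + s \<Longrightarrow> knows m s u x"
proof -
  assume a: "u < m" "x \<le> u" "u < x + s"
  then have "u + m - x = (u - x) + m" by simp
  then have "(u + m - x) mod m = u - x" using a(1) by (simp only: mod_add_self2) simp
  then show ?thesis unfolding knows_def using a by linarith
qed

lemma knows_wrap: "u < m \<Longrightarrow> u < x \<Longrightarrow> x < m \<Longrightarrow> u + m < x + s \<Longrightarrow> knows m s u x"
  by (simp add: knows_def)

lemma not_knows_gap: "u < m \<Longrightarrow> u < x \<Longrightarrow> x < m \<Longrightarrow> x + s \<le> u + m \<Longrightarrow> \<not> knows m s u x"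
  by (simp add: knows_def)

lemma not_knows_above: "u < m \<Longrightarrow> x + s \<le> u \<Longrightarrow> \<not> knows m s u x"
proof -
  assume a: "u < m" "x + s \<le> u"
  then have "u + m - x = (u - x) + m" by simp
  then have "(u + m - x) mod m = u - x" using a(1) by (simp only: mod_add_self2) simp
  then show ?thesis unfolding knows_def using a by linarith
qed

section \<open>Isolated parameters, checked by evaluation\<close>

definition c9_5_code :: "f4 list list" where
  "c9_5_code = [[F1, F0, F1, Fb, F0, F0, F0, F0, F0],
   [F0, F0, F0, Fa, F1, F1, F0, F0, F0],
   [Fb, F1, F0, F0, F0, F0, F0, Fb, Fb],
   [F0, F0, F0, F0, F0, Fb, Fb, Fa, Fb]]"

definition c9_5_table :: "(bool list \<times> nat \<times> nat \<times> f4 list) list" where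
  "c9_5_table = [([True, False, False, False, False, True, True, True, True], 1, 2, [F0, F0, F1, Fa, Fb, F0, F0, F0, F0]),
   ([True, True, False, False, False, False, True, True, True], 5, 3, [F0, F0, F1, Fa, Fb, F0, F0, F0, F0]),
   ([True, True, True, False, False, False, False, True, True], 3, 0, [F0, F0, F0, F0, F1, F1, F1, F0, F0]),
   ([True, True, True, True, False, False, False, False, True], 7, 2, [F0, F0, F0, F0, F1, F1, F1, F0, F0]),
   ([True, True, True, True, True, False, False, False, False], 5, 1, [F0, F0, F0, F0, F0, F0, F1, Fb, Fb]),
   ([False, True, True, True, True, True, False, False, False], 0, 0, [F0, F0, F0, F0, F0, F0, F1, Fb, Fb]),
   ([False, False, True, True, True, True, True, False, False], 0, 0, [F0, F1, F0, F0, F0, F0, F0, F1, Fb]),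
   ([False, False, False, True, True, True, True, True, False], 8, 3, [F1, Fb, F1, F0, F0, F0, F0, F0, F0]),
   ([False, False, False, False, True, True, True, True, True], 3, 1, [F1, Fb, F1, F0, F0, F0, F0, F0, F0])]"

lemma good_9_5: "good_code 9 5 4 (table_code [0..<9] c9_5_code)"
proof -
  have "finite_table_ok 9 5 c9_5_code c9_5_table"
    unfolding c9_5_code_def c9_5_table_def by code_simp
  moreover have "length c9_5_code = 4" by (simp add: c9_5_code_def)
  ultimately show ?thesis using finite_table by metis
qed

definition c11_5_code :: "f4 list list" where
  "c11_5_code = [[Fb, F0, F0, F0, F0, F0, F0, F0, Fa, F1, F0],
   [Fb, F1, Fb, F0, F0, F0, F0, F0, F0, F0, Fa],
   [F0, Fb, Fa, Fb, F1, F0, F0, F0, F0, F0, F0],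
   [F0, F0, F0, F1, F1, Fb, F1, F0, F0, F0, F0],
   [F0, F0, F0, F0, F0, F0, Fa, Fa, Fb, F0, F0]]"

definition c11_5_table :: "(bool list \<times> nat \<times> nat \<times> f4 list) list" where
  "c11_5_table = [([True, False, False, False, False, False, False, True, True, True, True], 6, 4, [F0, F1, Fa, F1, Fb, Fb, F0, F0, F0, F0, F0]),
   ([True, True, False, False, False, False, False, False, True, True, True], 2, 1, [F0, F0, F0, F1, Fb, F1, F1, F1, F0, F0, F0]),
   ([True, True, True, False, False, False, False, False, False, True, True], 8, 0, [F0, F0, F0, F1, Fb, F1, F1, F1, F0, F0, F0]),
   ([True, True, True, True, False, False, False, False, False, False, True], 4, 2, [F0, F0, F0, F0, F0, F1, Fb, F1, F1, Fa, F0]),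
   ([True, True, True, True, True, False, False, False, False, False, False], 10, 1, [F0, F0, F0, F0, F0, F1, Fb, F1, F1, Fa, F0]),
   ([False, True, True, True, True, True, False, False, False, False, False], 6, 3, [F1, F0, F0, F0, F0, F0, F0, F1, Fb, Fa, Fa]),
   ([False, False, True, True, True, True, True, False, False, False, False], 1, 2, [F1, F0, F0, F0, F0, F0, F0, F1, Fb, Fa, Fa]),
   ([False, False, False, True, True, True, True, True, False, False, False], 8, 4, [F1, F1, Fa, F0, F0, F0, F0, F0, F0, Fb, Fa]),
   ([False, False, False, False, True, True, True, True, True, False, False], 3, 3, [F1, F1, Fa, F0, F0, F0, F0, F0, F0, Fb, Fa]),
   ([False, False, False, False, False, True, True, True, True, True, False], 0, 0, [F0, F1, F1, Fb, Fb, F0, F0, F0, F0, F0, F1]),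
   ([False, False, False, False, False, False, True, True, True, True, True], 0, 0, [F0, F1, Fa, F1, Fb, Fb, F0, F0, F0, F0, F0])]"

lemma good_11_5: "good_code 11 5 5 (table_code [0..<11] c11_5_code)"
proof -
  have "finite_table_ok 11 5 c11_5_code c11_5_table"
    unfolding c11_5_code_def c11_5_table_def by code_simp
  moreover have "length c11_5_code = 5" by (simp add: c11_5_code_def)
  ultimately show ?thesis using finite_table by metis
qed

definition c10_6_code :: "f4 list list" where
  "c10_6_code = [[Fb, Fb, F0, F0, F0, F0, F0, Fa, F1, F0],
   [F0, Fb, Fb, Fa, F0, F0, F0, F0, F0, F1],
   [F0, F0, Fb, F0, Fb, Fa, F0, F0, F0, F0],
   [F0, F0, F0, F0, F0, Fa, F1, Fb, Fb, F0]]"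

definition c10_6_table :: "(bool list \<times> nat \<times> nat \<times> f4 list) list" where
  "c10_6_table = [([True, False, False, False, False, True, True, True, True, True], 1, 0, [F0, F0, F1, Fa, F1, F0, F0, F0, F0, F0]),
   ([True, True, False, False, False, False, True, True, True, True], 5, 3, [F0, F0, F1, Fa, F1, F0, F0, F0, F0, F0]),
   ([True, True, True, False, False, False, False, True, True, True], 3, 1, [F0, F0, F0, F0, F1, Fa, Fb, F0, F0, F0]),
   ([True, True, True, True, False, False, False, False, True, True], 7, 0, [F0, F0, F0, F0, F1, Fa, Fb, F0, F0, F0]),
   ([True, True, True, True, True, False, False, False, False, True], 5, 2, [F0, F0, F0, F0, F0, F0, F1, Fb, F1, F0]),
   ([True, True, True, True, True, True, False, False, False, False], 9, 1, [F0, F0, F0, F0, F0, F0, F1, Fb, F1, F0]),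
   ([False, True, True, True, True, True, True, False, False, False], 9, 1, [F1, F0, F0, F0, F0, F0, F0, F1, F1, F0]),
   ([False, False, True, True, True, True, True, True, False, False], 8, 3, [F1, F1, F0, F0, F0, F0, F0, F0, F0, Fb]),
   ([False, False, False, True, True, True, True, True, True, False], 2, 2, [F1, F1, F0, F0, F0, F0, F0, F0, F0, Fb]),
   ([False, False, False, False, True, True, True, True, True, True], 2, 2, [F1, F1, F0, Fa, F0, F0, F0, F0, F0, F0])]"

lemma good_10_6: "good_code 10 6 4 (table_code [0..<10] c10_6_code)"
proof -
  have "finite_table_ok 10 6 c10_6_code c10_6_table"
    unfolding c10_6_code_def c10_6_table_def by code_simp
  moreover have "length c10_6_code = 4" by (simp add: c10_6_code_def)
  ultimately show ?thesis using finite_table by metis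
qed

definition c13_5_code :: "f4 list list" where
  "c13_5_code = [[F1, F0, F1, F0, F0, F0, F0, F0, F0, F0, F0, F0, F1],
   [F0, F1, F0, F1, F1, F0, F0, F0, F0, F0, F0, F0, F0],
   [F0, F0, F0, F0, F1, F1, F1, F0, F0, F0, F0, F0, F0],
   [F0, F0, F0, F0, F0, F0, F1, F0, F1, F1, F0, F0, F0],
   [F0, F0, F0, F0, F0, F0, F0, F0, F0, F0, F1, F1, F0]]"

definition c13_5_table :: "(bool list \<times> nat \<times> nat \<times> f4 list) list" where
  "c13_5_table = [([True, False, False, False, False, False, False, False, False, True, True, True, True], 2, 0, [F0, F1, F0, Fa, Fb, F1, Fa, F1, Fa, F0, F0, F0, F0]),
   ([True, True, False, False, False, False, False, False, False, False, True, True, True], 2, 0, [F0, F0, F0, F1, F1, Fa, Fb, F1, F1, Fa, F0, F0, F0]),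
   ([True, True, True, False, False, False, False, False, False, False, False, True, True], 10, 4, [F0, F0, F0, F1, F1, Fa, Fb, F1, F1, Fa, F0, F0, F0]),
   ([True, True, True, True, False, False, False, False, False, False, False, False, True], 4, 1, [F0, F0, F0, F0, F0, F1, F1, F1, Fa, Fb, F1, F1, F0]),
   ([True, True, True, True, True, False, False, False, False, False, False, False, False], 12, 0, [F0, F0, F0, F0, F0, F1, F1, F1, Fa, Fb, F1, F1, F0]),
   ([False, True, True, True, True, True, False, False, False, False, False, False, False], 6, 2, [F1, F0, F0, F0, F0, F0, F0, F1, F1, F1, F1, F1, F1]),
   ([False, False, True, True, True, True, True, False, False, False, False, False, False], 1, 1, [F1, F0, F0, F0, F0, F0, F0, F1, F1, F1, F1, F1, F1]),
   ([False, False, False, True, True, True, True, True, False, False, False, False, False], 1, 1, [F1, F0, Fa, F0, F0, F0, F0, F0, F1, F1, F1, F1, Fb]),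
   ([False, False, False, False, True, True, True, True, True, False, False, False, False], 9, 3, [F1, F1, Fa, F1, F0, F0, F0, F0, F0, F0, F1, F1, Fb]),
   ([False, False, False, False, False, True, True, True, True, True, False, False, False], 4, 2, [F1, F1, Fa, F1, F0, F0, F0, F0, F0, F0, F1, F1, Fb]),
   ([False, False, False, False, False, False, True, True, True, True, True, False, False], 11, 4, [F1, F1, Fa, Fa, Fb, Fb, F0, F0, F0, F0, F0, F0, Fb]),
   ([False, False, False, False, False, False, False, True, True, True, True, True, False], 6, 3, [F1, F1, Fa, Fa, Fb, Fb, F0, F0, F0, F0, F0, F0, Fb]),
   ([False, False, False, False, False, False, False, False, True, True, True, True, True], 6, 3, [F1, F1, F1, Fa, Fb, Fb, F0, F1, F0, F0, F0, F0, F0])]"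

lemma good_13_5: "good_code 13 5 5 (table_code [0..<13] c13_5_code)"
proof -
  have "finite_table_ok 13 5 c13_5_code c13_5_table"
    unfolding c13_5_code_def c13_5_table_def by code_simp
  moreover have "length c13_5_code = 5" by (simp add: c13_5_code_def)
  ultimately show ?thesis using finite_table by metis
qed

definition c10_7_code :: "f4 list list" where
  "c10_7_code = [[F1, F0, F1, F0, F0, F0, F0, F1, F0, F1],
   [F0, F1, F0, F1, F1, F0, F0, F0, F0, F0],
   [F0, F0, F0, F0, F0, F1, F1, F0, F1, F0]]"

definition c10_7_table :: "(bool list \<times> nat \<times> nat \<times> f4 list) list" where
  "c10_7_table = [([True, False, False, False, True, True, True, True, True, True], 2, 0, [F0, F1, F0, F1, F0, F0, F0, F0, F0, F0]),
   ([True, True, False, False, False, True, True, True, True, True], 2, 0, [F0, F0, F0, F1, F1, F0, F0, F0, F0, F0]),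
   ([True, True, True, False, False, False, True, True, True, True], 5, 2, [F0, F0, F0, F1, F1, F0, F0, F0, F0, F0]),
   ([True, True, True, True, False, False, False, True, True, True], 4, 1, [F0, F0, F0, F0, F0, F1, F1, F0, F0, F0]),
   ([True, True, True, True, True, False, False, False, True, True], 7, 0, [F0, F0, F0, F0, F0, F1, F1, F0, F0, F0]),
   ([True, True, True, True, True, True, False, False, False, True], 7, 0, [F0, F0, F0, F0, F0, F0, F1, F0, F1, F0]),
   ([True, True, True, True, True, True, True, False, False, False], 8, 2, [F0, F0, F0, F0, F0, F0, F0, F1, F0, F1]),
   ([False, True, True, True, True, True, True, True, False, False], 8, 2, [F1, F0, F0, F0, F0, F0, F0, F0, F0, F1]),
   ([False, False, True, True, True, True, True, True, True, False], 1, 1, [F1, F0, F0, F0, F0, F0, F0, F0, F0, F1]),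
   ([False, False, False, True, True, True, True, True, True, True], 1, 1, [F1, F0, F1, F0, F0, F0, F0, F0, F0, F0])]"

lemma good_10_7: "good_code 10 7 3 (table_code [0..<10] c10_7_code)"
proof -
  have "finite_table_ok 10 7 c10_7_code c10_7_table"
    unfolding c10_7_code_def c10_7_table_def by code_simp
  moreover have "length c10_7_code = 3" by (simp add: c10_7_code_def)
  ultimately show ?thesis using finite_table by metis
qed

definition c8_5_code :: "f4 list list" where
  "c8_5_code = [[F1, F0, F1, F0, F0, F0, F0, F1],
   [F0, F1, F0, F1, F1, F0, F0, F0],
   [F0, F0, F0, F0, F0, F1, F1, F0]]"

definition c8_5_table :: "(bool list \<times> nat \<times> nat \<times> f4 list) list" where
  "c8_5_table = [([True, False, False, False, True, True, True, True], 2, 0, [F0, F1, F0, F1, F0, F0, F0, F0]),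
   ([True, True, False, False, False, True, True, True], 2, 0, [F0, F0, F0, F1, F1, F0, F0, F0]),
   ([True, True, True, False, False, False, True, True], 5, 2, [F0, F0, F0, F1, F1, F0, F0, F0]),
   ([True, True, True, True, False, False, False, True], 4, 1, [F0, F0, F0, F0, F0, F1, F1, F0]),
   ([True, True, True, True, True, False, False, False], 7, 0, [F0, F0, F0, F0, F0, F1, F1, F0]),
   ([False, True, True, True, True, True, False, False], 6, 2, [F1, F0, F0, F0, F0, F0, F0, F1]),
   ([False, False, True, True, True, True, True, False], 1, 1, [F1, F0, F0, F0, F0, F0, F0, F1]),
   ([False, False, False, True, True, True, True, True], 1, 1, [F1, F0, F1, F0, F0, F0, F0, F0])]"

lemma good_8_5: "good_code 8 5 3 (table_code [0..<8] c8_5_code)"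
proof -
  have "finite_table_ok 8 5 c8_5_code c8_5_table"
    unfolding c8_5_code_def c8_5_table_def by code_simp
  moreover have "length c8_5_code = 3" by (simp add: c8_5_code_def)
  ultimately show ?thesis using finite_table by metis
qed

definition c13_8_code :: "f4 list list" where
  "c13_8_code = [[F1, F0, F1, F0, F0, F0, F0, F0, F0, F0, F0, F0, F0],
   [F0, F0, F0, F1, F0, F1, F0, F0, F1, F0, F0, F0, F0],
   [F0, F0, F0, F0, F0, F0, F0, F1, F0, F0, F1, F1, F0]]"

definition c13_8_table :: "(bool list \<times> nat \<times> nat \<times> f4 list) list" where
  "c13_8_table = [([True, False, False, False, False, False, True, True, True, True, True, True, True], 2, 0, [F0, F1, F0, F1, F1, F1, F0, F0, F0, F0, F0, F0, F0]),
   ([True, True, False, False, False, False, False, True, True, True, True, True, True], 2, 0, [F0, F0, F0, F1, F1, F1, F1, F0, F0, F0, F0, F0, F0]),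
   ([True, True, True, False, False, False, False, False, True, True, True, True, True], 7, 2, [F0, F0, F0, F1, F1, F1, F1, F0, F0, F0, F0, F0, F0]),
   ([True, True, True, True, False, False, False, False, False, True, True, True, True], 7, 2, [F0, F0, F0, F0, F1, F1, F1, F0, F1, F0, F0, F0, F0]),
   ([True, True, True, True, True, False, False, False, False, False, True, True, True], 7, 2, [F0, F0, F0, F0, F0, F1, F1, F0, F1, F1, F0, F0, F0]),
   ([True, True, True, True, True, True, False, False, False, False, False, True, True], 8, 1, [F0, F0, F0, F0, F0, F0, F1, F1, F0, F1, F1, F0, F0]),
   ([True, True, True, True, True, True, True, False, False, False, False, False, True], 8, 1, [F0, F0, F0, F0, F0, F0, F0, F1, F0, F1, Fa, Fb, F0]),
   ([True, True, True, True, True, True, True, True, False, False, False, False, False], 8, 1, [F0, F0, F0, F0, F0, F0, F0, F0, F0, F1, F1, F1, F1]),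
   ([False, True, True, True, True, True, True, True, True, False, False, False, False], 0, 0, [F0, F0, F0, F0, F0, F0, F0, F0, F0, F1, F1, F1, F1]),
   ([False, False, True, True, True, True, True, True, True, True, False, False, False], 0, 0, [F0, F1, F0, F0, F0, F0, F0, F0, F0, F0, F1, F1, F1]),
   ([False, False, False, True, True, True, True, True, True, True, True, False, False], 11, 2, [F1, F1, F1, F0, F0, F0, F0, F0, F0, F0, F0, F0, F1]),
   ([False, False, False, False, True, True, True, True, True, True, True, True, False], 3, 1, [F1, F1, F1, F0, F0, F0, F0, F0, F0, F0, F0, F0, F1]),
   ([False, False, False, False, False, True, True, True, True, True, True, True, True], 3, 1, [F1, F1, F1, F0, F1, F0, F0, F0, F0, F0, F0, F0, F0])]"

lemma good_13_8: "good_code 13 8 3 (table_code [0..<13] c13_8_code)"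
proof -
  have "finite_table_ok 13 8 c13_8_code c13_8_table"
    unfolding c13_8_code_def c13_8_table_def by code_simp
  moreover have "length c13_8_code = 3" by (simp add: c13_8_code_def)
  ultimately show ?thesis using finite_table by metis
qed

definition c11_6_code :: "f4 list list" where
  "c11_6_code = [[F1, F1, F0, F0, F0, F0, F0, F0, F0, F1, F1],
   [F1, F0, F1, F1, F1, F0, F0, F0, F0, F0, F0],
   [F0, F0, F0, F1, F0, F1, F1, F0, F0, F0, F0],
   [F0, F0, F0, F0, F0, F0, F1, F0, F1, F1, F0]]"

definition c11_6_table :: "(bool list \<times> nat \<times> nat \<times> f4 list) list" where
  "c11_6_table = [([True, False, False, False, False, False, True, True, True, True, True], 1, 0, [F0, F0, F1, Fa, Fb, Fa, F0, F0, F0, F0, F0]),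
   ([True, True, False, False, False, False, False, True, True, True, True], 6, 3, [F0, F0, F1, Fa, Fb, Fa, F0, F0, F0, F0, F0]),
   ([True, True, True, False, False, False, False, False, True, True, True], 6, 3, [F0, F0, F0, F1, F1, F1, F0, F1, F0, F0, F0]),
   ([True, True, True, True, False, False, False, False, False, True, True], 4, 1, [F0, F0, F0, F0, F0, F1, F1, F1, F1, F0, F0]),
   ([True, True, True, True, True, False, False, False, False, False, True], 9, 0, [F0, F0, F0, F0, F0, F1, F1, F1, F1, F0, F0]),
   ([True, True, True, True, True, True, False, False, False, False, False], 6, 2, [F0, F0, F0, F0, F0, F0, F0, F1, F1, F1, F1]),
   ([False, True, True, True, True, True, True, False, False, False, False], 0, 1, [F0, F0, F0, F0, F0, F0, F0, F1, F1, F1, F1]),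
   ([False, False, True, True, True, True, True, True, False, False, False], 0, 1, [F0, F1, F0, F0, F0, F0, F0, F0, Fa, Fa, Fb]),
   ([False, False, False, True, True, True, True, True, True, False, False], 9, 3, [F1, Fa, F1, F0, F0, F0, F0, F0, F0, F0, Fb]),
   ([False, False, False, False, True, True, True, True, True, True, False], 3, 2, [F1, Fa, F1, F0, F0, F0, F0, F0, F0, F0, Fb]),
   ([False, False, False, False, False, True, True, True, True, True, True], 3, 2, [F1, F1, Fa, F0, Fb, F0, F0, F0, F0, F0, F0])]"

lemma good_11_6: "good_code 11 6 4 (table_code [0..<11] c11_6_code)"
proof -
  have "finite_table_ok 11 6 c11_6_code c11_6_table"
    unfolding c11_6_code_def c11_6_table_def by code_simp
  moreover have "length c11_6_code = 4" by (simp add: c11_6_code_def)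
  ultimately show ?thesis using finite_table by metis
qed

lemmas list_eq_simps = list.map list.inject simp_thms
lemmas list_all2_simps = list.rel_inject zero_f4_def f4.distinct simp_thms

section \<open>Parametric families of sparse codes\<close>

definition gap_code :: "f4 list list" where
  "gap_code = [[F1, F1, F0, F0, F0, F0, F0, F0, F0],
   [F0, F0, F1, F1, F1, F0, F0, F0, F0],
   [F0, F0, F0, F0, F0, F1, F1, F1, F1]]"

definition gap_table :: "(bool list \<times> nat \<times> nat \<times> f4 list) list" where
  "gap_table = [([True, False, False, False, True, True, True, True, True], 1, 0, [F0, F0, F1, F1, F0, F0, F0, F0, F0]),
   ([True, True, False, False, True, False, True, True, True], 5, 2, [F0, F0, F1, F1, F0, F0, F0, F0, F0]),
   ([True, True, True, False, False, False, True, True, True], 5, 2, [F0, F0, F0, F1, F1, F0, F0, F0, F0]),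
   ([True, True, True, True, False, False, False, True, True], 4, 1, [F0, F0, F0, F0, F0, F1, F1, F0, F0]),
   ([True, True, True, True, False, False, False, False, True], 4, 1, [F0, F0, F0, F0, F0, F1, Fa, Fb, F0]),
   ([True, True, True, True, False, True, False, False, False], 4, 1, [F0, F0, F0, F0, F0, F0, F1, Fa, Fb]),
   ([False, True, True, True, True, True, False, False, False], 0, 0, [F0, F0, F0, F0, F0, F0, F1, Fa, Fb]),
   ([False, True, True, True, True, True, True, False, False], 0, 0, [F0, F0, F0, F0, F0, F0, F0, F1, F1]),
   ([False, False, True, True, True, True, True, True, False], 8, 2, [F1, F1, F0, F0, F0, F0, F0, F0, F0]),
   ([False, False, False, True, True, True, True, True, True], 2, 1, [F1, F1, F0, F0, F0, F0, F0, F0, F0]),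
   ([True, False, False, False, False, True, True, True, True], 1, 0, [F0, F0, F1, Fa, Fb, F0, F0, F0, F0]),
   ([True, True, False, False, False, False, True, True, True], 5, 2, [F0, F0, F1, Fa, Fb, F0, F0, F0, F0]),
   ([True, True, True, True, False, False, False, False, False], 4, 1, [F0, F0, F0, F0, F0, F1, F1, F1, F1]),
   ([False, True, True, True, True, False, False, False, False], 0, 0, [F0, F0, F0, F0, F0, F1, F1, F1, F1])]"

text \<open>With \<open>g = h + 2\<close> unknown messages this is the case
  \<open>m = 2 * g + r\<close>. For \<open>r = h\<close> the points \<open>h + 2 + r\<close> and
  \<open>2 * h + 2\<close> coincide, and for \<open>r = 2\<close> the points
  \<open>2 * h + 4\<close> and \<open>2 * h + 2 + r\<close> do; both cases have their own code
  below.\<close>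

lemma good_gap:
  assumes "3 \<le> r" "r \<le> h + 1" "r \<noteq> h"
  shows "good_code (2 * h + 4 + r) (h + 2 + r) 3 (table_code [0, h, h + 1, h + 2, h + 2 + r, 2 * h + 2, 2 * h + 4, 2 * h + 2 + r, 2 * h + 3 + r] gap_code)"
proof -
  let ?m = "2 * h + 4 + r" and ?s = "h + 2 + r" and ?P = "[0, h, h + 1, h + 2, h + 2 + r, 2 * h + 2, 2 * h + 4, 2 * h + 2 + r, 2 * h + 3 + r]"
  have "good_code ?m ?s (length gap_code) (table_code ?P gap_code)"
  proof (rule good_table_code[where T = gap_table])
    show "distinct ?P" using assms by simp
    show "set ?P \<subseteq> {..<?m}" using assms by simp
    show "\<forall>row\<in>set gap_code. length row = length ?P" by (simp add: gap_code_def)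
    have "list_all (row_ok gap_code) gap_table" unfolding gap_code_def gap_table_def by code_simp
    then show "\<forall>r\<in>set gap_table. row_ok gap_code r" by (simp add: list_all_iff)
    fix row assume "row \<in> set gap_code"
    then consider "row = [F1, F1, F0, F0, F0, F0, F0, F0, F0]" | "row = [F0, F0, F1, F1, F1, F0, F0, F0, F0]" | "row = [F0, F0, F0, F0, F0, F1, F1, F1, F1]"
      unfolding gap_code_def by auto
    then show "\<exists>u<?m. list_all2 (\<lambda>x c. c \<noteq> 0 \<longrightarrow> knows ?m ?s u x) ?P row"
    proof cases
      case 1
      have w: "h < ?m" using assms by linarith
      note K = knows_below[OF w] knows_wrap[OF w]
      have "list_all2 (\<lambda>x c. c \<noteq> 0 \<longrightarrow> knows ?m ?s (h) x) ?P row"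
        by (insert assms, simp only: 1 list_all2_simps, intro conjI, (rule K; linarith)+)
      then show ?thesis using w by blast
    next
      case 2
      have w: "h + 2 + r < ?m" using assms by linarith
      note K = knows_below[OF w] knows_wrap[OF w]
      have "list_all2 (\<lambda>x c. c \<noteq> 0 \<longrightarrow> knows ?m ?s (h + 2 + r) x) ?P row"
        by (insert assms, simp only: 2 list_all2_simps, intro conjI, (rule K; linarith)+)
      then show ?thesis using w by blast
    next
      case 3
      have w: "2 * h + 3 + r < ?m" using assms by linarith
      note K = knows_below[OF w] knows_wrap[OF w]
      have "list_all2 (\<lambda>x c. c \<noteq> 0 \<longrightarrow> knows ?m ?s (2 * h + 3 + r) x) ?P row"
        by (insert assms, simp only: 3 list_all2_simps, intro conjI, (rule K; linarith)+)
      then show ?thesis using w by blast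
    qed
  next
    fix u assume u: "u < ?m"
    note K = knows_below[OF u] knows_wrap[OF u] not_knows_gap[OF u] not_knows_above[OF u]
    let ?K = "map (knows ?m ?s u) ?P"
    show "?K \<in> fst ` set gap_table"
    \<comment> \<open>The points \<open>h + 2 + r\<close> and \<open>2 * h + 2\<close> appear in
      this order if \<open>r < h\<close> and in the opposite order if \<open>r = h + 1\<close>, so
      the patterns of flags differ.\<close>
    proof (cases "r \<le> h")
      case c: True
      \<comment> \<open>The flags change only when \<open>u\<close> reaches a point \<open>x\<close>
        of \<open>P\<close>, which becomes known, or \<open>x + s\<close> modulo \<open>m\<close>,
        where \<open>x\<close> is lost. These values are the breakpoints; in between the flags are
        constant. The later families use the same kind of case split.\<close>
      consider "u < r" | "r \<le> u" "u < h" | "h \<le> u" "u < h + 1" | "h + 1 \<le> u" "u < h + 2" | "h + 2 \<le> u" "u < h + r" | "h + r \<le> u" "u < h + r + 1" | "h + r + 1 \<le> u" "u < h + r + 2" | "h + r + 2 \<le> u" "u < 2 * h + 2" | "2 * h + 2 \<le> u" "u < 2 * h + 4" | "2 * h + 4 \<le> u" "u < 2 * h + 2 + r" | "2 * h + 2 + r \<le> u" "u < 2 * h + 3 + r" | "2 * h + 3 + r \<le> u" by (meson leI)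
      then show ?thesis
      proof cases
        case 1
        have "?K = [True, False, False, False, True, True, True, True, True]"
          by (insert 1 assms u c, simp only: list_eq_simps, intro conjI, (rule K; linarith)+)
        then show ?thesis by (simp add: gap_table_def)
      next
        case 2
        have "?K = [True, False, False, False, False, True, True, True, True]"
          by (insert 2 assms u c, simp only: list_eq_simps, intro conjI, (rule K; linarith)+)
        then show ?thesis by (simp add: gap_table_def)
      next
        case 3
        have "?K = [True, True, False, False, False, False, True, True, True]"
          by (insert 3 assms u c, simp only: list_eq_simps, intro conjI, (rule K; linarith)+)
        then show ?thesis by (simp add: gap_table_def)
      next
        case 4
        have "?K = [True, True, True, False, False, False, True, True, True]"
          by (insert 4 assms u c, simp only: list_eq_simps, intro conjI, (rule K; linarith)+)
        then show ?thesis by (simp add: gap_table_def)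
      next
        case 5
        have "?K = [True, True, True, True, False, False, False, True, True]"
          by (insert 5 assms u c, simp only: list_eq_simps, intro conjI, (rule K; linarith)+)
        then show ?thesis by (simp add: gap_table_def)
      next
        case 6
        have "?K = [True, True, True, True, False, False, False, False, True]"
          by (insert 6 assms u c, simp only: list_eq_simps, intro conjI, (rule K; linarith)+)
        then show ?thesis by (simp add: gap_table_def)
      next
        case 7
        have "?K = [True, True, True, True, False, False, False, False, False]"
          by (insert 7 assms u c, simp only: list_eq_simps, intro conjI, (rule K; linarith)+)
        then show ?thesis by (simp add: gap_table_def)
      next
        case 8
        have "?K = [False, True, True, True, True, False, False, False, False]"
          by (insert 8 assms u c, simp only: list_eq_simps, intro conjI, (rule K; linarith)+)
        then show ?thesis by (simp add: gap_table_def)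
      next
        case 9
        have "?K = [False, True, True, True, True, True, False, False, False]"
          by (insert 9 assms u c, simp only: list_eq_simps, intro conjI, (rule K; linarith)+)
        then show ?thesis by (simp add: gap_table_def)
      next
        case 10
        have "?K = [False, True, True, True, True, True, True, False, False]"
          by (insert 10 assms u c, simp only: list_eq_simps, intro conjI, (rule K; linarith)+)
        then show ?thesis by (simp add: gap_table_def)
      next
        case 11
        have "?K = [False, False, True, True, True, True, True, True, False]"
          by (insert 11 assms u c, simp only: list_eq_simps, intro conjI, (rule K; linarith)+)
        then show ?thesis by (simp add: gap_table_def)
      next
        case 12
        have "?K = [False, False, False, True, True, True, True, True, True]"
          by (insert 12 assms u c, simp only: list_eq_simps, intro conjI, (rule K; linarith)+)
        then show ?thesis by (simp add: gap_table_def)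
      qed
    next
      case c: False
      consider "u < h" | "h \<le> u" "u < h + 1" | "h + 1 \<le> u" "u < h + 2" | "h + 2 \<le> u" "u < 2 * h + 1" | "2 * h + 1 \<le> u" "u < 2 * h + 2" | "2 * h + 2 \<le> u" "u < 2 * h + 3" | "2 * h + 3 \<le> u" "u < 2 * h + 4" | "2 * h + 4 \<le> u" "u < 3 * h + 3" | "3 * h + 3 \<le> u" "u < 3 * h + 4" | "3 * h + 4 \<le> u" by (meson leI)
      then show ?thesis
      proof cases
        case 1
        have "?K = [True, False, False, False, True, True, True, True, True]"
          by (insert 1 assms u c, simp only: list_eq_simps, intro conjI, (rule K; linarith)+)
        then show ?thesis by (simp add: gap_table_def)
      next
        case 2
        have "?K = [True, True, False, False, True, False, True, True, True]"
          by (insert 2 assms u c, simp only: list_eq_simps, intro conjI, (rule K; linarith)+)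
        then show ?thesis by (simp add: gap_table_def)
      next
        case 3
        have "?K = [True, True, True, False, False, False, True, True, True]"
          by (insert 3 assms u c, simp only: list_eq_simps, intro conjI, (rule K; linarith)+)
        then show ?thesis by (simp add: gap_table_def)
      next
        case 4
        have "?K = [True, True, True, True, False, False, False, True, True]"
          by (insert 4 assms u c, simp only: list_eq_simps, intro conjI, (rule K; linarith)+)
        then show ?thesis by (simp add: gap_table_def)
      next
        case 5
        have "?K = [True, True, True, True, False, False, False, False, True]"
          by (insert 5 assms u c, simp only: list_eq_simps, intro conjI, (rule K; linarith)+)
        then show ?thesis by (simp add: gap_table_def)
      next
        case 6
        have "?K = [True, True, True, True, False, True, False, False, False]"
          by (insert 6 assms u c, simp only: list_eq_simps, intro conjI, (rule K; linarith)+)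
        then show ?thesis by (simp add: gap_table_def)
      next
        case 7
        have "?K = [False, True, True, True, True, True, False, False, False]"
          by (insert 7 assms u c, simp only: list_eq_simps, intro conjI, (rule K; linarith)+)
        then show ?thesis by (simp add: gap_table_def)
      next
        case 8
        have "?K = [False, True, True, True, True, True, True, False, False]"
          by (insert 8 assms u c, simp only: list_eq_simps, intro conjI, (rule K; linarith)+)
        then show ?thesis by (simp add: gap_table_def)
      next
        case 9
        have "?K = [False, False, True, True, True, True, True, True, False]"
          by (insert 9 assms u c, simp only: list_eq_simps, intro conjI, (rule K; linarith)+)
        then show ?thesis by (simp add: gap_table_def)
      next
        case 10
        have "?K = [False, False, False, True, True, True, True, True, True]"
          by (insert 10 assms u c, simp only: list_eq_simps, intro conjI, (rule K; linarith)+)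
        then show ?thesis by (simp add: gap_table_def)
      qed
    qed
  qed
  moreover have "length gap_code = 3" by (simp add: gap_code_def)
  ultimately show ?thesis by simp
qed

definition gap2_code :: "f4 list list" where
  "gap2_code = [[F1, F1, F0, F0, F0, F0, F0, F0],
   [F0, F0, F1, F1, F1, F0, F0, F0],
   [F0, F0, F0, F0, F0, F1, F1, F1]]"

definition gap2_table :: "(bool list \<times> nat \<times> nat \<times> f4 list) list" where
  "gap2_table = [([True, False, False, False, True, True, True, True], 1, 0, [F0, F0, F1, F1, F0, F0, F0, F0]),
   ([True, False, False, False, False, True, True, True], 1, 0, [F0, F0, F1, Fa, Fb, F0, F0, F0]),
   ([True, True, False, False, False, False, True, True], 5, 2, [F0, F0, F1, Fa, Fb, F0, F0, F0]),
   ([True, True, True, False, False, False, True, True], 5, 2, [F0, F0, F0, F1, F1, F0, F0, F0]),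
   ([True, True, True, True, False, False, False, True], 4, 1, [F0, F0, F0, F0, F0, F1, F1, F0]),
   ([True, True, True, True, False, False, False, False], 4, 1, [F0, F0, F0, F0, F0, F1, Fa, Fb]),
   ([False, True, True, True, True, False, False, False], 0, 0, [F0, F0, F0, F0, F0, F1, Fa, Fb]),
   ([False, True, True, True, True, True, False, False], 0, 0, [F0, F0, F0, F0, F0, F0, F1, F1]),
   ([False, False, True, True, True, True, True, False], 7, 2, [F1, F1, F0, F0, F0, F0, F0, F0]),
   ([False, False, False, True, True, True, True, True], 2, 1, [F1, F1, F0, F0, F0, F0, F0, F0])]"

text \<open>This is the code of \<open>good_gap\<close> at \<open>r = 2\<close>, with its two
  coinciding points merged into one.\<close>

lemma good_gap2:
  assumes "3 \<le> h"
  shows "good_code (2 * h + 6) (h + 4) 3 (table_code [0, h, h + 1, h + 2, h + 4, 2 * h + 2, 2 * h + 4, 2 * h + 5] gap2_code)"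
proof -
  let ?m = "2 * h + 6" and ?s = "h + 4" and ?P = "[0, h, h + 1, h + 2, h + 4, 2 * h + 2, 2 * h + 4, 2 * h + 5]"
  have "good_code ?m ?s (length gap2_code) (table_code ?P gap2_code)"
  proof (rule good_table_code[where T = gap2_table])
    show "distinct ?P" using assms by simp
    show "set ?P \<subseteq> {..<?m}" using assms by simp
    show "\<forall>row\<in>set gap2_code. length row = length ?P" by (simp add: gap2_code_def)
    have "list_all (row_ok gap2_code) gap2_table" unfolding gap2_code_def gap2_table_def by code_simp
    then show "\<forall>r\<in>set gap2_table. row_ok gap2_code r" by (simp add: list_all_iff)
    fix row assume "row \<in> set gap2_code"
    then consider "row = [F1, F1, F0, F0, F0, F0, F0, F0]" | "row = [F0, F0, F1, F1, F1, F0, F0, F0]" | "row = [F0, F0, F0, F0, F0, F1, F1, F1]"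
      unfolding gap2_code_def by auto
    then show "\<exists>u<?m. list_all2 (\<lambda>x c. c \<noteq> 0 \<longrightarrow> knows ?m ?s u x) ?P row"
    proof cases
      case 1
      have w: "h < ?m" using assms by linarith
      note K = knows_below[OF w] knows_wrap[OF w]
      have "list_all2 (\<lambda>x c. c \<noteq> 0 \<longrightarrow> knows ?m ?s (h) x) ?P row"
        by (insert assms, simp only: 1 list_all2_simps, intro conjI, (rule K; linarith)+)
      then show ?thesis using w by blast
    next
      case 2
      have w: "h + 4 < ?m" using assms by linarith
      note K = knows_below[OF w] knows_wrap[OF w]
      have "list_all2 (\<lambda>x c. c \<noteq> 0 \<longrightarrow> knows ?m ?s (h + 4) x) ?P row"
        by (insert assms, simp only: 2 list_all2_simps, intro conjI, (rule K; linarith)+)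
      then show ?thesis using w by blast
    next
      case 3
      have w: "2 * h + 5 < ?m" using assms by linarith
      note K = knows_below[OF w] knows_wrap[OF w]
      have "list_all2 (\<lambda>x c. c \<noteq> 0 \<longrightarrow> knows ?m ?s (2 * h + 5) x) ?P row"
        by (insert assms, simp only: 3 list_all2_simps, intro conjI, (rule K; linarith)+)
      then show ?thesis using w by blast
    qed
  next
    fix u assume u: "u < ?m"
    note K = knows_below[OF u] knows_wrap[OF u] not_knows_gap[OF u] not_knows_above[OF u]
    let ?K = "map (knows ?m ?s u) ?P"
    show "?K \<in> fst ` set gap2_table"
    proof -
      consider "u < 2" | "2 \<le> u" "u < h" | "h \<le> u" "u < h + 1" | "h + 1 \<le> u" "u < h + 2" | "h + 2 \<le> u" "u < h + 3" | "h + 3 \<le> u" "u < h + 4" | "h + 4 \<le> u" "u < 2 * h + 2" | "2 * h + 2 \<le> u" "u < 2 * h + 4" | "2 * h + 4 \<le> u" "u < 2 * h + 5" | "2 * h + 5 \<le> u" by (meson leI)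
      then show ?thesis
      proof cases
        case 1
        have "?K = [True, False, False, False, True, True, True, True]"
          by (insert 1 assms u, simp only: list_eq_simps, intro conjI, (rule K; linarith)+)
        then show ?thesis by (simp add: gap2_table_def)
      next
        case 2
        have "?K = [True, False, False, False, False, True, True, True]"
          by (insert 2 assms u, simp only: list_eq_simps, intro conjI, (rule K; linarith)+)
        then show ?thesis by (simp add: gap2_table_def)
      next
        case 3
        have "?K = [True, True, False, False, False, False, True, True]"
          by (insert 3 assms u, simp only: list_eq_simps, intro conjI, (rule K; linarith)+)
        then show ?thesis by (simp add: gap2_table_def)
      next
        case 4
        have "?K = [True, True, True, False, False, False, True, True]"
          by (insert 4 assms u, simp only: list_eq_simps, intro conjI, (rule K; linarith)+)
        then show ?thesis by (simp add: gap2_table_def)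
      next
        case 5
        have "?K = [True, True, True, True, False, False, False, True]"
          by (insert 5 assms u, simp only: list_eq_simps, intro conjI, (rule K; linarith)+)
        then show ?thesis by (simp add: gap2_table_def)
      next
        case 6
        have "?K = [True, True, True, True, False, False, False, False]"
          by (insert 6 assms u, simp only: list_eq_simps, intro conjI, (rule K; linarith)+)
        then show ?thesis by (simp add: gap2_table_def)
      next
        case 7
        have "?K = [False, True, True, True, True, False, False, False]"
          by (insert 7 assms u, simp only: list_eq_simps, intro conjI, (rule K; linarith)+)
        then show ?thesis by (simp add: gap2_table_def)
      next
        case 8
        have "?K = [False, True, True, True, True, True, False, False]"
          by (insert 8 assms u, simp only: list_eq_simps, intro conjI, (rule K; linarith)+)
        then show ?thesis by (simp add: gap2_table_def)
      next
        case 9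
        have "?K = [False, False, True, True, True, True, True, False]"
          by (insert 9 assms u, simp only: list_eq_simps, intro conjI, (rule K; linarith)+)
        then show ?thesis by (simp add: gap2_table_def)
      next
        case 10
        have "?K = [False, False, False, True, True, True, True, True]"
          by (insert 10 assms u, simp only: list_eq_simps, intro conjI, (rule K; linarith)+)
        then show ?thesis by (simp add: gap2_table_def)
      qed
    qed
  qed
  moreover have "length gap2_code = 3" by (simp add: gap2_code_def)
  ultimately show ?thesis by simp
qed

definition gap3_code :: "f4 list list" where
  "gap3_code = [[F1, F1, F0, F0, F0, F0, F0, F0, F0],
   [F0, F0, F1, F1, F0, F1, F0, F0, F0],
   [F0, F0, F0, F0, F1, F0, F1, F1, F1]]"

definition gap3_table :: "(bool list \<times> nat \<times> nat \<times> f4 list) list" where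
  "gap3_table = [([True, False, False, False, True, True, True, True, True], 1, 0, [F0, F0, F1, F1, F0, F0, F0, F0, F0]),
   ([True, True, False, False, False, True, True, True, True], 4, 2, [F0, F0, F1, F1, F0, F0, F0, F0, F0]),
   ([True, True, True, False, False, False, True, True, True], 4, 2, [F0, F0, F0, F1, F0, F1, F0, F0, F0]),
   ([True, True, True, True, False, False, False, True, True], 5, 1, [F0, F0, F0, F0, F1, F0, F1, F0, F0]),
   ([True, True, True, True, False, False, False, False, True], 5, 1, [F0, F0, F0, F0, F1, F0, Fa, Fb, F0]),
   ([True, True, True, True, False, False, False, False, False], 5, 1, [F0, F0, F0, F0, F1, F0, F1, F1, F1]),
   ([True, True, True, True, True, False, False, False, False], 5, 1, [F0, F0, F0, F0, F0, F0, F1, Fa, Fb]),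
   ([False, True, True, True, True, True, False, False, False], 0, 0, [F0, F0, F0, F0, F0, F0, F1, Fa, Fb]),
   ([False, True, True, True, True, True, True, False, False], 0, 0, [F0, F0, F0, F0, F0, F0, F0, F1, F1]),
   ([False, False, True, True, True, True, True, True, False], 8, 2, [F1, F1, F0, F0, F0, F0, F0, F0, F0]),
   ([False, False, False, True, True, True, True, True, True], 2, 1, [F1, F1, F0, F0, F0, F0, F0, F0, F0])]"

text \<open>With \<open>g = h + 3\<close> this is the case \<open>m = 2 * g + r\<close> with
  \<open>r = g - 2\<close>, which \<open>good_gap\<close> cannot reach.\<close>

lemma good_gap3:
  assumes "3 \<le> h"
  shows "good_code (3 * h + 7) (2 * h + 4) 3 (table_code [0, h, h + 1, h + 3, 2 * h + 3, 2 * h + 4, 2 * h + 6, 3 * h + 4, 3 * h + 5] gap3_code)"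
proof -
  let ?m = "3 * h + 7" and ?s = "2 * h + 4" and ?P = "[0, h, h + 1, h + 3, 2 * h + 3, 2 * h + 4, 2 * h + 6, 3 * h + 4, 3 * h + 5]"
  have "good_code ?m ?s (length gap3_code) (table_code ?P gap3_code)"
  proof (rule good_table_code[where T = gap3_table])
    show "distinct ?P" using assms by simp
    show "set ?P \<subseteq> {..<?m}" using assms by simp
    show "\<forall>row\<in>set gap3_code. length row = length ?P" by (simp add: gap3_code_def)
    have "list_all (row_ok gap3_code) gap3_table" unfolding gap3_code_def gap3_table_def by code_simp
    then show "\<forall>r\<in>set gap3_table. row_ok gap3_code r" by (simp add: list_all_iff)
    fix row assume "row \<in> set gap3_code"
    then consider "row = [F1, F1, F0, F0, F0, F0, F0, F0, F0]" | "row = [F0, F0, F1, F1, F0, F1, F0, F0, F0]" | "row = [F0, F0, F0, F0, F1, F0, F1, F1, F1]"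
      unfolding gap3_code_def by auto
    then show "\<exists>u<?m. list_all2 (\<lambda>x c. c \<noteq> 0 \<longrightarrow> knows ?m ?s u x) ?P row"
    proof cases
      case 1
      have w: "h < ?m" using assms by linarith
      note K = knows_below[OF w] knows_wrap[OF w]
      have "list_all2 (\<lambda>x c. c \<noteq> 0 \<longrightarrow> knows ?m ?s (h) x) ?P row"
        by (insert assms, simp only: 1 list_all2_simps, intro conjI, (rule K; linarith)+)
      then show ?thesis using w by blast
    next
      case 2
      have w: "2 * h + 4 < ?m" using assms by linarith
      note K = knows_below[OF w] knows_wrap[OF w]
      have "list_all2 (\<lambda>x c. c \<noteq> 0 \<longrightarrow> knows ?m ?s (2 * h + 4) x) ?P row"
        by (insert assms, simp only: 2 list_all2_simps, intro conjI, (rule K; linarith)+)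
      then show ?thesis using w by blast
    next
      case 3
      have w: "3 * h + 5 < ?m" using assms by linarith
      note K = knows_below[OF w] knows_wrap[OF w]
      have "list_all2 (\<lambda>x c. c \<noteq> 0 \<longrightarrow> knows ?m ?s (3 * h + 5) x) ?P row"
        by (insert assms, simp only: 3 list_all2_simps, intro conjI, (rule K; linarith)+)
      then show ?thesis using w by blast
    qed
  next
    fix u assume u: "u < ?m"
    note K = knows_below[OF u] knows_wrap[OF u] not_knows_gap[OF u] not_knows_above[OF u]
    let ?K = "map (knows ?m ?s u) ?P"
    show "?K \<in> fst ` set gap3_table"
    proof -
      consider "u < h" | "h \<le> u" "u < h + 1" | "h + 1 \<le> u" "u < h + 3" | "h + 3 \<le> u" "u < 2 * h + 1" | "2 * h + 1 \<le> u" "u < 2 * h + 2" | "2 * h + 2 \<le> u" "u < 2 * h + 3" | "2 * h + 3 \<le> u" "u < 2 * h + 4" | "2 * h + 4 \<le> u" "u < 2 * h + 6" | "2 * h + 6 \<le> u" "u < 3 * h + 4" | "3 * h + 4 \<le> u" "u < 3 * h + 5" | "3 * h + 5 \<le> u" by (meson leI)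
      then show ?thesis
      proof cases
        case 1
        have "?K = [True, False, False, False, True, True, True, True, True]"
          by (insert 1 assms u, simp only: list_eq_simps, intro conjI, (rule K; linarith)+)
        then show ?thesis by (simp add: gap3_table_def)
      next
        case 2
        have "?K = [True, True, False, False, False, True, True, True, True]"
          by (insert 2 assms u, simp only: list_eq_simps, intro conjI, (rule K; linarith)+)
        then show ?thesis by (simp add: gap3_table_def)
      next
        case 3
        have "?K = [True, True, True, False, False, False, True, True, True]"
          by (insert 3 assms u, simp only: list_eq_simps, intro conjI, (rule K; linarith)+)
        then show ?thesis by (simp add: gap3_table_def)
      next
        case 4
        have "?K = [True, True, True, True, False, False, False, True, True]"
          by (insert 4 assms u, simp only: list_eq_simps, intro conjI, (rule K; linarith)+)
        then show ?thesis by (simp add: gap3_table_def)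
      next
        case 5
        have "?K = [True, True, True, True, False, False, False, False, True]"
          by (insert 5 assms u, simp only: list_eq_simps, intro conjI, (rule K; linarith)+)
        then show ?thesis by (simp add: gap3_table_def)
      next
        case 6
        have "?K = [True, True, True, True, False, False, False, False, False]"
          by (insert 6 assms u, simp only: list_eq_simps, intro conjI, (rule K; linarith)+)
        then show ?thesis by (simp add: gap3_table_def)
      next
        case 7
        have "?K = [True, True, True, True, True, False, False, False, False]"
          by (insert 7 assms u, simp only: list_eq_simps, intro conjI, (rule K; linarith)+)
        then show ?thesis by (simp add: gap3_table_def)
      next
        case 8
        have "?K = [False, True, True, True, True, True, False, False, False]"
          by (insert 8 assms u, simp only: list_eq_simps, intro conjI, (rule K; linarith)+)
        then show ?thesis by (simp add: gap3_table_def)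
      next
        case 9
        have "?K = [False, True, True, True, True, True, True, False, False]"
          by (insert 9 assms u, simp only: list_eq_simps, intro conjI, (rule K; linarith)+)
        then show ?thesis by (simp add: gap3_table_def)
      next
        case 10
        have "?K = [False, False, True, True, True, True, True, True, False]"
          by (insert 10 assms u, simp only: list_eq_simps, intro conjI, (rule K; linarith)+)
        then show ?thesis by (simp add: gap3_table_def)
      next
        case 11
        have "?K = [False, False, False, True, True, True, True, True, True]"
          by (insert 11 assms u, simp only: list_eq_simps, intro conjI, (rule K; linarith)+)
        then show ?thesis by (simp add: gap3_table_def)
      qed
    qed
  qed
  moreover have "length gap3_code = 3" by (simp add: gap3_code_def)
  ultimately show ?thesis by simp
qed

definition below_code :: "f4 list list" where
  "below_code = [[F1, F1, F0, F0, F0, F0, F0, F0, F0, F1, F1],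
   [F1, F0, F1, F1, F1, F0, F0, F0, F0, F0, F0],
   [F0, F0, F0, F1, F0, F1, F1, F0, F0, F0, F0],
   [F0, F0, F0, F0, F0, F0, F0, F1, F1, F1, F0]]"

definition below_table :: "(bool list \<times> nat \<times> nat \<times> f4 list) list" where
  "below_table = [([True, False, False, False, False, False, True, True, True, True, True], 1, 0, [F0, F0, F1, Fa, Fb, Fa, F0, F0, F0, F0, F0]),
   ([True, False, False, False, False, False, False, True, True, True, True], 1, 0, [F0, F0, F1, Fa, Fb, F1, Fb, F0, F0, F0, F0]),
   ([True, True, False, False, False, False, False, False, True, True, True], 7, 3, [F0, F0, F1, Fa, Fb, F1, Fb, F0, F0, F0, F0]),
   ([True, True, True, False, False, False, False, False, True, True, True], 7, 3, [F0, F0, F0, F1, F1, Fa, Fb, F0, F0, F0, F0]),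
   ([True, True, True, True, False, False, False, False, False, True, True], 4, 1, [F0, F0, F0, F0, F0, F1, F1, F1, F1, F0, F0]),
   ([True, True, True, True, True, False, False, False, False, False, True], 9, 0, [F0, F0, F0, F0, F0, F1, F1, F1, F1, F0, F0]),
   ([True, True, True, True, True, True, False, False, False, False, False], 6, 2, [F0, F0, F0, F0, F0, F0, F0, F1, Fa, Fb, Fb]),
   ([False, True, True, True, True, True, True, False, False, False, False], 0, 1, [F0, F0, F0, F0, F0, F0, F0, F1, Fa, Fb, Fb]),
   ([False, True, True, True, True, True, True, True, False, False, False], 0, 1, [F0, F0, F0, F0, F0, F0, F0, F0, F1, F1, F1]),
   ([False, False, True, True, True, True, True, True, False, False, False], 0, 1, [F0, F1, F0, F0, F0, F0, F0, F0, Fa, Fa, Fb]),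
   ([False, False, False, True, True, True, True, True, True, False, False], 9, 3, [F1, Fa, F1, F0, F0, F0, F0, F0, F0, F0, Fb]),
   ([False, False, False, False, True, True, True, True, True, True, False], 3, 2, [F1, Fa, F1, F0, F0, F0, F0, F0, F0, F0, Fb]),
   ([False, False, False, False, False, True, True, True, True, True, True], 3, 2, [F1, F1, Fa, F0, Fb, F0, F0, F0, F0, F0, F0])]"

text \<open>With \<open>g = h + 4\<close> this is the case \<open>m = 2 * g + 1\<close>, that is
  \<open>m = 2 * s - 1\<close>. The bound on \<open>h\<close> keeps \<open>h + 5\<close> apart from
  \<open>2 * h + 4\<close>.\<close>

lemma good_below:
  assumes "2 \<le> h"
  shows "good_code (2 * h + 9) (h + 5) 4 (table_code [0, h, h + 1, h + 2, h + 3, h + 4, h + 5, 2 * h + 4, 2 * h + 6, 2 * h + 7, 2 * h + 8] below_code)"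
proof -
  let ?m = "2 * h + 9" and ?s = "h + 5" and ?P = "[0, h, h + 1, h + 2, h + 3, h + 4, h + 5, 2 * h + 4, 2 * h + 6, 2 * h + 7, 2 * h + 8]"
  have "good_code ?m ?s (length below_code) (table_code ?P below_code)"
  proof (rule good_table_code[where T = below_table])
    show "distinct ?P" using assms by simp
    show "set ?P \<subseteq> {..<?m}" using assms by simp
    show "\<forall>row\<in>set below_code. length row = length ?P" by (simp add: below_code_def)
    have "list_all (row_ok below_code) below_table" unfolding below_code_def below_table_def by code_simp
    then show "\<forall>r\<in>set below_table. row_ok below_code r" by (simp add: list_all_iff)
    fix row assume "row \<in> set below_code"
    then consider "row = [F1, F1, F0, F0, F0, F0, F0, F0, F0, F1, F1]" | "row = [F1, F0, F1, F1, F1, F0, F0, F0, F0, F0, F0]" | "row = [F0, F0, F0, F1, F0, F1, F1, F0, F0, F0, F0]" | "row = [F0, F0, F0, F0, F0, F0, F0, F1, F1, F1, F0]"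
      unfolding below_code_def by auto
    then show "\<exists>u<?m. list_all2 (\<lambda>x c. c \<noteq> 0 \<longrightarrow> knows ?m ?s u x) ?P row"
    proof cases
      case 1
      have w: "h < ?m" using assms by linarith
      note K = knows_below[OF w] knows_wrap[OF w]
      have "list_all2 (\<lambda>x c. c \<noteq> 0 \<longrightarrow> knows ?m ?s (h) x) ?P row"
        by (insert assms, simp only: 1 list_all2_simps, intro conjI, (rule K; linarith)+)
      then show ?thesis using w by blast
    next
      case 2
      have w: "h + 3 < ?m" using assms by linarith
      note K = knows_below[OF w] knows_wrap[OF w]
      have "list_all2 (\<lambda>x c. c \<noteq> 0 \<longrightarrow> knows ?m ?s (h + 3) x) ?P row"
        by (insert assms, simp only: 2 list_all2_simps, intro conjI, (rule K; linarith)+)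
      then show ?thesis using w by blast
    next
      case 3
      have w: "h + 5 < ?m" using assms by linarith
      note K = knows_below[OF w] knows_wrap[OF w]
      have "list_all2 (\<lambda>x c. c \<noteq> 0 \<longrightarrow> knows ?m ?s (h + 5) x) ?P row"
        by (insert assms, simp only: 3 list_all2_simps, intro conjI, (rule K; linarith)+)
      then show ?thesis using w by blast
    next
      case 4
      have w: "2 * h + 7 < ?m" using assms by linarith
      note K = knows_below[OF w] knows_wrap[OF w]
      have "list_all2 (\<lambda>x c. c \<noteq> 0 \<longrightarrow> knows ?m ?s (2 * h + 7) x) ?P row"
        by (insert assms, simp only: 4 list_all2_simps, intro conjI, (rule K; linarith)+)
      then show ?thesis using w by blast
    qed
  next
    fix u assume u: "u < ?m"
    note K = knows_below[OF u] knows_wrap[OF u] not_knows_gap[OF u] not_knows_above[OF u]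
    let ?K = "map (knows ?m ?s u) ?P"
    show "?K \<in> fst ` set below_table"
    proof -
      consider "u < 1" | "1 \<le> u" "u < h" | "h \<le> u" "u < h + 1" | "h + 1 \<le> u" "u < h + 2" | "h + 2 \<le> u" "u < h + 3" | "h + 3 \<le> u" "u < h + 4" | "h + 4 \<le> u" "u < h + 5" | "h + 5 \<le> u" "u < 2 * h + 4" | "2 * h + 4 \<le> u" "u < 2 * h + 5" | "2 * h + 5 \<le> u" "u < 2 * h + 6" | "2 * h + 6 \<le> u" "u < 2 * h + 7" | "2 * h + 7 \<le> u" "u < 2 * h + 8" | "2 * h + 8 \<le> u" by (meson leI)
      then show ?thesis
      proof cases
        case 1
        have "?K = [True, False, False, False, False, False, True, True, True, True, True]"
          by (insert 1 assms u, simp only: list_eq_simps, intro conjI, (rule K; linarith)+)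
        then show ?thesis by (simp add: below_table_def)
      next
        case 2
        have "?K = [True, False, False, False, False, False, False, True, True, True, True]"
          by (insert 2 assms u, simp only: list_eq_simps, intro conjI, (rule K; linarith)+)
        then show ?thesis by (simp add: below_table_def)
      next
        case 3
        have "?K = [True, True, False, False, False, False, False, False, True, True, True]"
          by (insert 3 assms u, simp only: list_eq_simps, intro conjI, (rule K; linarith)+)
        then show ?thesis by (simp add: below_table_def)
      next
        case 4
        have "?K = [True, True, True, False, False, False, False, False, True, True, True]"
          by (insert 4 assms u, simp only: list_eq_simps, intro conjI, (rule K; linarith)+)
        then show ?thesis by (simp add: below_table_def)
      next
        case 5
        have "?K = [True, True, True, True, False, False, False, False, False, True, True]"
          by (insert 5 assms u, simp only: list_eq_simps, intro conjI, (rule K; linarith)+)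
        then show ?thesis by (simp add: below_table_def)
      next
        case 6
        have "?K = [True, True, True, True, True, False, False, False, False, False, True]"
          by (insert 6 assms u, simp only: list_eq_simps, intro conjI, (rule K; linarith)+)
        then show ?thesis by (simp add: below_table_def)
      next
        case 7
        have "?K = [True, True, True, True, True, True, False, False, False, False, False]"
          by (insert 7 assms u, simp only: list_eq_simps, intro conjI, (rule K; linarith)+)
        then show ?thesis by (simp add: below_table_def)
      next
        case 8
        have "?K = [False, True, True, True, True, True, True, False, False, False, False]"
          by (insert 8 assms u, simp only: list_eq_simps, intro conjI, (rule K; linarith)+)
        then show ?thesis by (simp add: below_table_def)
      next
        case 9
        have "?K = [False, True, True, True, True, True, True, True, False, False, False]"
          by (insert 9 assms u, simp only: list_eq_simps, intro conjI, (rule K; linarith)+)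
        then show ?thesis by (simp add: below_table_def)
      next
        case 10
        have "?K = [False, False, True, True, True, True, True, True, False, False, False]"
          by (insert 10 assms u, simp only: list_eq_simps, intro conjI, (rule K; linarith)+)
        then show ?thesis by (simp add: below_table_def)
      next
        case 11
        have "?K = [False, False, False, True, True, True, True, True, True, False, False]"
          by (insert 11 assms u, simp only: list_eq_simps, intro conjI, (rule K; linarith)+)
        then show ?thesis by (simp add: below_table_def)
      next
        case 12
        have "?K = [False, False, False, False, True, True, True, True, True, True, False]"
          by (insert 12 assms u, simp only: list_eq_simps, intro conjI, (rule K; linarith)+)
        then show ?thesis by (simp add: below_table_def)
      next
        case 13
        have "?K = [False, False, False, False, False, True, True, True, True, True, True]"
          by (insert 13 assms u, simp only: list_eq_simps, intro conjI, (rule K; linarith)+)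
        then show ?thesis by (simp add: below_table_def)
      qed
    qed
  qed
  moreover have "length below_code = 4" by (simp add: below_code_def)
  ultimately show ?thesis by simp
qed

definition above_code :: "f4 list list" where
  "above_code = [[F1, F1, F0, F0, F0, F0, F0, F0, F0, F0, F1, F1],
   [F1, F0, F1, F1, F0, F0, F0, F0, F0, F0, F0, F0],
   [F0, F0, F0, F1, F1, F1, F0, F0, F0, F0, F0, F0],
   [F0, F0, F0, F0, F0, F1, F1, F0, F1, F1, F0, F0],
   [F0, F0, F0, F0, F0, F0, F0, F1, F0, F1, F1, F1]]"

definition above_table :: "(bool list \<times> nat \<times> nat \<times> f4 list) list" where
  "above_table = [([True, False, False, False, False, False, False, True, True, True, True, True], 1, 0, [F0, F0, F1, F1, Fa, Fb, Fb, F0, F0, F0, F0, F0]),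
   ([True, True, False, False, False, False, False, False, True, True, True, True], 7, 4, [F0, F0, F1, F1, Fa, Fb, Fb, F0, F0, F0, F0, F0]),
   ([True, True, False, False, False, False, False, False, False, True, True, True], 7, 4, [F0, F0, F1, F1, Fa, Fb, F1, F0, Fa, F0, F0, F0]),
   ([True, True, True, False, False, False, False, False, False, False, True, True], 3, 1, [F0, F0, F0, F0, F1, F1, F1, F1, F1, F1, F0, F0]),
   ([True, True, True, True, False, False, False, False, False, False, False, True], 10, 0, [F0, F0, F0, F0, F1, F1, F1, F1, F1, F1, F0, F0]),
   ([True, True, True, True, True, False, False, False, False, False, False, False], 5, 2, [F0, F0, F0, F0, F0, F0, F1, Fa, Fb, Fa, F1, F1]),
   ([False, True, True, True, True, True, False, False, False, False, False, False], 0, 1, [F0, F0, F0, F0, F0, F0, F1, Fa, Fb, Fa, F1, F1]),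
   ([False, False, True, True, True, True, True, False, False, False, False, False], 0, 1, [F0, F1, F0, F0, F0, F0, F0, Fa, Fb, Fb, Fa, Fb]),
   ([False, False, True, True, True, True, True, True, False, False, False, False], 0, 1, [F0, F1, F0, F0, F0, F0, F0, F0, F1, F1, Fa, Fb]),
   ([False, False, False, True, True, True, True, True, True, False, False, False], 9, 3, [F1, F1, F1, F0, F0, F0, F0, F0, F0, F0, F1, F1]),
   ([False, False, False, False, True, True, True, True, True, True, False, False], 3, 2, [F1, F1, F1, F0, F0, F0, F0, F0, F0, F0, F1, F1]),
   ([False, False, False, False, False, True, True, True, True, True, True, False], 11, 4, [F1, F1, Fa, Fb, Fb, F0, F0, F0, F0, F0, F0, F0]),
   ([False, False, False, False, False, False, True, True, True, True, True, True], 5, 3, [F1, F1, Fa, Fb, Fb, F0, F0, F0, F0, F0, F0, F0]),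
   ([False, True, True, True, True, True, True, False, False, False, False, False], 0, 1, [F0, F0, F0, F0, F0, F0, F0, F1, F1, F1, F1, F1])]"

text \<open>This is the case \<open>m = 2 * s + 1\<close>, where a remainder of one position meets a
  single block, so that the chains below have no block to lend.\<close>

lemma good_above:
  assumes "1 \<le> h"
  shows "good_code (2 * h + 11) (h + 5) 5 (table_code [0, h, h + 2, h + 3, h + 4, h + 5, h + 6, 2 * h + 6, 2 * h + 7, 2 * h + 8, 2 * h + 9, 2 * h + 10] above_code)"
proof -
  let ?m = "2 * h + 11" and ?s = "h + 5" and ?P = "[0, h, h + 2, h + 3, h + 4, h + 5, h + 6, 2 * h + 6, 2 * h + 7, 2 * h + 8, 2 * h + 9, 2 * h + 10]"
  have "good_code ?m ?s (length above_code) (table_code ?P above_code)"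
  proof (rule good_table_code[where T = above_table])
    show "distinct ?P" using assms by simp
    show "set ?P \<subseteq> {..<?m}" using assms by simp
    show "\<forall>row\<in>set above_code. length row = length ?P" by (simp add: above_code_def)
    have "list_all (row_ok above_code) above_table" unfolding above_code_def above_table_def by code_simp
    then show "\<forall>r\<in>set above_table. row_ok above_code r" by (simp add: list_all_iff)
    fix row assume "row \<in> set above_code"
    then consider "row = [F1, F1, F0, F0, F0, F0, F0, F0, F0, F0, F1, F1]" | "row = [F1, F0, F1, F1, F0, F0, F0, F0, F0, F0, F0, F0]" | "row = [F0, F0, F0, F1, F1, F1, F0, F0, F0, F0, F0, F0]" | "row = [F0, F0, F0, F0, F0, F1, F1, F0, F1, F1, F0, F0]" | "row = [F0, F0, F0, F0, F0, F0, F0, F1, F0, F1, F1, F1]"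
      unfolding above_code_def by auto
    then show "\<exists>u<?m. list_all2 (\<lambda>x c. c \<noteq> 0 \<longrightarrow> knows ?m ?s u x) ?P row"
    proof cases
      case 1
      have w: "h < ?m" using assms by linarith
      note K = knows_below[OF w] knows_wrap[OF w]
      have "list_all2 (\<lambda>x c. c \<noteq> 0 \<longrightarrow> knows ?m ?s (h) x) ?P row"
        by (insert assms, simp only: 1 list_all2_simps, intro conjI, (rule K; linarith)+)
      then show ?thesis using w by blast
    next
      case 2
      have w: "h + 3 < ?m" using assms by linarith
      note K = knows_below[OF w] knows_wrap[OF w]
      have "list_all2 (\<lambda>x c. c \<noteq> 0 \<longrightarrow> knows ?m ?s (h + 3) x) ?P row"
        by (insert assms, simp only: 2 list_all2_simps, intro conjI, (rule K; linarith)+)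
      then show ?thesis using w by blast
    next
      case 3
      have w: "h + 5 < ?m" using assms by linarith
      note K = knows_below[OF w] knows_wrap[OF w]
      have "list_all2 (\<lambda>x c. c \<noteq> 0 \<longrightarrow> knows ?m ?s (h + 5) x) ?P row"
        by (insert assms, simp only: 3 list_all2_simps, intro conjI, (rule K; linarith)+)
      then show ?thesis using w by blast
    next
      case 4
      have w: "2 * h + 8 < ?m" using assms by linarith
      note K = knows_below[OF w] knows_wrap[OF w]
      have "list_all2 (\<lambda>x c. c \<noteq> 0 \<longrightarrow> knows ?m ?s (2 * h + 8) x) ?P row"
        by (insert assms, simp only: 4 list_all2_simps, intro conjI, (rule K; linarith)+)
      then show ?thesis using w by blast
    next
      case 5
      have w: "2 * h + 10 < ?m" using assms by linarith
      note K = knows_below[OF w] knows_wrap[OF w]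
      have "list_all2 (\<lambda>x c. c \<noteq> 0 \<longrightarrow> knows ?m ?s (2 * h + 10) x) ?P row"
        by (insert assms, simp only: 5 list_all2_simps, intro conjI, (rule K; linarith)+)
      then show ?thesis using w by blast
    qed
  next
    fix u assume u: "u < ?m"
    note K = knows_below[OF u] knows_wrap[OF u] not_knows_gap[OF u] not_knows_above[OF u]
    let ?K = "map (knows ?m ?s u) ?P"
    show "?K \<in> fst ` set above_table"
    proof -
      consider "u < h" | "h \<le> u" "u < h + 1" | "h + 1 \<le> u" "u < h + 2" | "h + 2 \<le> u" "u < h + 3" | "h + 3 \<le> u" "u < h + 4" | "h + 4 \<le> u" "u < h + 5" | "h + 5 \<le> u" "u < h + 6" | "h + 6 \<le> u" "u < 2 * h + 5" | "2 * h + 5 \<le> u" "u < 2 * h + 6" | "2 * h + 6 \<le> u" "u < 2 * h + 7" | "2 * h + 7 \<le> u" "u < 2 * h + 8" | "2 * h + 8 \<le> u" "u < 2 * h + 9" | "2 * h + 9 \<le> u" "u < 2 * h + 10" | "2 * h + 10 \<le> u" by (meson leI)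
      then show ?thesis
      proof cases
        case 1
        have "?K = [True, False, False, False, False, False, False, True, True, True, True, True]"
          by (insert 1 assms u, simp only: list_eq_simps, intro conjI, (rule K; linarith)+)
        then show ?thesis by (simp add: above_table_def)
      next
        case 2
        have "?K = [True, True, False, False, False, False, False, False, True, True, True, True]"
          by (insert 2 assms u, simp only: list_eq_simps, intro conjI, (rule K; linarith)+)
        then show ?thesis by (simp add: above_table_def)
      next
        case 3
        have "?K = [True, True, False, False, False, False, False, False, False, True, True, True]"
          by (insert 3 assms u, simp only: list_eq_simps, intro conjI, (rule K; linarith)+)
        then show ?thesis by (simp add: above_table_def)
      next
        case 4
        have "?K = [True, True, True, False, False, False, False, False, False, False, True, True]"
          by (insert 4 assms u, simp only: list_eq_simps, intro conjI, (rule K; linarith)+)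
        then show ?thesis by (simp add: above_table_def)
      next
        case 5
        have "?K = [True, True, True, True, False, False, False, False, False, False, False, True]"
          by (insert 5 assms u, simp only: list_eq_simps, intro conjI, (rule K; linarith)+)
        then show ?thesis by (simp add: above_table_def)
      next
        case 6
        have "?K = [True, True, True, True, True, False, False, False, False, False, False, False]"
          by (insert 6 assms u, simp only: list_eq_simps, intro conjI, (rule K; linarith)+)
        then show ?thesis by (simp add: above_table_def)
      next
        case 7
        have "?K = [False, True, True, True, True, True, False, False, False, False, False, False]"
          by (insert 7 assms u, simp only: list_eq_simps, intro conjI, (rule K; linarith)+)
        then show ?thesis by (simp add: above_table_def)
      next
        case 8
        have "?K = [False, True, True, True, True, True, True, False, False, False, False, False]"
          by (insert 8 assms u, simp only: list_eq_simps, intro conjI, (rule K; linarith)+)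
        then show ?thesis by (simp add: above_table_def)
      next
        case 9
        have "?K = [False, False, True, True, True, True, True, False, False, False, False, False]"
          by (insert 9 assms u, simp only: list_eq_simps, intro conjI, (rule K; linarith)+)
        then show ?thesis by (simp add: above_table_def)
      next
        case 10
        have "?K = [False, False, True, True, True, True, True, True, False, False, False, False]"
          by (insert 10 assms u, simp only: list_eq_simps, intro conjI, (rule K; linarith)+)
        then show ?thesis by (simp add: above_table_def)
      next
        case 11
        have "?K = [False, False, False, True, True, True, True, True, True, False, False, False]"
          by (insert 11 assms u, simp only: list_eq_simps, intro conjI, (rule K; linarith)+)
        then show ?thesis by (simp add: above_table_def)
      next
        case 12
        have "?K = [False, False, False, False, True, True, True, True, True, True, False, False]"
          by (insert 12 assms u, simp only: list_eq_simps, intro conjI, (rule K; linarith)+)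
        then show ?thesis by (simp add: above_table_def)
      next
        case 13
        have "?K = [False, False, False, False, False, True, True, True, True, True, True, False]"
          by (insert 13 assms u, simp only: list_eq_simps, intro conjI, (rule K; linarith)+)
        then show ?thesis by (simp add: above_table_def)
      next
        case 14
        have "?K = [False, False, False, False, False, False, True, True, True, True, True, True]"
          by (insert 14 assms u, simp only: list_eq_simps, intro conjI, (rule K; linarith)+)
        then show ?thesis by (simp add: above_table_def)
      qed
    qed
  qed
  moreover have "length above_code = 5" by (simp add: above_code_def)
  ultimately show ?thesis by simp
qed

section \<open>Chains of blocks for \<open>m > 2 * s\<close>\<close>

text \<open>A point in two of the sets could be deleted from one of them, leaving a cover of
  \<open>m\<close> points of total size below \<open>m\<close>. This replaces a comparison of all
  pairs of sets.\<close>

lemma cover_disjoint: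
  fixes A :: "nat \<Rightarrow> nat set"
  assumes cov: "{..<m} \<subseteq> (\<Union>i<n. A i)" and size: "(\<Sum>i<n. card (A i)) \<le> m"
    and fin: "\<And>i. i < n \<Longrightarrow> finite (A i)"
    and ij: "i < n" "j < n" "u \<in> A i" "u \<in> A j"
  shows "i = j"
proof (rule ccontr)
  assume "i \<noteq> j"
  define B where "B = A(i := A i - {u})"
  have "{..<m} \<subseteq> (\<Union>k<n. B k)"
  proof
    fix x assume "x \<in> {..<m}"
    then obtain k where k: "k < n" "x \<in> A k" using cov by blast
    show "x \<in> (\<Union>k<n. B k)"
    proof (cases "k = i \<and> x = u")
      case True
      then have "x \<in> B j" using ij \<open>i \<noteq> j\<close> by (simp add: B_def)
      then show ?thesis using ij by blast
    next
      case False
      then have "x \<in> B k" using k by (auto simp: B_def)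
      then show ?thesis using k by blast
    qed
  qed
  then have "m \<le> card (\<Union>k<n. B k)"
    using fin card_mono[of "\<Union>k<n. B k" "{..<m}"] by (auto simp: B_def)
  also have "\<dots> \<le> (\<Sum>k<n. card (B k))" by (rule card_UN_le) simp
  also have "\<dots> < (\<Sum>k<n. card (A k))"
  proof (rule sum_strict_mono_ex1)
    show "\<forall>k\<in>{..<n}. card (B k) \<le> card (A k)"
      using fin by (auto simp: B_def intro!: card_mono)
    have "card (B i) < card (A i)"
      using card_Diff1_less[OF fin[OF ij(1)] ij(3)] by (simp only: B_def fun_upd_same)
    then show "\<exists>k\<in>{..<n}. card (B k) < card (A k)" using ij by blast
  qed simp
  finally show False using size by simp
qed

text \<open>A codeword whose two points occur nowhere else can be put in front of any solved list:
  it is skipped if both points lie outside \<open>U\<close> and peeled if both lie inside.\<close>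

lemma peelable_private:
  assumes "peelable U Ss" "distinct ns"
    and "\<And>n. n \<in> set ns \<Longrightarrow> X n \<noteq> Y n"
    and "\<And>n. n \<in> set ns \<Longrightarrow> {X n, Y n} \<inter> U = {} \<or> {X n, Y n} \<subseteq> U"
    and "\<And>n S. n \<in> set ns \<Longrightarrow> S \<in> set Ss \<Longrightarrow> {X n, Y n} \<inter> S = {}"
    and "\<And>n l. n \<in> set ns \<Longrightarrow> l \<in> set ns \<Longrightarrow> n \<noteq> l \<Longrightarrow> {X n, Y n} \<inter> {X l, Y l} = {}"
  shows "peelable U (map (\<lambda>n. {X n, Y n :: nat}) ns @ Ss)"
  using assms(2-)
proof (induction ns)
  case Nil
  then show ?case using assms(1) by simp
next
  case (Cons n ns)
  have IH: "peelable U (map (\<lambda>n. {X n, Y n}) ns @ Ss)"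
    using Cons.prems by (intro Cons.IH) auto
  show ?case
  proof (cases "{X n, Y n} \<inter> U = {}")
    case True
    then show ?thesis using IH by (simp add: peelable.skip)
  next
    case False
    then have sub: "{X n, Y n} \<subseteq> {X n, Y n} \<inter> U" using Cons.prems(3)[of n] by auto
    have "{X n, Y n} \<inter> \<Union> (set (map (\<lambda>n. {X n, Y n}) ns @ Ss)) = {}"
      using Cons.prems(1) Cons.prems(4)[of n] Cons.prems(5)[of n] by (fastforce simp: disjoint_iff)
    then show ?thesis
      using peelable.peel[OF IH _ sub] Cons.prems(2)[of n] by simp
  qed
qed

lemma sum_lessThan_add: "(\<Sum>i<k + l. f i) = (\<Sum>i<k. f i) + (\<Sum>i<l. f (k + i :: nat) :: nat)"
  by (induction l) simp_all

text \<open>The remainder of length \<open>\<sigma> e\<close> is cut into \<open>e\<close> cells at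
  the values of \<open>\<sigma>\<close>. Cells have length at least 2, and any two cyclically
  neighbouring cells together have length at most \<open>s\<close>: \<open>two\<close> says so
  inside the remainder, \<open>cyc\<close> for the last cell and the first. The last cell has length
  \<open>q + 1\<close>.\<close>

locale chain =
  fixes s t e q :: nat and \<sigma> :: "nat \<Rightarrow> nat"
  assumes t: "0 < t" and e: "0 < e" and zero: "\<sigma> 0 = 0"
    and gap: "k < e \<Longrightarrow> \<sigma> k + 2 \<le> \<sigma> (Suc k)"
    and two: "Suc k < e \<Longrightarrow> \<sigma> (Suc (Suc k)) \<le> \<sigma> k + s"
    and cyc: "\<sigma> e + \<sigma> 1 \<le> \<sigma> (e - 1) + s"
    and q: "\<sigma> e = \<sigma> (e - 1) + q + 1"
begin

definition m :: nat where "m = 2 * s * t + \<sigma> e"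

text \<open>The value of the formula for \<open>c\<close> at \<open>k = e\<close>. The full blocks
  are attached here.\<close>

definition base :: nat where "base = s + \<sigma> e - 2"

definition a :: "nat \<Rightarrow> nat" where "a k = \<sigma> (Suc k) - 2"
text \<open>The value at 0 is the general formula with \<open>\<sigma> (- 1)\<close> read cyclically
  as \<open>- (q + 1)\<close>, since the last cell has length \<open>q + 1\<close>.\<close>

definition b :: "nat \<Rightarrow> nat" where "b k = (if k = 0 then s - q - 2 else s + \<sigma> (k - 1) - 1)"
definition c :: "nat \<Rightarrow> nat" where "c k = s + \<sigma> k - 2"

text \<open>The four points provide two alternative pairs for peeling: \<open>a k\<close> and its
  successor at the low end, \<open>b k\<close> and \<open>c k\<close> at the high end. The successor
  of \<open>a k\<close> may coincide with \<open>b k\<close>, and points may be shared between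
  different \<open>k\<close>.\<close>

definition S :: "nat \<Rightarrow> nat set" where "S k = {a k, Suc (a k), b k, c k}"

text \<open>Codewords \<open>3 * T\<close>, \<open>3 * T + 1\<close> and \<open>3 * T + 2\<close>
  form block \<open>T\<close>. Their distances from \<open>X\<close> to \<open>Y\<close> are
  \<open>q\<close>, \<open>s - q - 1\<close> and 1, with sum \<open>s\<close>, so a block serves
  \<open>2 * s\<close> users.\<close>

definition X :: "nat \<Rightarrow> nat" where
  "X n = base + 2 * s * (n div 3) + (if n mod 3 = 1 then 1 else if n mod 3 = 2 then s else 0)
     - (if n mod 3 = 0 then q else 0)"

definition Y :: "nat \<Rightarrow> nat" where
  "Y n = base + 2 * s * (n div 3) + (if n mod 3 = 1 then s - q else if n mod 3 = 2 then s + 1 else 0)"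

lemma sigma_mono: "j \<le> k \<Longrightarrow> k \<le> e \<Longrightarrow> \<sigma> j \<le> \<sigma> k"
proof (induction k)
  case (Suc k)
  then show ?case using gap[of k] by (cases "j = Suc k") auto
qed simp

lemma sigma_less: "j < k \<Longrightarrow> k \<le> e \<Longrightarrow> \<sigma> j + 2 \<le> \<sigma> k"
  using gap[of j] sigma_mono[of "Suc j" k] by simp

lemma q_bounds: "0 < q" "q + 3 \<le> s" "q + 1 + \<sigma> 1 \<le> s"
proof -
  have "\<sigma> (e - 1) + 2 \<le> \<sigma> e" using gap[of "e - 1"] e by simp
  moreover have "2 \<le> \<sigma> 1" using gap[of 0] e zero by simp
  ultimately show "0 < q" "q + 3 \<le> s" "q + 1 + \<sigma> 1 \<le> s" using cyc q by auto
qed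

lemma ab: "k < e \<Longrightarrow> Suc (a k) \<le> b k"
proof (cases k)
  case 0
  then show ?thesis using q_bounds gap[of 0] e zero by (simp add: a_def b_def)
next
  case (Suc l)
  assume "k < e"
  then show ?thesis using two[of l] gap[of k] Suc by (simp add: a_def b_def)
qed

lemma bc: "k < e \<Longrightarrow> b k < c k"
proof (cases k)
  case 0
  then show ?thesis using q_bounds zero by (simp add: b_def c_def)
next
  case (Suc l)
  assume "k < e"
  then show ?thesis using gap[of l] q_bounds Suc by (simp add: b_def c_def)
qed

lemma ca: "k < e \<Longrightarrow> c k < a k + s"
  using gap[of k] q_bounds by (simp add: a_def c_def)

lemma cb: "j < k \<Longrightarrow> k < e \<Longrightarrow> c j < b k"
proof -
  assume "j < k" "k < e"
  then have "\<sigma> j \<le> \<sigma> (k - 1)" "0 < k" by (auto intro: sigma_mono)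
  then show ?thesis using q_bounds by (simp add: b_def c_def)
qed

lemma aa: "j < k \<Longrightarrow> k < e \<Longrightarrow> Suc (a j) < a k"
  using sigma_less[of "Suc j" "Suc k"] gap[of j] by (simp add: a_def)

lemma c_less: "k < e \<Longrightarrow> c k < base - q"
proof -
  assume "k < e"
  then have "\<sigma> k \<le> \<sigma> (e - 1)" by (auto intro: sigma_mono)
  then show ?thesis using q q_bounds by (simp add: base_def c_def)
qed

lemma base_q: "base - q + q = base" "base - q < base"
  using q q_bounds by (auto simp: base_def)

lemma base_m: "base + 2 * s * t + 2 = m + s"
  using q q_bounds by (simp add: base_def m_def)

lemma base_m': "base + s + 2 \<le> m"
proof -
  obtain t' where "t = Suc t'" using t by (cases t) auto
  then have "2 * s * t = 2 * s + 2 * s * t'" by simp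
  then show ?thesis using base_m by linarith
qed

lemma S_elem: "k < e \<Longrightarrow> x \<in> S k \<Longrightarrow> a k \<le> x \<and> x \<le> c k"
  using ab[of k] bc[of k] by (auto simp: S_def)

lemma S_knows:
  assumes "k < e" "x \<in> S k" "u < m"
  shows "x < m" "knows m s u x \<longleftrightarrow> x \<le> u \<and> u < x + s"
proof -
  have "x < base" using S_elem[OF assms(1,2)] c_less[OF assms(1)] base_q by linarith
  then have "x + s < m" using base_m' by linarith
  moreover have "s < m" using base_m' by linarith
  ultimately show "x < m" "knows m s u x \<longleftrightarrow> x \<le> u \<and> u < x + s"
    using knows_iff[of u m x s] assms(3) by auto
qed

lemma XY: "X n < Y n" "Y n < X n + s"
proof -
  have "n mod 3 = 0 \<or> n mod 3 = 1 \<or> n mod 3 = 2" by linarith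
  then show "X n < Y n" "Y n < X n + s"
    using q_bounds base_q by (auto simp: X_def Y_def)
qed

lemma YX: "Y n < X (Suc n)"
proof -
  have n: "n = 3 * (n div 3) + n mod 3" by simp
  consider "n mod 3 = 0" | "n mod 3 = 1" | "n mod 3 = 2" by linarith
  then show ?thesis
  proof cases
    case 1
    then have "Suc n div 3 = n div 3" "Suc n mod 3 = 1" using n by (simp_all add: div_Suc mod_Suc)
    then show ?thesis using 1 by (simp add: X_def Y_def)
  next
    case 2
    then have "Suc n div 3 = n div 3" "Suc n mod 3 = 2" using n by (simp_all add: div_Suc mod_Suc)
    then show ?thesis using 2 q_bounds by (simp add: X_def Y_def)
  next
    case 3
    then have "Suc n div 3 = Suc (n div 3)" "Suc n mod 3 = 0" using n by (simp_all add: div_Suc mod_Suc)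
    then show ?thesis using 3 q_bounds by (simp add: X_def Y_def)
  qed
qed

lemma X_mono: "j < k \<Longrightarrow> Y j < X k"
proof (induction k)
  case (Suc k)
  then show ?case using YX[of j] YX[of k] XY(1)[of k] by (cases "j = k") auto
qed simp

lemma X_ge: "base - q \<le> X n"
  using X_mono[of 0 n] XY(1)[of 0] by (cases n) (auto simp: X_def)

lemma Y_less: "n < 3 * t \<Longrightarrow> Y n < m"
proof -
  assume "n < 3 * t"
  then have "n < 3 * t - 1 \<or> n = 3 * t - 1" by linarith
  then have "Y n \<le> Y (3 * t - 1)"
    using X_mono[of n "3 * t - 1"] XY(1)[of "3 * t - 1"] by auto
  moreover obtain t' where t': "t = Suc t'" using t by (cases t) auto
  have "3 * t - 1 = 3 * t' + 2" using t' by simp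
  then have "(3 * t - 1) div 3 = t'" "(3 * t - 1) mod 3 = 2" by presburger+
  then have "Y (3 * t - 1) = base + 2 * s * t' + s + 1" by (simp add: Y_def)
  moreover have "2 * s * t = 2 * s + 2 * s * t'" using t' by simp
  ultimately show ?thesis using base_m by linarith
qed

text \<open>The users who decode from codeword \<open>i\<close>. For \<open>S k\<close>, the users
  from \<open>b k\<close> up to just before \<open>c k\<close> miss only \<open>c k\<close>, and
  user \<open>a k + s\<close> has just lost \<open>a k\<close>. For a pair, they are the users who
  know exactly one of its ends; the second interval may wrap around the circle.\<close>

definition arc :: "nat \<Rightarrow> nat set" where
  "arc i = (if i < e then {b i..<c i} \<union> {a i + s}
     else {X (i - e)..<Y (i - e)} \<union> (\<lambda>x. (x + s) mod m) ` {X (i - e)..<Y (i - e)})"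

definition word :: "nat \<Rightarrow> nat set" where
  "word i = (if i < e then S i else {X (i - e), Y (i - e)})"

lemma special_view:
  assumes k: "k < e" and u: "u < m"
  shows "b k \<le> u \<Longrightarrow> u < c k \<Longrightarrow> S k \<inter> unknown m s u = {c k}"
    and "u = a k + s \<Longrightarrow> S k \<inter> unknown m s u = {a k}"
  using S_knows[OF k _ u] ab[OF k] bc[OF k] ca[OF k] by (auto simp: S_def unknown_def)

lemma X_knows:
  assumes "n < 3 * t" "x \<in> {X n, Y n}" "u < m"
  shows "x < m" "knows m s u x \<longleftrightarrow> x \<le> u \<and> u < x + s \<or> u + m < x + s"
proof -
  have "s < m" using base_m' by linarith
  moreover show "x < m" using assms Y_less[of n] XY(1)[of n] by auto
  ultimately show "knows m s u x \<longleftrightarrow> x \<le> u \<and> u < x + s \<or> u + m < x + s"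
    using knows_iff assms by simp
qed

lemma mod_arc:
  assumes "n < 3 * t" "u < m"
  shows "u \<in> (\<lambda>x. (x + s) mod m) ` {X n..<Y n} \<longleftrightarrow> X n + s \<le> u \<and> u < Y n + s \<or> X n + s \<le> u + m \<and> u + m < Y n + s"
proof
  assume "u \<in> (\<lambda>x. (x + s) mod m) ` {X n..<Y n}"
  then obtain x where x: "X n \<le> x" "x < Y n" "u = (x + s) mod m" by auto
  show "X n + s \<le> u \<and> u < Y n + s \<or> X n + s \<le> u + m \<and> u + m < Y n + s"
  proof (cases "x + s < m")
    case True
    then show ?thesis using x by simp
  next
    case False
    have "x + s - m < m" using x Y_less[OF assms(1)] base_m' by linarith
    then have "u = x + s - m" using False x(3) by (simp add: le_mod_geq)
    then show ?thesis using x False by auto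
  qed
next
  assume "X n + s \<le> u \<and> u < Y n + s \<or> X n + s \<le> u + m \<and> u + m < Y n + s"
  then show "u \<in> (\<lambda>x. (x + s) mod m) ` {X n..<Y n}"
  proof
    assume "X n + s \<le> u \<and> u < Y n + s"
    then show ?thesis using assms(2) by (intro image_eqI[of _ _ "u - s"]) auto
  next
    assume "X n + s \<le> u + m \<and> u + m < Y n + s"
    then show ?thesis using assms(2) by (intro image_eqI[of _ _ "u + m - s"]) auto
  qed
qed

lemma pair_view:
  assumes n: "n < 3 * t" and u: "u < m"
  shows "X n \<le> u \<Longrightarrow> u < Y n \<Longrightarrow> {X n, Y n} \<inter> unknown m s u = {Y n}"
    and "u \<in> (\<lambda>x. (x + s) mod m) ` {X n..<Y n} \<Longrightarrow> {X n, Y n} \<inter> unknown m s u = {X n}"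
    and "u \<notin> arc (e + n) \<Longrightarrow> {X n, Y n} \<inter> unknown m s u = {} \<or> {X n, Y n} \<subseteq> unknown m s u"
proof -
  note k = X_knows[OF n _ u]
  have X: "X n < m" "X n \<in> unknown m s u \<longleftrightarrow> \<not> (X n \<le> u \<and> u < X n + s \<or> u + m < X n + s)"
    and Y: "Y n < m" "Y n \<in> unknown m s u \<longleftrightarrow> \<not> (Y n \<le> u \<and> u < Y n + s \<or> u + m < Y n + s)"
    using k[of "X n"] k[of "Y n"] by (auto simp: unknown_def)
  have s: "2 * s \<le> m" using t by (simp add: m_def) (metis le_add1 mult.right_neutral mult_le_mono2 Suc_leI trans_le_add1 One_nat_def)
  note arith = X Y XY[of n] s u
  show "{X n, Y n} \<inter> unknown m s u = {Y n}" if "X n \<le> u" "u < Y n"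
  proof -
    have "X n \<notin> unknown m s u" "Y n \<in> unknown m s u"
      unfolding X(2) Y(2) using that arith(1,3,5-) by linarith+
    then show ?thesis by auto
  qed
  show "{X n, Y n} \<inter> unknown m s u = {X n}" if "u \<in> (\<lambda>x. (x + s) mod m) ` {X n..<Y n}"
  proof -
    have "X n \<in> unknown m s u" "Y n \<notin> unknown m s u"
      unfolding X(2) Y(2) using that[unfolded mod_arc[OF n u]] arith(1,3,5-) by linarith+
    then show ?thesis by auto
  qed
  show "{X n, Y n} \<inter> unknown m s u = {} \<or> {X n, Y n} \<subseteq> unknown m s u" if "u \<notin> arc (e + n)"
  proof -
    have "\<not> (X n \<le> u \<and> u < Y n)" "\<not> (X n + s \<le> u \<and> u < Y n + s \<or> X n + s \<le> u + m \<and> u + m < Y n + s)"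
      using that mod_arc[OF n u] by (auto simp: arc_def)
    then have "X n \<in> unknown m s u \<longleftrightarrow> Y n \<in> unknown m s u"
      unfolding X(2) Y(2) using arith(1,3,5-) by linarith
    then show ?thesis by auto
  qed
qed

lemma finite_arc: "finite (arc i)" by (simp add: arc_def)

lemma pair_size: "(\<Sum>n<3 * l. 2 * (Y n - X n)) = 2 * s * l"
proof (induction l)
  case (Suc l)
  have l: "(3 * l) div 3 = l" "(3 * l) mod 3 = 0" "(3 * l + 1) div 3 = l" "(3 * l + 1) mod 3 = 1"
    "(3 * l + 2) div 3 = l" "(3 * l + 2) mod 3 = 2" by presburger+
  have d: "Y (3 * l) - X (3 * l) = q" "Y (3 * l + 1) - X (3 * l + 1) = s - q - 1" "Y (3 * l + 2) - X (3 * l + 2) = 1"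
    using base_q by (simp_all only: X_def Y_def l) auto
  have "3 * Suc l = Suc (Suc (Suc (3 * l)))" by simp
  then have "(\<Sum>n<3 * Suc l. 2 * (Y n - X n)) = 2 * s * l + 2 * q + 2 * (s - q - 1) + 2"
    using Suc.IH d by (simp only: sum.lessThan_Suc) simp
  also have "\<dots> = 2 * s * Suc l" using q_bounds by simp
  finally show ?case .
qed simp

text \<open>The first codeword serves \<open>q + 1\<close> users and each later one as many as its
  preceding cell is long, so the sum telescopes. At \<open>l = e - 1\<close> it equals
  \<open>\<sigma> e\<close>, by the choice of \<open>q\<close>.\<close>

lemma special_size: "l < e \<Longrightarrow> (\<Sum>k<Suc l. c k - b k + 1) = q + 1 + \<sigma> l"
proof (induction l)
  case 0
  then show ?case using q_bounds zero by (simp add: b_def c_def)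
next
  case (Suc l)
  have "c (Suc l) - b (Suc l) + 1 = \<sigma> (Suc l) - \<sigma> l"
    using gap[of l] Suc.prems q_bounds by (simp add: b_def c_def)
  then show ?case using Suc gap[of l] by simp
qed

text \<open>The special codewords account for \<open>\<sigma> e\<close> users and the
  \<open>t\<close> blocks for \<open>2 * s * t\<close>, which together is \<open>m\<close>.\<close>

lemma arc_size: "(\<Sum>i<e + 3 * t. card (arc i)) \<le> m"
proof -
  have "(\<Sum>i<e. card (arc i)) \<le> (\<Sum>k<e. c k - b k + 1)"
  proof (rule sum_mono)
    fix k assume "k \<in> {..<e}"
    then show "card (arc k) \<le> c k - b k + 1"
      using card_Un_le[of "{b k..<c k}" "{a k + s}"] by (simp add: arc_def)
  qed
  also have "\<dots> = \<sigma> e"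
    using special_size[of "e - 1"] e q by simp
  finally have 1: "(\<Sum>i<e. card (arc i)) \<le> \<sigma> e" .
  have "(\<Sum>n<3 * t. card (arc (e + n))) \<le> (\<Sum>n<3 * t. 2 * (Y n - X n))"
  proof (rule sum_mono)
    fix n
    show "card (arc (e + n)) \<le> 2 * (Y n - X n)"
      using card_Un_le[of "{X n..<Y n}" "(\<lambda>x. (x + s) mod m) ` {X n..<Y n}"]
        card_image_le[of "{X n..<Y n}" "\<lambda>x. (x + s) mod m"] by (simp add: arc_def)
  qed
  then show ?thesis using 1 pair_size[of t] by (simp add: sum_lessThan_add m_def)
qed

lemma sigma_cell: "x < \<sigma> k \<Longrightarrow> k \<le> e \<Longrightarrow> \<exists>j<k. \<sigma> j \<le> x \<and> x < \<sigma> (Suc j)"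
proof (induction k)
  case (Suc k)
  then show ?case by (cases "x < \<sigma> k") (auto intro: less_SucI)
qed (simp add: zero)

lemma cover_special:
  assumes "s - q - 2 \<le> u" "u \<le> base" "u \<noteq> s - 2"
  shows "\<exists>i<e + 3 * t. u \<in> arc i"
proof -
  \<comment> \<open>Beyond \<open>s - 2\<close>, users are measured by \<open>x\<close> with
    \<open>u = s - 2 + x\<close>. A cut point \<open>x = \<sigma> j\<close> is the single user
    \<open>a (j - 1) + s\<close>; the interior of cell \<open>j\<close> is the interval from
    \<open>b (j + 1)\<close> to \<open>c (j + 1)\<close>, except for the last cell, whose interior
    is served by the first pair.\<close>
  consider "u < s - 2" | "u = base" | x where "u = s + x - 2" "0 < x" "x < \<sigma> e"
  proof -
    assume 1: "u < s - 2 \<Longrightarrow> thesis" and 2: "u = base \<Longrightarrow> thesis"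
      and 3: "\<And>x. u = s + x - 2 \<Longrightarrow> 0 < x \<Longrightarrow> x < \<sigma> e \<Longrightarrow> thesis"
    show thesis
    proof (cases "u < s - 2 \<or> u = base")
      case False
      then have "u = s + (u + 2 - s) - 2" "0 < u + 2 - s" "u + 2 - s < \<sigma> e"
        using assms(2,3) q_bounds by (auto simp: base_def)
      then show thesis by (rule 3)
    qed (use 1 2 in auto)
  qed
  then show ?thesis
  proof cases
    case 1
    then show ?thesis using assms(1) e zero by (intro exI[of _ 0]) (auto simp: arc_def b_def c_def)
  next
    case 2
    have "u = a (e - 1) + s"
      using 2 e q q_bounds gap[of "e - 1"] by (simp add: base_def a_def)
    then show ?thesis using e by (intro exI[of _ "e - 1"]) (auto simp: arc_def)
  next
    case 3
    obtain j where j: "j < e" "\<sigma> j \<le> x" "x < \<sigma> (Suc j)" using sigma_cell[OF 3(3)] by auto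
    show ?thesis
    proof (cases "x = \<sigma> j")
      case True
      then have "0 < j" using 3(2) zero by (cases j) auto
      then have "2 \<le> \<sigma> j" using sigma_less[of 0 j] j(1) by simp
      then have "u = a (j - 1) + s" using True 3(1) \<open>0 < j\<close> by (simp add: a_def)
      then show ?thesis using j(1) by (intro exI[of _ "j - 1"]) (auto simp: arc_def)
    next
      case False
      show ?thesis
      proof (cases "Suc j < e")
        case True
        then have "u \<in> arc (Suc j)"
          using False j(2,3) 3(1) q_bounds by (auto simp: arc_def b_def c_def)
        then show ?thesis using True by (intro exI[of _ "Suc j"]) auto
      next
        case last: False
        then have je: "j = e - 1" "Suc j = e" using j(1) by auto
        have "\<sigma> (e - 1) < x" "x < \<sigma> e" using False j(2,3) je by auto
        then have "u \<in> {X 0..<Y 0}"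
          using 3(1) q q_bounds by (auto simp: X_def Y_def base_def)
        then show ?thesis using t by (intro exI[of _ e]) (auto simp: arc_def)
      qed
    qed
  qed
qed

lemma arc_pairI:
  assumes "n < 3 * t" "u < m"
    and "X n \<le> u \<and> u < Y n \<or> X n + s \<le> u \<and> u < Y n + s \<or> X n + s \<le> u + m \<and> u + m < Y n + s"
  shows "\<exists>i<e + 3 * t. u \<in> arc i"
  using assms mod_arc[OF assms(1,2)] by (intro exI[of _ "e + n"]) (auto simp: arc_def)

lemma XY_values:
  "X (3 * T) = base + 2 * s * T - q" "Y (3 * T) = base + 2 * s * T"
  "X (3 * T + 1) = base + 2 * s * T + 1" "Y (3 * T + 1) = base + 2 * s * T + (s - q)"
  "X (3 * T + 2) = base + 2 * s * T + s" "Y (3 * T + 2) = base + 2 * s * T + (s + 1)"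
proof -
  have "(3 * T) div 3 = T" "(3 * T) mod 3 = 0" "(3 * T + 1) div 3 = T" "(3 * T + 1) mod 3 = 1"
    "(3 * T + 2) div 3 = T" "(3 * T + 2) mod 3 = 2" by presburger+
  then show "X (3 * T) = base + 2 * s * T - q" "Y (3 * T) = base + 2 * s * T"
    "X (3 * T + 1) = base + 2 * s * T + 1" "Y (3 * T + 1) = base + 2 * s * T + (s - q)"
    "X (3 * T + 2) = base + 2 * s * T + s" "Y (3 * T + 2) = base + 2 * s * T + (s + 1)"
    by (simp_all only: X_def Y_def) auto
qed

lemma cover:
  assumes u: "u < m"
  shows "\<exists>i<e + 3 * t. u \<in> arc i"
proof -
  obtain t' where t': "t = Suc t'" using t by (cases t) auto
  have st: "2 * s * t = 2 * s + 2 * s * t'" using t' by simp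
  have last: "3 * t' + 1 < 3 * t" "3 * t' + 2 < 3 * t" using t' by auto
  \<comment> \<open>Users below \<open>s - q - 2\<close> and the user \<open>s - 2\<close> are
    served by the last block, across the end of the circle: modulo \<open>m\<close>, the second pair
    of that block continues to \<open>s - q - 3\<close>, and the third pair reaches exactly
    \<open>s - 2\<close>.\<close>
  consider "u < s - q - 2" | "u = s - 2" | "s - q - 2 \<le> u" "u \<le> base" "u \<noteq> s - 2" | "base < u"
    by linarith
  then show ?thesis
  proof cases
    case 1
    then show ?thesis
      using base_m st q_bounds u by (intro arc_pairI[OF last(1) u]) (unfold XY_values, linarith)
  next
    case 2
    then show ?thesis
      using base_m st q_bounds u by (intro arc_pairI[OF last(2) u]) (unfold XY_values, linarith)
  next
    case 3
    then show ?thesis by (rule cover_special)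
  next
    case 4
    \<comment> \<open>\<open>T\<close> is the block and \<open>\<rho>\<close> the offset in it,
      counted from the user after \<open>base + 2 * s * T\<close>. The six ranges below are served
      by pairs 1, 0, 2, 1, the first pair of the next block, and pair 2.\<close>
    define T where "T = (u - base - 1) div (2 * s)"
    define \<rho> where "\<rho> = (u - base - 1) mod (2 * s)"
    have u': "u = base + 1 + 2 * s * T + \<rho>" and \<rho>: "\<rho> < 2 * s"
      using 4 q_bounds mult_div_mod_eq[of "2 * s" "u - base - 1"] by (auto simp: T_def \<rho>_def)
    have Tt: "T < t"
    proof (rule ccontr)
      assume "\<not> T < t"
      then have "2 * s * t \<le> 2 * s * T" by simp
      then show False using u u' base_m q_bounds by linarith
    qed
    have n: "3 * T < 3 * t" "3 * T + 1 < 3 * t" "3 * T + 2 < 3 * t" using Tt by auto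
    consider "\<rho> + 1 < s - q" | "s - q \<le> \<rho> + 1" "\<rho> + 1 < s" | "\<rho> + 1 = s" | "s < \<rho> + 1" "\<rho> + 1 < 2 * s - q"
      | "2 * s - q \<le> \<rho> + 1" "\<rho> + 1 < 2 * s" | "\<rho> + 1 = 2 * s"
      using \<rho> by linarith
    then show ?thesis
    proof cases
      case 1
      then show ?thesis using u' q_bounds by (intro arc_pairI[OF n(2) u]) (unfold XY_values, linarith)
    next
      case 2
      then show ?thesis using u' q_bounds base_q by (intro arc_pairI[OF n(1) u]) (unfold XY_values, linarith)
    next
      case 3
      then show ?thesis using u' q_bounds by (intro arc_pairI[OF n(3) u]) (unfold XY_values, linarith)
    next
      case 4
      then show ?thesis using u' q_bounds by (intro arc_pairI[OF n(2) u]) (unfold XY_values, linarith)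
    next
      case 5
      \<comment> \<open>In the last block, users of this range would have numbers above
        \<open>m\<close>; after wrapping they are those served by the special codeword 0.\<close>
      have "Suc T < t"
      proof (rule ccontr)
        assume "\<not> Suc T < t"
        then have "2 * s * t \<le> 2 * s * Suc T" by (intro mult_le_mono2) simp
        then show False using u u' base_m q_bounds 5 by simp
      qed
      then have n': "3 * Suc T < 3 * t" by simp
      have "2 * s * Suc T = 2 * s * T + 2 * s" by simp
      then show ?thesis using 5 u' q_bounds by (intro arc_pairI[OF n' u]) (unfold XY_values, linarith)
    next
      case 6
      then show ?thesis using u' q_bounds by (intro arc_pairI[OF n(3) u]) (unfold XY_values, linarith)
    qed
  qed
qed

text \<open>The arcs cover all \<open>m\<close> users and their sizes add up to at most
  \<open>m\<close>.\<close>

lemma arc_unique: "i < e + 3 * t \<Longrightarrow> j < e + 3 * t \<Longrightarrow> u \<in> arc i \<Longrightarrow> u \<in> arc j \<Longrightarrow> i = j"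
  by (rule cover_disjoint[OF _ arc_size]) (use cover in \<open>auto simp: finite_arc\<close>)

lemma S_private: "k < e \<Longrightarrow> S k \<inter> {X n, Y n} = {}"
proof -
  assume k: "k < e"
  have "x < X n \<and> x < Y n" if "x \<in> S k" for x
    using S_elem[OF k that] c_less[OF k] X_ge[of n] XY(1)[of n] by linarith
  then show ?thesis by auto
qed

text \<open>If \<open>{b k, c k}\<close> cannot be used to satisfy codeword \<open>k\<close>, the known window lies to the right of
  \<open>a k\<close>, so every codeword up to \<open>k\<close> can be satisfied on its first two positions.\<close>

lemma bad_special:
  assumes i: "i < e + 3 * t" and u: "u < m" "u \<in> arc i" and d: "word i \<inter> unknown m s u = {d}"
    and k: "k < e" "k \<noteq> i" "\<not> {b k, c k} \<subseteq> unknown m s u - {d}"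
    and j: "j \<le> k" "j \<noteq> i"
  shows "S j \<inter> (unknown m s u - {d}) = {} \<or> {a j, Suc (a j)} \<subseteq> unknown m s u - {d}"
proof -
  have je: "j < e" using k(1) j(1) by simp
  \<comment> \<open>User \<open>u\<close> is served by codeword \<open>i\<close> alone, hence lies
    in no other arc. So \<open>u\<close> is not strictly between learning \<open>b k\<close> and
    learning \<open>c k\<close>, and by \<open>nj\<close> it is not the one user for whom
    \<open>a j\<close> is lost while its successor is still known.\<close>
  have nk: "\<not> (b k \<le> u \<and> u < c k)"
  proof
    assume "b k \<le> u \<and> u < c k"
    then have "u \<in> arc k" using k(1) by (simp add: arc_def)
    then show False using arc_unique[OF _ i _ u(2), of k] k(1,2) by simp
  qed
  have nj: "u \<noteq> a j + s"
  proof
    assume "u = a j + s"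
    then have "u \<in> arc j" using je by (simp add: arc_def)
    then show False using arc_unique[OF _ i _ u(2), of j] je j(2) by simp
  qed
  have kn: "x \<in> unknown m s u \<longleftrightarrow> \<not> (x \<le> u \<and> u < x + s)" if "x \<in> S l" "l < e" for x l
    using S_knows[OF that(2,1) u(1)] by (simp add: unknown_def)
  have mem: "a l \<in> S l" "Suc (a l) \<in> S l" "b l \<in> S l" "c l \<in> S l" for l by (auto simp: S_def)
  have cj: "c j \<le> c k \<and> b j \<le> b k"
  proof (cases "j = k")
    case False
    then have "c j < b k" using j(1) by (intro cb[OF _ k(1)]) simp
    then show ?thesis using bc[OF k(1)] bc[OF je] by linarith
  qed simp
  have ij: "a i \<noteq> a j \<and> a i \<noteq> Suc (a j)" if "i < e"
  proof (cases "i < j")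
    case True
    then show ?thesis using aa[OF True je] by linarith
  next
    case False
    then have "Suc (a j) < a i" using j(2) by (intro aa[OF _ that]) simp
    then show ?thesis by linarith
  qed
  have dw: "d \<in> word i" "d \<in> unknown m s u" using d by auto
  have special: "i < e \<Longrightarrow> (b i \<le> u \<and> u < c i \<and> d = c i) \<or> (u = a i + s \<and> d = a i)"
  proof -
    assume ie: "i < e"
    then have "b i \<le> u \<and> u < c i \<or> u = a i + s" using u(2) by (auto simp: arc_def)
    then show ?thesis using special_view[OF ie u(1)] d ie by (auto simp: word_def)
  qed
  have pair: "\<not> i < e \<Longrightarrow> d \<notin> S l" if "l < e" for l
    using S_private[OF that, of "i - e"] dw(1) by (auto simp: word_def)
  have "b k \<notin> unknown m s u \<or> c k \<notin> unknown m s u \<or> d \<in> {b k, c k}" using k(3) by blast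
  \<comment> \<open>If \<open>b k\<close> or \<open>c k\<close> is known, \<open>nk\<close> pushes
    \<open>u\<close> up to \<open>c k\<close> or beyond. Then either all of \<open>S j\<close> lies
    in the known window, or both low points of \<open>S j\<close> have already left it.\<close>
  then consider (known) "c k \<le> u" "u < c k + s" | (dec) "d \<in> {b k, c k}"
  proof (elim disjE)
    assume "b k \<notin> unknown m s u"
    then have "b k \<le> u" "u < b k + s" using kn[OF mem(3) k(1)] by auto
    then show ?thesis using that(1) nk bc[OF k(1)] by linarith
  next
    assume "c k \<notin> unknown m s u"
    then show ?thesis using that(1) kn[OF mem(4) k(1)] by blast
  qed (rule that(2))
  then show ?thesis
  proof cases
    case known
    show ?thesis
    proof (cases "u < a j + s")
      case True
      have "x \<notin> unknown m s u" if "x \<in> S j" for x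
        using kn[OF that je] S_elem[OF je that] True known cj by linarith
      then show ?thesis by blast
    next
      case False
      then have "Suc (a j) + s \<le> u" using nj by simp
      then have unk: "a j \<in> unknown m s u" "Suc (a j) \<in> unknown m s u"
        using kn[OF mem(1) je] kn[OF mem(2) je] by linarith+
      have "d \<noteq> a j \<and> d \<noteq> Suc (a j)"
      proof (cases "i < e")
        case True
        have "a i \<noteq> a j \<and> a i \<noteq> Suc (a j)" by (rule ij[OF True])
        moreover have "Suc (a j) \<le> u" using ab[OF je] bc[OF je] cj known by linarith
        ultimately show ?thesis using special[OF True] by auto
      next
        case False
        then show ?thesis using pair[OF je False] mem(1,2)[of j] by auto
      qed
      then show ?thesis using unk by auto
    qed
  next
    case dec
    \<comment> \<open>Codewords can share points: \<open>d\<close> must be the low point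
      \<open>a i\<close>, coinciding with \<open>b k\<close> or \<open>c k\<close>. Then
      \<open>u = a i + s\<close>, and everything below \<open>a i\<close> is unknown.\<close>
    have ie: "i < e" using pair[of k] k(1) dec mem(3,4)[of k] by auto
    have "c i \<noteq> b k \<and> c i \<noteq> c k"
    proof (cases "i < k")
      case True
      then show ?thesis using cb[OF True k(1)] bc[OF k(1)] by linarith
    next
      case False
      then have "c k < b i" using k(2) by (intro cb[OF _ ie]) simp
      then show ?thesis using bc[OF ie] bc[OF k(1)] by linarith
    qed
    then have "d \<noteq> c i" using dec by auto
    then have di: "u = a i + s" "d = a i" using special[OF ie] by auto
    have "b k \<le> d" using dec bc[OF k(1)] by auto
    then have "Suc (a j) \<le> d" using ab[OF je] cj by linarith
    then have unk: "a j \<in> unknown m s u" "Suc (a j) \<in> unknown m s u"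
      using kn[OF mem(1) je] kn[OF mem(2) je] di by linarith+
    have "a i \<noteq> a j \<and> a i \<noteq> Suc (a j)" by (rule ij[OF ie])
    then show ?thesis using unk di by auto
  qed
qed

text \<open>Low points increase with the index, so those of \<open>S l\<close> lie below every point
  of the later codewords and are fresh when \<open>l\<close> is placed in front of them.\<close>

lemma peel_low:
  assumes low: "\<And>j. j < K \<Longrightarrow> S j \<inter> U = {} \<or> {a j, Suc (a j)} \<subseteq> U" and K: "K \<le> e"
  shows "l \<le> K \<Longrightarrow> peelable U (map S [l..<K])"
proof (induction "K - l" arbitrary: l)
  case 0
  then show ?case by (simp add: peelable.Nil)
next
  case (Suc z)
  then have l: "l < K" by simp
  have IH: "peelable U (map S [Suc l..<K])" using Suc l by simp
  have upt: "[l..<K] = l # [Suc l..<K]" using l by (simp add: upt_conv_Cons)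
  show ?case
  proof (cases "S l \<inter> U = {}")
    case True
    then show ?thesis using IH upt by (simp add: peelable.skip)
  next
    case False
    then have "{a l, Suc (a l)} \<subseteq> S l \<inter> U" using low[OF l] by (auto simp: S_def)
    moreover have "{a l, Suc (a l)} \<inter> \<Union> (set (map S [Suc l..<K])) = {}"
    proof -
      have "x \<notin> S j" if "l < j" "j < K" "x \<le> Suc (a l)" for x j
        using S_elem[of j x] aa[of l j] that K by auto
      then show ?thesis by fastforce
    qed
    ultimately show ?thesis using peelable.peel[OF IH, of "a l" "Suc (a l)" "S l"] upt by simp
  qed
qed

text \<open>The mirror image of the preceding argument: \<open>b l\<close> and \<open>c l\<close>
  lie above every point of the codewords with smaller index, so on the high side the codewords are
  placed in decreasing order.\<close>

lemma peel_high:
  assumes low: "peelable U (map S [0..<K])"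
    and high: "\<And>j. K \<le> j \<Longrightarrow> j < e \<Longrightarrow> S j \<inter> U = {} \<or> {b j, c j} \<subseteq> U"
  shows "K \<le> l \<Longrightarrow> l \<le> e \<Longrightarrow> peelable U (map S (rev [K..<l]) @ map S [0..<K])"
proof (induction l)
  case 0
  then show ?case using low by simp
next
  case (Suc l)
  show ?case
  proof (cases "K = Suc l")
    case True
    then show ?thesis using low by simp
  next
    case False
    then have l: "K \<le> l" "l < e" using Suc.prems by auto
    have IH: "peelable U (map S (rev [K..<l]) @ map S [0..<K])" using Suc.IH l by simp
    have upt: "map S (rev [K..<Suc l]) @ map S [0..<K] = S l # (map S (rev [K..<l]) @ map S [0..<K])"
      using l by simp
    show ?thesis
    proof (cases "S l \<inter> U = {}")
      case True
      then show ?thesis unfolding upt using IH by (rule peelable.skip[rotated])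
    next
      case False
      then have sub: "{b l, c l} \<subseteq> S l \<inter> U" using high[OF l] by (auto simp: S_def)
      have "x \<notin> S j" if "j < l" "b l \<le> x" for x j
        using S_elem[of j x] cb[of j l] that l by auto
      then have "{b l, c l} \<inter> \<Union> (set (map S (rev [K..<l]) @ map S [0..<K])) = {}"
        using bc[OF l(2)] l(1) by fastforce
      then show ?thesis unfolding upt using peelable.peel[OF IH _ sub] bc[OF l(2)] by simp
    qed
  qed
qed

lemma words: "set (map word [0..<e + 3 * t]) = S ` {..<e} \<union> (\<lambda>n. {X n, Y n}) ` {..<3 * t}"
proof -
  have "{..<e + 3 * t} = {..<e} \<union> (\<lambda>n. e + n) ` {..<3 * t}"
  proof -
    have "x \<in> (\<lambda>n. e + n) ` {..<3 * t}" if "x < e + 3 * t" "\<not> x < e" for x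
      using that by (intro image_eqI[of _ _ "x - e"]) auto
    then show ?thesis by auto
  qed
  then have "word ` {..<e + 3 * t} = word ` {..<e} \<union> (\<lambda>n. word (e + n)) ` {..<3 * t}"
    by (simp only: image_Un image_image)
  moreover have "word ` {..<e} = S ` {..<e}" by (auto simp: word_def)
  moreover have "word (e + n) = {X n, Y n}" for n by (simp add: word_def)
  ultimately show ?thesis by (simp add: atLeast0LessThan)
qed

lemma word_local:
  assumes "W \<in> set (map word [0..<e + 3 * t])"
  shows "W \<subseteq> {..<m}" "\<exists>u<m. \<forall>x\<in>W. knows m s u x"
proof -
  from assms consider k where "k < e" "W = S k" | n where "n < 3 * t" "W = {X n, Y n}"
    unfolding words by blast
  note cases = this
  have m0: "0 < m" using base_m' by linarith
  show "W \<subseteq> {..<m}"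
    using cases
  proof cases
    case 1
    then show ?thesis using S_knows(1)[OF 1(1) _ m0] by blast
  next
    case 2
    then show ?thesis using X_knows(1)[OF 2(1) _ m0] by blast
  qed
  show "\<exists>u<m. \<forall>x\<in>W. knows m s u x"
    using cases
  proof cases
    case 1
    have "c k < m" using S_knows(1)[OF 1(1) _ m0, of "c k"] by (simp add: S_def)
    moreover have "knows m s (c k) x" if "x \<in> S k" for x
      using S_knows(2)[OF 1(1) that \<open>c k < m\<close>] S_elem[OF 1(1) that] ca[OF 1(1)] by simp
    ultimately show ?thesis using 1 by blast
  next
    case 2
    have "Y n < m" using Y_less[OF 2(1)] .
    moreover have "knows m s (Y n) x" if "x \<in> {X n, Y n}" for x
      using X_knows(2)[OF 2(1) that \<open>Y n < m\<close>] XY[of n] that q_bounds by auto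
    ultimately show ?thesis using 2 by blast
  qed
qed

lemma word_decode:
  assumes i: "i < e + 3 * t" "u \<in> arc i" and u: "u < m"
  shows "\<exists>d. word i \<inter> unknown m s u = {d}"
proof (cases "i < e")
  case True
  then show ?thesis using i(2) special_view[OF True u] by (auto simp: arc_def word_def)
next
  case False
  then have n: "i - e < 3 * t" using i(1) by simp
  have "u \<in> {X (i - e)..<Y (i - e)} \<or> u \<in> (\<lambda>x. (x + s) mod m) ` {X (i - e)..<Y (i - e)}"
    using i(2) False by (simp add: arc_def)
  then show ?thesis
    using pair_view(1,2)[OF n u] False by (auto simp only: word_def if_False atLeastLessThan_iff)
qed

lemma pair_disjoint: "n \<noteq> l \<Longrightarrow> {X n, Y n} \<inter> {X l, Y l} = {}"
proof -
  have "{X n, Y n} \<inter> {X l, Y l} = {}" if "n < l" for n l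
  proof -
    have "Y n < X l" "X n < X l" "Y n < Y l" "X n < Y l"
      using X_mono[OF that] XY(1)[of n] XY(1)[of l] by linarith+
    then show ?thesis by auto
  qed
  moreover assume "n \<noteq> l"
  ultimately show ?thesis by (metis Int_commute nat_neq_iff)
qed

lemma peelable_words:
  assumes i: "i < e + 3 * t" "u \<in> arc i" and u: "u < m" and d: "word i \<inter> unknown m s u = {d}"
  shows "\<exists>Ts. set Ts = set (map word [0..<e + 3 * t]) \<and> peelable (unknown m s u - {d}) Ts"
proof -
  let ?U = "unknown m s u - {d}"
  have dec: "word i \<inter> ?U = {}" using d by auto
  let ?bad = "\<lambda>k. k < e \<and> k \<noteq> i \<and> \<not> {b k, c k} \<subseteq> ?U"
  \<comment> \<open>\<open>K\<close> is one more than the greatest index whose high pair is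
    unusable, or 0 if there is none. From \<open>K\<close> on the high pairs are peeled, below
    \<open>K\<close> the low pairs; codeword \<open>i\<close> itself is always skipped, since its
    only unknown point is \<open>d\<close>.\<close>
  obtain K where K: "K \<le> e" "\<And>k. K \<le> k \<Longrightarrow> \<not> ?bad k" "\<And>j. j < K \<Longrightarrow> S j \<inter> ?U = {} \<or> {a j, Suc (a j)} \<subseteq> ?U"
  proof (cases "\<exists>k. ?bad k")
    case False
    then show ?thesis using that[of 0] by blast
  next
    case True
    define k where "k = (GREATEST k. ?bad k)"
    have bk: "?bad k" unfolding k_def using True by (intro GreatestI_ex_nat[of ?bad e]) auto
    have low: "S j \<inter> ?U = {} \<or> {a j, Suc (a j)} \<subseteq> ?U" if "j \<le> k" for j
    proof (cases "j = i")
      case True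
      then show ?thesis using dec bk that by (auto simp: word_def)
    next
      case False
      then show ?thesis using bad_special[OF i(1) u i(2) d, of k j] bk that by blast
    qed
    have "l \<le> k" if "?bad l" for l
      unfolding k_def using that by (intro Greatest_le_nat[of ?bad _ e]) auto
    then have up: "\<not> ?bad l" if "Suc k \<le> l" for l using that by (meson not_less_eq_eq)
    have le: "Suc k \<le> e" using bk by simp
    have lo: "S j \<inter> ?U = {} \<or> {a j, Suc (a j)} \<subseteq> ?U" if "j < Suc k" for j
      using low that by simp
    show ?thesis by (rule that[OF le up lo])
  qed
  have high: "S j \<inter> ?U = {} \<or> {b j, c j} \<subseteq> ?U" if "K \<le> j" "j < e" for j
    using K(2)[OF that(1)] that(2) dec by (cases "j = i") (auto simp: word_def)
  have sp: "peelable ?U (map S (rev [K..<e]) @ map S [0..<K])"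
    using peel_high[OF peel_low[OF K(3,1)] high, of e] K(1) by simp
  let ?Ts = "map (\<lambda>n. {X n, Y n}) [0..<3 * t] @ (map S (rev [K..<e]) @ map S [0..<K])"
  have setS: "set (map S (rev [K..<e]) @ map S [0..<K]) = S ` {..<e}"
  proof -
    have "{K..<e} \<union> {0..<K} = {..<e}" using K(1) by auto
    moreover have "set (map S (rev [K..<e]) @ map S [0..<K]) = S ` ({K..<e} \<union> {0..<K})"
      by (simp only: set_append set_map set_rev set_upt image_Un)
    ultimately show ?thesis by (simp only:)
  qed
  have "peelable ?U ?Ts"
  proof (rule peelable_private[OF sp])
    fix n assume "n \<in> set [0..<3 * t]"
    then have n: "n < 3 * t" by simp
    show "X n \<noteq> Y n" using XY(1)[of n] by simp
    show "{X n, Y n} \<inter> W = {}" if "W \<in> set (map S (rev [K..<e]) @ map S [0..<K])" for W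
      using that S_private[of _ n] unfolding setS by blast
    show "{X n, Y n} \<inter> {X l, Y l} = {}" if "n \<noteq> l" for l
      using that by (rule pair_disjoint)
    show "{X n, Y n} \<inter> ?U = {} \<or> {X n, Y n} \<subseteq> ?U"
    proof (cases "i = e + n")
      case True
      then show ?thesis using dec by (simp add: word_def)
    next
      case False
      have "d \<notin> {X n, Y n}"
      proof (cases "i < e")
        case True
        then have "word i = S i" by (simp add: word_def)
        then show ?thesis using d S_private[OF True, of n] by blast
      next
        case ie: False
        then have "n \<noteq> i - e" using False by auto
        then have "{X n, Y n} \<inter> word i = {}" using pair_disjoint ie by (simp only: word_def if_False)
        moreover have "d \<in> word i" using d by blast
        ultimately show ?thesis by blast
      qed
      moreover have "u \<notin> arc (e + n)"
        using arc_unique[OF i(1) _ i(2), of "e + n"] False n by auto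
      ultimately show ?thesis using pair_view(3)[OF n u] by blast
    qed
  qed simp
  moreover have "set ?Ts = set (map word [0..<e + 3 * t])"
    unfolding words set_append[of "map _ [0..<3 * t]"] setS
    by (simp only: set_map set_upt atLeast0LessThan Un_commute)
  ultimately show ?thesis by blast
qed

lemma good_chain: "good_code m s (e + 3 * t) (set_code (map word [0..<e + 3 * t]))"
proof -
  have "good_code m s (length (map word [0..<e + 3 * t])) (set_code (map word [0..<e + 3 * t]))"
  proof (rule good_set_codeI)
    fix u assume u: "u < m"
    obtain i where i: "i < e + 3 * t" "u \<in> arc i" using cover[OF u] by blast
    obtain d where d: "word i \<inter> unknown m s u = {d}" using word_decode[OF i u] by blast
    obtain Ts where Ts: "set Ts = set (map word [0..<e + 3 * t])" "peelable (unknown m s u - {d}) Ts"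
      using peelable_words[OF i u d] by blast
    have "word i \<in> set (map word [0..<e + 3 * t])" using i(1) by simp
    moreover have "d \<in> word i" using d by blast
    ultimately show "\<exists>d W Ts. W \<in> set (map word [0..<e + 3 * t]) \<and> d \<in> W \<and> W \<inter> unknown m s u = {d} \<and>
        set Ts = set (map word [0..<e + 3 * t]) \<and> peelable (unknown m s u - {d}) Ts"
      using d Ts by (intro exI conjI)
  qed (rule word_local, assumption)+
  moreover have "length (map word [0..<e + 3 * t]) = e + 3 * t" by (simp only: length_map length_upt diff_zero)
  ultimately show ?thesis by (simp only:)
qed

end

section \<open>Choosing the remainder for \<open>m > 2 * s\<close>\<close>

text \<open>Cells as equal as possible, cut at the integer parts of \<open>k * r / e\<close>.
  Average length at least 2 makes every cell at least 2 long, and twice the average being at most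
  \<open>s\<close> bounds two neighbouring cells by \<open>s\<close>.\<close>

lemma good_uniform:
  assumes t: "0 < t" and e: "0 < e" and r: "2 * e \<le> r" "2 * r \<le> e * s"
  shows "\<exists>c. good_code (2 * s * t + r) s (e + 3 * t) c"
proof -
  define \<sigma> where "\<sigma> k = k * r div e" for k
  have gap: "\<sigma> k + 2 \<le> \<sigma> (Suc k)" for k
  proof -
    have "\<sigma> k + 2 = (k * r + 2 * e) div e" using e by (simp add: \<sigma>_def)
    also have "\<dots> \<le> \<sigma> (Suc k)" unfolding \<sigma>_def using r(1) by (intro div_le_mono) simp
    finally show ?thesis .
  qed
  have two: "\<sigma> (Suc (Suc k)) \<le> \<sigma> k + s" for k
  proof -
    have "\<sigma> (Suc (Suc k)) \<le> (k * r + s * e) div e"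
      unfolding \<sigma>_def using r(2) by (intro div_le_mono) (simp add: mult.commute)
    also have "\<dots> = \<sigma> k + s" using e by (simp add: \<sigma>_def)
    finally show ?thesis .
  qed
  have se: "\<sigma> e = r" using e by (simp add: \<sigma>_def)
  have cyc: "\<sigma> e + \<sigma> 1 \<le> \<sigma> (e - 1) + s"
  proof -
    have er: "(e - 1) * r + r = e * r" using e by (cases e) auto
    have "(e - 1) * r < e * \<sigma> (e - 1) + e"
      unfolding \<sigma>_def using e by (metis add.commute dividend_less_times_div mult.commute)
    moreover have "e * \<sigma> 1 \<le> r" by (simp add: \<sigma>_def)
    \<comment> \<open>The rounding error costs less than one unit after division by
      \<open>e\<close>, so a strict inequality between integers with an extra 1 on the right
      suffices.\<close>
    ultimately have "e * (r + \<sigma> 1) < e * (\<sigma> (e - 1) + s + 1)"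
      using r(2) er by (simp add: distrib_left)
    then have "r + \<sigma> 1 < \<sigma> (e - 1) + s + 1" by (simp only: mult_less_cancel1)
    then show ?thesis using se by simp
  qed
  have "\<sigma> (e - 1) + 2 \<le> r" using gap[of "e - 1"] e se by simp
  then interpret chain s t e "r - \<sigma> (e - 1) - 1" \<sigma>
    using t e gap two cyc se by unfold_locales (auto simp: \<sigma>_def)
  show ?thesis using good_chain se by (auto simp: m_def)
qed

text \<open>A user served by pair \<open>i\<close> knows both or neither of the points of any other
  pair \<open>n\<close>. The case \<open>u = 1\<close> is \<open>2 * i + 3\<close> reduced modulo
  \<open>2 * M\<close>.\<close>

lemma pair_known:
  fixes n i M u :: nat
  assumes "n \<noteq> i" "n < M" "i < M" "4 \<le> M" and u: "u = 2 * i \<or> u = 2 * i + 3 \<or> u = 1 \<and> M = i + 1"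
  shows "(2 * n \<le> u \<and> u < 2 * n + 3 \<or> u + 2 * M < 2 * n + 3) \<longleftrightarrow>
    (2 * n + 1 \<le> u \<and> u < 2 * n + 1 + 3 \<or> u + 2 * M < 2 * n + 1 + 3)"
proof -
  have "n < i \<and> n + 1 \<noteq> i \<or> n + 1 = i \<or> n = i + 1 \<or> i + 1 < n" using assms(1) by linarith
  moreover have "2 * i + 2 * M < 2 * n + 3 \<longleftrightarrow> 2 * i + 2 * M < 2 * n + 1 + 3" by presburger
  ultimately show ?thesis using u assms(1-4) by (elim disjE) auto
qed

text \<open>The chain needs \<open>q + 3 \<le> s\<close> with \<open>q > 0\<close>, so
  \<open>s = 3\<close> is treated apart. The pair of \<open>2 * n\<close> and
  \<open>2 * n + 1\<close> serves the users \<open>2 * n\<close> and \<open>2 * n + 3\<close>, that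
  is, one even and one odd user per pair.\<close>

lemma good_adjacent_pairs:
  assumes M: "4 \<le> M"
  shows "\<exists>c. good_code (2 * M) 3 M c"
proof -
  let ?W = "\<lambda>n. {2 * n, 2 * n + 1 :: nat}"
  have unk: "x \<in> unknown (2 * M) 3 u \<longleftrightarrow> \<not> (x \<le> u \<and> u < x + 3 \<or> u + 2 * M < x + 3)"
    if "u < 2 * M" "x < 2 * M" for x u
    using knows_iff[of u "2 * M" x 3] that M by (simp add: unknown_def)
  have "good_code (2 * M) 3 (length (map ?W [0..<M])) (set_code (map ?W [0..<M]))"
  proof (rule good_set_codeI)
    fix S assume "S \<in> set (map ?W [0..<M])"
    then obtain n where n: "n < M" "S = ?W n" by auto
    then show "S \<subseteq> {..<2 * M}" by auto
    have "knows (2 * M) 3 (2 * n + 1) (2 * n)" "knows (2 * M) 3 (2 * n + 1) (2 * n + 1)"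
      using n M by (simp_all add: knows_iff)
    moreover have "2 * n + 1 < 2 * M" using n by simp
    ultimately show "\<exists>u<2 * M. \<forall>x\<in>S. knows (2 * M) 3 u x" using n(2) by blast
  next
    fix u assume u: "u < 2 * M"
    obtain i d where i: "i < M" and id: "u = 2 * i \<and> d = 2 * i + 1 \<or> u = 2 * i + 3 \<and> d = 2 * i \<or>
        u = 1 \<and> M = i + 1 \<and> d = 2 * i"
    proof (cases "even u")
      case True
      then obtain k where "u = 2 * k" by (elim evenE)
      then show thesis using u by (intro that[of k "2 * k + 1"]) auto
    next
      case False
      then obtain k where k: "u = 2 * k + 1" by (elim oddE)
      show thesis
      proof (cases k)
        case 0
        then show thesis using k M by (intro that[of "M - 1" "2 * (M - 1)"]) auto
      next
        case (Suc j)
        then show thesis using k u by (intro that[of j "2 * j"]) auto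
      qed
    qed
    have b: "2 * n < 2 * M" "2 * n + 1 < 2 * M" if "n < M" for n using that by auto
    have "(2 * i \<in> unknown (2 * M) 3 u \<longleftrightarrow> d = 2 * i) \<and> (2 * i + 1 \<in> unknown (2 * M) 3 u \<longleftrightarrow> d = 2 * i + 1)"
      unfolding unk[OF u b(1)[OF i]] unk[OF u b(2)[OF i]] using id M i by (elim disjE) simp_all
    then have dec: "?W i \<inter> unknown (2 * M) 3 u = {d}" using id by auto
    have other: "?W n \<inter> (unknown (2 * M) 3 u - {d}) = {} \<or> ?W n \<subseteq> unknown (2 * M) 3 u - {d}" if n: "n < M" for n
    proof (cases "n = i")
      case True
      then show ?thesis using dec by auto
    next
      case False
      have "2 * n \<in> unknown (2 * M) 3 u \<longleftrightarrow> 2 * n + 1 \<in> unknown (2 * M) 3 u"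
        unfolding unk[OF u b(1)[OF n]] unk[OF u b(2)[OF n]]
        using pair_known[OF False n i M, of u] id by blast
      moreover have "d \<noteq> 2 * n" "d \<noteq> 2 * n + 1" using id False by (elim disjE conjE; presburger)+
      ultimately show ?thesis by auto
    qed
    have pl: "peelable (unknown (2 * M) 3 u - {d}) (map ?W [0..<M] @ [])"
    proof (rule peelable_private[OF peelable.Nil])
      show "{2 * n, 2 * n + 1} \<inter> {2 * l, 2 * l + 1} = {}" if "n \<noteq> l" for n l :: nat
        using that by (auto; presburger)
    qed (use other in simp_all)
    show "\<exists>d S Ts. S \<in> set (map ?W [0..<M]) \<and> d \<in> S \<and> S \<inter> unknown (2 * M) 3 u = {d} \<and>
        set Ts = set (map ?W [0..<M]) \<and> peelable (unknown (2 * M) 3 u - {d}) Ts"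
    proof (intro exI conjI)
      show "?W i \<in> set (map ?W [0..<M])" using i by simp
      show "d \<in> ?W i" using id by auto
      show "?W i \<inter> unknown (2 * M) 3 u = {d}" by (rule dec)
      show "peelable (unknown (2 * M) 3 u - {d}) (map ?W [0..<M])" using pl by simp
    qed simp
  qed
  then show ?thesis by auto
qed

lemma good_sparse:
  assumes m: "2 * s < m" and s: "3 \<le> s" "s \<in> {3, 4} \<Longrightarrow> even m"
  shows "\<exists>N c. good_code m s N c \<and> 2 * s * N \<le> 3 * m + 6 * s"
proof (cases "s = 3")
  case True
  then obtain M where M: "m = 2 * M" using s(2) by auto
  then have "4 \<le> M" using m True by simp
  then show ?thesis using good_adjacent_pairs[of M] True M by auto
next
  case False
  define t r where "t = m div (2 * s)" and "r = m mod (2 * s)"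
  have mt: "m = 2 * s * t + r" by (simp add: t_def r_def)
  have r: "r < 2 * s" using s by (simp add: r_def)
  have t: "0 < t" using m s by (simp add: t_def div_greater_zero_iff)
  \<comment> \<open>For \<open>s = 4\<close> the two spacing conditions of
    \<open>good_uniform\<close> force the remainder to be exactly \<open>2 * e\<close>, so the
    parity of \<open>m\<close> is essential there.\<close>
  have evr: "even r" if "s = 4" using s(2) that by (simp add: r_def dvd_mod_iff)
  \<comment> \<open>The last condition is the budget: three codewords per block use up
    \<open>3 * (m - r')\<close> of the allowed \<open>3 * m + 6 * s\<close>.\<close>
  have U: ?thesis if U: "0 < t'" "0 < e" "m = 2 * s * t' + r'" "2 * e \<le> r'" "2 * r' \<le> e * s" "2 * s * e \<le> 3 * r' + 6 * s" for t' e r'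
  proof -
    obtain c where "good_code m s (e + 3 * t') c" using good_uniform[OF U(1,2,4,5)] U(3) by auto
    moreover have "2 * s * (e + 3 * t') \<le> 3 * m + 6 * s" using U(3,6) by (simp add: distrib_left)
    ultimately show ?thesis by blast
  qed
  obtain t' where t': "t = Suc t'" using t by (cases t) auto
  \<comment> \<open>One block is lent to the remainder, for values of \<open>r\<close> that admit no
    suitable \<open>e\<close>.\<close>
  have mt': "m = 2 * s * t' + (2 * s + r)" using mt t' by simp
  have s5: "5 \<le> s" if "odd r"
  proof -
    have "s \<noteq> 4" using evr that by blast
    then show ?thesis using False s(1) by linarith
  qed
  have W: ?thesis if "good_code m' s' N c" "m' = m" "s' = s" "2 * s * N \<le> 3 * m + 6 * s" for m' s' N c
    using that by blast
  consider "r = 0" | "r = 1" | "r = 2" | "r = 3" | "4 \<le> r" by linarith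
  then show ?thesis
  proof cases
    assume r: "r = 0"
    then have "t' \<noteq> 0" using m mt' by (intro notI) simp
    then show ?thesis using r mt' s(1) False by (intro U[of t' 4 "2 * s"]; linarith)
  next
    assume r: "r = 1"
    have s5: "5 \<le> s" using s5 r by simp
    show ?thesis
    proof (cases "t' = 0")
      case False
      have "m = 2 * s * t' + (2 * s + 1)" using mt' r by simp
      then show ?thesis using False s5 by (intro U[of t' 5 "2 * s + 1"]; (linarith | (simp; fail)))
    next
      case True
      then have m: "m = 2 * s + 1" using mt' r by simp
      show ?thesis
      proof (cases "s = 5")
        case True
        then show ?thesis using m by (intro W[OF good_11_5]; linarith)
      next
        case False
        then obtain h where "s = h + 5" "1 \<le> h" using s5 by (intro that[of "s - 5"]) auto
        then show ?thesis using m by (intro W[OF good_above[of h]]; linarith)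
      qed
    qed
  next
    assume "r = 2"
    then show ?thesis using mt t s(1) False by (intro U[of t 1 2]; linarith)
  next
    assume r: "r = 3"
    have s5: "5 \<le> s" using s5 r by simp
    show ?thesis
    proof (cases "s = 5")
      case False
      then show ?thesis using r mt t s5 by (intro U[of t 1 3]; linarith)
    next
      \<comment> \<open>For \<open>s = 5\<close> and \<open>r = 3\<close> one cell is too long and
        two cells are too short. With a borrowed block, 13 positions split into six cells.\<close>
      case s5: True
      show ?thesis
      proof (cases "t' = 0")
        case True
        then have "m = 13" using mt' r s5 by simp
        then show ?thesis using s5 by (intro W[OF good_13_5]; linarith)
      next
        case False
        then have "m = 2 * s * t' + 13" using mt' r s5 by simp
        then show ?thesis using False s5 by (intro U[of t' 6 13]; linarith)
      qed
    qed
  next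
    assume r4: "4 \<le> r"
    have r6: "6 \<le> r" if "s < r"
    proof (cases "s = 4")
      case True
      then have "even r" by (rule evr)
      then have "r \<noteq> 5" by auto
      then show ?thesis using that True by linarith
    qed (use that s(1) False in linarith)
    have r8: "8 \<le> r" if "3 * s < 2 * r"
    proof (cases "s = 4")
      case True
      then have "even r" by (rule evr)
      then have "r \<noteq> 7" by auto
      then show ?thesis using that True by linarith
    qed (use that s(1) False in linarith)
    consider "r \<le> s" | "s < r" "2 * r \<le> 3 * s" | "3 * s < 2 * r" by linarith
    then show ?thesis
    proof cases
      assume "r \<le> s"
      then show ?thesis using mt t r4 by (intro U[of t 2 r]; linarith)
    next
      assume "s < r" "2 * r \<le> 3 * s"
      then show ?thesis using mt t r6 by (intro U[of t 3 r]; linarith)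
    next
      assume "3 * s < 2 * r"
      then show ?thesis using mt t r r8 by (intro U[of t 4 r]; linarith)
    qed
  qed
qed

section \<open>All parameters with \<open>m < 2 * s\<close>\<close>

lemma good_code_fold_iterate:
  assumes "good_code (s + g) s N c" "0 < s" "0 < g"
  shows "\<exists>c. good_code (s + g + k * g) (s + k * g) N c"
proof (induction k)
  case 0
  then show ?case using assms by auto
next
  case (Suc k)
  then obtain c' where "good_code ((s + k * g) + g) (s + k * g) N c'" by (auto simp: ac_simps)
  from good_code_fold[OF this] have "good_code ((s + k * g) + 2 * g) ((s + k * g) + g) N (\<lambda>k x. c' k (fold_pos g x))"
    using assms by simp
  moreover have "(s + k * g) + 2 * g = s + g + Suc k * g" "(s + k * g) + g = s + Suc k * g" by simp_all
  ultimately show ?case by (simp only:) blast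
qed

lemma good_dense:
  assumes m: "m < 2 * s" "s < m" and ndvd: "\<not> (m - s) dvd m"
    and ex: "\<not> (odd m \<and> m = s + 2)" "\<not> (m = 7 \<and> s = 4)"
  shows "\<exists>N c. good_code m s N c \<and> N \<le> 9"
proof -
  define g where "g = m - s"
  define r where "r = m mod g"
  \<comment> \<open>\<open>g = 1\<close> divides every \<open>m\<close>, and \<open>g = 2\<close>
    divides every even \<open>m\<close>; odd \<open>m\<close> with \<open>g = 2\<close> is an
    excluded case.\<close>
  have g3: "3 \<le> g"
  proof (rule ccontr)
    assume "\<not> 3 \<le> g"
    then have "g = 1 \<or> g = 2" using m unfolding g_def by arith
    then show False using ndvd ex m by (auto simp: g_def)
  qed
  have r: "0 < r" "r < g" using ndvd g3 by (auto simp: r_def g_def mod_greater_zero_iff_not_dvd)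
  define z where "z = m div g"
  have mz: "m = z * g + r" by (simp add: r_def z_def)
  have "2 * g \<le> m" using m by (simp add: g_def)
  then have "2 \<le> z" using g3 by (simp add: z_def less_eq_div_iff_mult_less_eq)
  then obtain k where k: "z = k + 2" by (metis add.commute le_Suc_ex)
  have ms: "m = (g + r) + g + k * g" "s = (g + r) + k * g"
    using mz k m by (auto simp: g_def distrib_right)
  have F: ?thesis if c: "good_code M S N c" "M = (g + r) + g" "S = g + r" "N \<le> 9" for M S N c
  proof -
    have "good_code ((g + r) + g) (g + r) N c" using c by (simp only:)
    then obtain c' where "good_code ((g + r) + g + k * g) ((g + r) + k * g) N c'"
      using good_code_fold_iterate[of "g + r" g N c k] r by auto
    then have "good_code m s N c'" by (simp only: ms)
    then show ?thesis using c(4) by blast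
  qed
  \<comment> \<open>The small \<open>g\<close> appear separately because points of the corresponding
    family would collide: for instance at \<open>g = 4\<close> and \<open>g = 5\<close> with
    \<open>r = 1\<close>, at \<open>g = 4\<close> with \<open>r = 2\<close>, and at
    \<open>g = 5\<close> with \<open>r = 3\<close>.\<close>
  have "(g = 3 \<and> r = 1) \<or> (g = 4 \<and> r = 1) \<or> (g = 5 \<and> r = 1) \<or> (6 \<le> g \<and> r = 1) \<or>
      (g = 4 \<and> r = 2) \<or> (g = 5 \<and> r = 3) \<or> (6 \<le> g \<and> r + 2 = g) \<or>
      (g = 3 \<and> r = 2) \<or> (5 \<le> g \<and> r = 2) \<or> (3 \<le> r \<and> r + 2 \<noteq> g)"
    using r g3 by presburger
  then show ?thesis
  proof (elim disjE conjE)
    assume A: "g = 3" "r = 1"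
    \<comment> \<open>The smallest circle of this class would be the excluded pair
      \<open>m = 7\<close>, \<open>s = 4\<close>, so the folding starts one step later, at
      \<open>m = 10\<close>, \<open>s = 7\<close>.\<close>
    then have "k \<noteq> 0" using ex(2) ms by auto
    then obtain l where "k = Suc l" by (cases k) auto
    then have "m = 7 + 3 + l * 3" "s = 7 + l * 3" using ms A by auto
    moreover have "good_code (7 + 3) 7 3 (table_code [0..<10] c10_7_code)" using good_10_7 by (simp only: numeral_plus_numeral add_num_simps)
    then have "\<exists>c. good_code (7 + 3 + l * 3) (7 + l * 3) 3 c" by (rule good_code_fold_iterate) simp_all
    ultimately have "\<exists>c. good_code m s 3 c" by (simp only:)
    then show ?thesis by (intro exI[of _ 3]) auto
  next
    assume "g = 4" "r = 1"
    then show ?thesis by (intro F[OF good_9_5]) simp_all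
  next
    assume "g = 5" "r = 1"
    then show ?thesis by (intro F[OF good_11_6]) simp_all
  next
    assume "6 \<le> g" "r = 1"
    then show ?thesis by (intro F[OF good_below[of "g - 4"]]) simp_all
  next
    assume "g = 4" "r = 2"
    then show ?thesis by (intro F[OF good_10_6]) simp_all
  next
    assume "g = 5" "r = 3"
    then show ?thesis by (intro F[OF good_13_8]) simp_all
  next
    assume "6 \<le> g" "r + 2 = g"
    then show ?thesis by (intro F[OF good_gap3[of "g - 3"]]) simp_all
  next
    assume "g = 3" "r = 2"
    then show ?thesis by (intro F[OF good_8_5]) simp_all
  next
    assume "5 \<le> g" "r = 2"
    then show ?thesis by (intro F[OF good_gap2[of "g - 2"]]) simp_all
  next
    assume "3 \<le> r" "r + 2 \<noteq> g"
    then show ?thesis using r by (intro F[OF good_gap[of r "g - 2"]]) auto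
  qed
qed

section \<open>The divisible case\<close>

lemma side_info_iff:
  assumes "i \<in> {1..m}" "j \<in> {1..m}" "s < m"
  shows "j \<in> side_info m s i \<longleftrightarrow> j \<le> i \<and> i < j + s \<or> i + m < j + s"
proof -
  have "i = m \<or> i < m" "j = m \<or> j < m" "0 < m" "0 < j" using assms by auto
  then show ?thesis
    using side_info_iff_knows[OF assms(2) less_imp_le[OF assms(3)], of i] knows_iff[of "i mod m" m "j mod m" s] assms(3)
    by (elim disjE) auto
qed

text \<open>The \<open>g\<close> messages unknown to a user are consecutive, so exactly one of them
  sits at a multiple of \<open>g\<close>; that one is decoded. No other unknown message enters any
  transmission, which makes secrecy immediate. Messages are \<open>t - 1\<close> bits long and
  \<open>t\<close> users send one bit each.\<close>

lemma valid_scheme_dvd: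
  assumes t: "2 \<le> t" and g: "0 < g"
  shows "\<exists>\<kappa> n enc. valid_scheme (g * t) (g * (t - 1)) \<kappa> n enc \<and>
    code_length (g * t) \<kappa> n = real t / real (t - 1)"
proof -
  define m s where "m = g * t" and "s = g * (t - 1)"
  have ms: "m = s + g" using t by (cases t) (auto simp: m_def s_def)
  \<comment> \<open>\<open>g * nx i\<close> is the first multiple of \<open>g\<close> strictly after
    \<open>i\<close> on the circle; for \<open>i = m\<close> it is \<open>g\<close> itself.\<close>
  define nx where "nx i = (if i = m then 1 else i div g + 1)" for i
  have nx: "nx i \<in> {1..t}" if "i \<in> {1..m}" for i
    using that t less_mult_imp_div_less[of i t g] by (auto simp: nx_def m_def mult.commute)
  have mult_le: "g * b \<in> {1..m}" if "b \<in> {1..t}" for b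
    using that g by (auto simp: m_def)
  have kn: "g * b \<in> side_info m s i \<longleftrightarrow> b \<noteq> nx i" if i: "i \<in> {1..m}" and b: "b \<in> {1..t}" for i b
  proof -
    have si: "g * b \<in> side_info m s i \<longleftrightarrow> g * b \<le> i \<and> i < g * b + s \<or> i + m < g * b + s"
      using side_info_iff[OF i mult_le[OF b]] ms g by simp
    have gm: "g * b \<le> m" using mult_le[OF b] by simp
    have le: "g * x + g \<le> g * y" if "x < y" for x y
      using mult_le_mono2[of "Suc x" y g] that by simp
    show ?thesis
    proof (cases "i = m")
      case True
      show ?thesis
      proof (cases "b = 1")
        case True
        with \<open>i = m\<close> si ms show ?thesis by (simp add: nx_def)
      next
        case False
        with b have "g * 1 + g \<le> g * b" by (intro le) auto
        with \<open>i = m\<close> si ms gm g b False show ?thesis by (simp add: nx_def)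
      qed
    next
      case False
      define q where "q = i div g"
      have q: "g * q \<le> i" "i < g * q + g"
        using g by (auto simp: q_def) (metis add.commute dividend_less_times_div)
      have nq: "nx i = q + 1" using False by (simp add: nx_def q_def)
      have "i < m" using False i by simp
      have "b \<le> q \<or> b = q + 1 \<or> q + 1 < b" by linarith
      then show ?thesis
      proof (elim disjE)
        assume "b \<le> q"
        then have "g * b \<le> g * q" by simp
        moreover have "g * 0 + g \<le> g * b" using b by (intro le) auto
        ultimately have "g * b \<le> i \<and> i < g * b + s" using q \<open>i < m\<close> ms by linarith
        then show ?thesis using si nq \<open>b \<le> q\<close> by simp
      next
        assume "b = q + 1"
        then show ?thesis using si q nq ms by simp
      next
        assume "q + 1 < b"
        then show ?thesis using si q nq ms le[of "q + 1" b] by simp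
      qed
    qed
  qed
  define \<kappa> where "\<kappa> = t - 1"
  define n where "n i = (if g dvd i then 1 else 0 :: nat)" for i
  \<comment> \<open>User \<open>g * b\<close> adds, for each known multiple \<open>g * a\<close>,
    the bit of that message with index \<open>b - a\<close> modulo \<open>t\<close>. The index
    \<open>t - 1\<close> would occur only for \<open>a = nx (g * b)\<close>, which is left out, so
    all indices fit the message length.\<close>
  define enc where "enc i u = vec (n i) (\<lambda>_. \<Sum>b\<in>{1..t} - {nx i}. u (g * b) $ ((i div g + t - b) mod t))"
    for i and u :: "nat \<Rightarrow> bit vec"
  have "valid_scheme m s \<kappa> n enc"
    unfolding valid_scheme_def
  proof (intro conjI ballI)
    show "1 \<le> \<kappa>" using t by (simp add: \<kappa>_def)
    fix i assume "i \<in> {1..m}"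
    show "enc i \<in> msg_tuples (side_info m s i) \<kappa> \<rightarrow> carrier_vec (n i)"
      by (simp add: enc_def)
  next
    fix i assume i: "i \<in> {1..m}"
    let ?d = "g * nx i"
    have "?d \<in> {1..m} - side_info m s i"
      using mult_le[OF nx[OF i]] kn[OF i nx[OF i]] by simp
    moreover have "decodable m s \<kappa> enc i ?d"
    proof (rule decodableI)
      fix w w' assume w: "w \<in> msg_tuples {1..m} \<kappa>" "w' \<in> msg_tuples {1..m} \<kappa>"
        and v: "user_view m s enc i w = user_view m s enc i w'"
      have car: "w ?d \<in> carrier_vec \<kappa>" "w' ?d \<in> carrier_vec \<kappa>"
        using w mult_le[OF nx[OF i]] by (auto simp: msg_tuples_def)
      have side: "w (g * b) = w' (g * b)" if "b \<in> {1..t}" "b \<noteq> nx i" for b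
        using fun_cong[of _ _ "g * b", OF conjunct2[OF v[unfolded user_view_def prod.inject]]] kn[OF i that(1)] that(2)
        by (simp add: restrict_def)
      show "w ?d = w' ?d"
      proof (rule eq_vecI)
        fix p assume "p < dim_vec (w' ?d)"
        then have p: "p < t - 1" using car by (simp add: \<kappa>_def)
        \<comment> \<open>Bit \<open>p\<close> of the wanted message is sent by the user
          \<open>p\<close> multiples of \<open>g\<close> after it, cyclically. That user knows the
          message, because \<open>p < t - 1\<close>.\<close>
        define b where "b = (if nx i + p \<le> t then nx i + p else nx i + p - t)"
        have b: "b \<in> {1..t}" using nx[OF i] p by (auto simp: b_def)
        have bp: "(b + t - nx i) mod t = p" using nx[OF i] p by (auto simp: b_def)
        have nb: "nx (g * b) = (if b = t then 1 else b + 1)" using g by (auto simp: nx_def m_def)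
        have ne: "nx i \<noteq> nx (g * b)" using nx[OF i] p t unfolding nb by (auto simp: b_def split: if_splits)
        have gb: "g * b \<in> {1..m}" by (rule mult_le[OF b])
        let ?A = "{1..t} - {nx (g * b)}"
        let ?F = "\<lambda>w a. w (g * a) $ ((b + t - a) mod t) :: bit"
        have res: "enc (g * b) (restrict x (side_info m s (g * b))) $ 0 = sum (?F x) ?A" for x
        proof -
          have "(\<Sum>a\<in>?A. restrict x (side_info m s (g * b)) (g * a) $ ((b + t - a) mod t)) = sum (?F x) ?A"
            using kn[OF gb] by (intro sum.cong) auto
          then show ?thesis using g by (simp add: enc_def n_def)
        qed
        have "transmission m s enc w (g * b) = transmission m s enc w' (g * b)"
          using v by (simp add: user_view_def)
        then have "enc (g * b) (restrict w (side_info m s (g * b))) = enc (g * b) (restrict w' (side_info m s (g * b)))"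
          using gb by (simp add: transmission_def)
        then have eq: "sum (?F w) ?A = sum (?F w') ?A" by (simp only: res[of w, symmetric] res[of w', symmetric])
        have split: "sum (?F x) ?A = ?F x (nx i) + sum (?F x) (?A - {nx i})" for x
          using nx[OF i] ne by (intro sum.remove) auto
        have rest: "sum (?F w) (?A - {nx i}) = sum (?F w') (?A - {nx i})"
          using side by (intro sum.cong) auto
        have "?F w (nx i) + sum (?F w') (?A - {nx i}) = ?F w' (nx i) + sum (?F w') (?A - {nx i})"
          by (rule trans[OF trans[OF arg_cong[OF rest[symmetric], of "(+) (?F w (nx i))"] split[of w, symmetric]] trans[OF eq split[of w']]])
        then have "?F w (nx i) = ?F w' (nx i)" by (rule add_right_imp_eq)
        then show "w ?d $ p = w' ?d $ p" using bp by simp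
      qed (use car in auto)
    qed
    moreover have "secure m s \<kappa> enc i ?d"
    proof (rule secureI)
      fix j and a :: "bit vec" assume j: "j \<in> {1..m} - (side_info m s i \<union> {?d})" and a: "a \<in> carrier_vec \<kappa>"
      \<comment> \<open>Changing message \<open>j\<close> alone suffices: \<open>j\<close> is not a
        multiple of \<open>g\<close>, so no encoder reads it.\<close>
      let ?p = "\<lambda>l\<in>{1..m}. if l = j then a else 0\<^sub>v \<kappa>"
      have jm: "g * b \<noteq> j" if "b \<in> {1..t}" for b using kn[OF i that] j by auto
      have pt: "?p \<in> msg_tuples {1..m} \<kappa>" using a by (auto simp: msg_tuples_def)
      have "user_view m s enc i (\<lambda>l\<in>{1..m}. w l + ?p l) = user_view m s enc i w"
        if w: "w \<in> msg_tuples {1..m} \<kappa>" for w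
      proof -
        let ?w = "\<lambda>l\<in>{1..m}. w l + ?p l"
        have wc: "w l \<in> carrier_vec \<kappa>" if "l \<in> {1..m}" for l using w that by (auto simp: msg_tuples_def)
        have same: "?w l = w l" if "l \<in> {1..m}" "l \<noteq> j" for l
          using wc[OF that(1)] that by simp
        have "enc k (restrict ?w S) = enc k (restrict w S)" for k S
        proof -
          have "restrict ?w S (g * b) = restrict w S (g * b)" if "b \<in> {1..t}" for b
            using same[OF mult_le[OF that] jm[OF that]] by (cases "g * b \<in> S") (simp_all only: restrict_apply if_True if_False)
          then show ?thesis unfolding enc_def by (intro arg_cong[of _ _ "vec (n k)"] ext sum.cong) simp_all
        qed
        then have "transmission m s enc ?w = transmission m s enc w"
          by (simp only: transmission_def)
        moreover have "restrict ?w (side_info m s i) = restrict w (side_info m s i)"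
        proof (rule restrict_ext)
          fix l assume l: "l \<in> side_info m s i"
          then have "l \<in> {1..m}" by (simp add: side_info_def)
          then show "?w l = w l" using l j by (intro same) auto
        qed
        ultimately show ?thesis by (simp only: user_view_def)
      qed
      then show "\<exists>p\<in>msg_tuples {1..m} \<kappa>. p j = a \<and> (\<forall>w\<in>msg_tuples {1..m} \<kappa>.
          user_view m s enc i (\<lambda>l\<in>{1..m}. w l + p l) = user_view m s enc i w)"
        using pt j by (intro bexI[OF _ pt] conjI ballI) simp_all
    qed
    ultimately show "\<exists>d\<in>{1..m} - side_info m s i. decodable m s \<kappa> enc i d \<and> secure m s \<kappa> enc i d"
      by blast
  qed
  moreover have "code_length m \<kappa> n = real t / real (t - 1)"
  proof -
    have "{i \<in> {1..m}. g dvd i} = (\<lambda>b. g * b) ` {1..t}"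
      using g by (auto simp: m_def elim!: dvdE)
    then have "card {i \<in> {1..m}. g dvd i} = t"
      using g by (simp add: card_image inj_on_def)
    moreover have "(\<Sum>i=1..m. real (n i)) = real (card {i \<in> {1..m}. g dvd i})"
      by (simp add: n_def if_distrib sum.If_cases Int_def cong: if_cong)
    ultimately show ?thesis
      by (simp add: code_length_def \<kappa>_def sum_divide_distrib[symmetric])
  qed
  ultimately show ?thesis unfolding m_def s_def by blast
qed

section \<open>Integrality as divisibility, and the three bounds\<close>

lemma quotient_in_Ints_iff:
  assumes "s < m"
  shows "real m / (real m - real s) \<in> \<int> \<longleftrightarrow> (m - s) dvd m"
proof -
  have "real m - real s = real (m - s)" using assms by simp
  moreover have "real m / real (m - s) \<in> \<int> \<longleftrightarrow> (m - s) dvd m"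
  proof
    assume "real m / real (m - s) \<in> \<int>"
    then obtain z where "real m / real (m - s) = of_int z" by (auto elim: Ints_cases)
    then have "real_of_int (int m) = of_int (z * int (m - s))" using assms by (simp add: field_simps)
    then have "int m = z * int (m - s)" by (simp only: of_int_eq_iff)
    then have "int (m - s) dvd int m" by simp
    then show "(m - s) dvd m" by (simp only: of_nat_dvd_iff)
  next
    assume "(m - s) dvd m"
    then obtain k where "m = (m - s) * k" by (elim dvdE)
    then have "real m = real (m - s) * real k" by (metis of_nat_mult)
    then have "real m / real (m - s) = real k" using assms by (simp add: field_simps)
    then show "real m / real (m - s) \<in> \<int>" by simp
  qed
  ultimately show ?thesis by (simp only:)
qed

theorem theorem2:
  fixes m s :: nat
  assumes "1 \<le> s" and "s + 1 \<le> m"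
    and "\<not> (s \<in> {1, 2} \<and> m \<ge> 2 * s + 1)"
    and "\<not> (s \<in> {3, 4} \<and> odd m \<and> m \<ge> 7)"
    and "\<not> (odd m \<and> m = s + 2)"
  shows
    "(real m / (real m - real s) \<in> \<int> \<longrightarrow>
        (\<exists>\<kappa> n enc. valid_scheme m s \<kappa> n enc \<and> code_length m \<kappa> n \<le> real m / real s)) \<and>
     (real m / (real m - real s) \<notin> \<int> \<and> m > 2 * s \<longrightarrow>
        (\<exists>\<kappa> n enc. valid_scheme m s \<kappa> n enc \<and> linear_scheme m s \<kappa> enc \<and>
          code_length m \<kappa> n \<le> 3 * real m / (2 * real s) + 3)) \<and>
     (real m / (real m - real s) \<notin> \<int> \<and> m < 2 * s \<longrightarrow>
        (\<exists>\<kappa> n enc. valid_scheme m s \<kappa> n enc \<and> linear_scheme m s \<kappa> enc \<and>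
          code_length m \<kappa> n \<le> 2 + 7))"
proof -
  have sm: "s < m" "s \<le> m" "0 < m" using assms(2) by linarith+
  note dvd = quotient_in_Ints_iff[OF sm(1)]
  have "\<exists>\<kappa> n enc. valid_scheme m s \<kappa> n enc \<and> code_length m \<kappa> n \<le> real m / real s" if int: "real m / (real m - real s) \<in> \<int>"
  proof -
    define g where "g = m - s"
    have sg: "s + g = m" and g: "0 < g" using sm by (simp_all add: g_def)
    obtain t where t: "m = g * t"
      using int unfolding dvd g_def[symmetric] by (elim dvdE)
    have "t \<noteq> 0" "t \<noteq> 1" using t sg sm(3) assms(1) by (intro notI; simp)+
    then have t2: "2 \<le> t" by simp
    then obtain t' where "t = Suc t'" by (cases t) auto
    then have s: "s = g * (t - 1)" using sg t by simp
    have "real m / real s = real t / real (t - 1)" using g by (simp add: t s)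
    then show ?thesis
      using valid_scheme_dvd[OF t2 g] unfolding t[symmetric] s[symmetric] by (metis order_refl)
  qed
  moreover have "\<exists>\<kappa> n enc. valid_scheme m s \<kappa> n enc \<and> linear_scheme m s \<kappa> enc \<and>
      code_length m \<kappa> n \<le> 3 * real m / (2 * real s) + 3" if m: "2 * s < m"
  proof -
    have "3 \<le> s" using assms(1,3) m by (cases "s = 1"; cases "s = 2"; simp)
    moreover have "even m" if "s \<in> {3, 4}" using assms(4) that m by auto
    ultimately obtain N c where c: "good_code m s N c" "2 * s * N \<le> 3 * m + 6 * s"
      using good_sparse[OF m] by blast
    have "real (2 * s * N) \<le> real (3 * m + 6 * s)" using c(2) by (simp only: of_nat_le_iff)
    then have "real N \<le> 3 * real m / (2 * real s) + 3" using assms(1) by (simp add: field_simps)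
    then show ?thesis
      using good_code_scheme[OF c(1) sm(2,3)] by metis
  qed
  moreover have "\<exists>\<kappa> n enc. valid_scheme m s \<kappa> n enc \<and> linear_scheme m s \<kappa> enc \<and>
      code_length m \<kappa> n \<le> 2 + 7"
    if ni: "real m / (real m - real s) \<notin> \<int>" and m: "m < 2 * s"
  proof -
    \<comment> \<open>This pair falls under the exclusion of odd \<open>m \<ge> 7\<close> with
      \<open>s = 4\<close>; it is the only use of that exclusion in the dense case.\<close>
    have "\<not> (m = 7 \<and> s = 4)" using assms(4) by auto
    then obtain N c where c: "good_code m s N c" "N \<le> 9"
      using good_dense[OF m sm(1) _ assms(5)] ni unfolding dvd by blast
    then show ?thesis
      using good_code_scheme[OF c(1) sm(2,3)] by (metis numeral_plus_numeral add_num_simps of_nat_le_iff of_nat_numeral)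
  qed
  ultimately show ?thesis by (intro conjI impI) simp_all
qed

end
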